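(* Let $d\ge 2$, let $K\subset\mathbb{R}^d$ be a convex body with center at the point $0\in K$, and let $\gamma\ge 0$. Assume the following. (1) $Z=\{Z(x,t):\ x\in\mathbb{R}^d,\ t\in\mathbb{R}\}$ is a measurable, mean-square continuous Gaussian random field, homogeneous and isotropic in space and stationary in time, with $\mathbb{E}[Z(x,t)]=0$, $\mathbb{E}[Z^2(x,t)]=1$ and $\mathbb{E}[Z(x,t)Z(y,s)]=C(\|x-y\|,|t-s|)\ge 0$. (2) $G:\mathbb{R}\to\mathbb{R}$ is a Borel function with $\mathbb{E}[G^2(Z(x,t))]<\infty$. (3) $G$ has Hermite rank $m\ge 1$, i.e. $\mathcal{J}_m\ne 0$ and $\mathcal{J}_n=0$ for all $1\le n\le m-1$, where $\mathcal{J}_n=\int_{\mathbb{R}}G(z)H_n(z)\phi(z)\,dz$. (4) (i) $C(z,\tau)\to 0$ if $\max\{z,\tau\}\to\infty$; and (ii) there exist $\delta_1\in(0,1)$ and $\delta_2\in(0,1)$ such that $$\lim_{T\to\infty}\frac{\sigma_{m,K}^2(T)}{T^{1+\delta_1}\,T^{\gamma d(1+\delta_2)}}=\infty .$$ Let $A_T=\int_0^T\int_{T^\gamma K}G(Z(x,t))\,dx\,dt$. Then the random variables $$Y_T=\frac{A_T-\mathbb{E}[A_T]}{|\mathcal{J}_m|\,\sigma_{m,K}(T)/m!}\qquad\text{and}\qquad Y_{m,T}=\frac{\operatorname{sgn}(\mathcal{J}_m)\int_0^T\int_{T^\gamma K}H_m(Z(x,t))\,dx\,dt}{\sigma_{m,K}(T)}$$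 have the same limiting distributions as $T\to\infty$ (if one of them exists).
   Context: A convex body in $\mathbb{R}^d$ is a compact convex set with non-empty interior. For $\gamma\ge 0$ and $T>0$, $T^\gamma K$ is the homothetic image of $K$ with center $0$ and scaling factor $T^\gamma$. $\phi(w)=\frac{1}{\sqrt{2\pi}}e^{-w^2/2}$ is the standard normal density. $H_n$ is the Hermite polynomial of order $n$ defined by $\frac{d^n}{dz^n}\phi(z)=(-1)^nH_n(z)\phi(z)$ (so $H_0=1$, $H_1(z)=z$, $H_2(z)=z^2-1$). Integrals of the random field are understood in the mean-square sense. For $n\ge 1$, $$\sigma_{n,K}^2(T)=\operatorname{Var}\Big(\int_0^T\int_{T^\gamma K}H_n(Z(x,t))\,dx\,dt\Big)=2\,n!\,T\int_0^T\Big(1-\frac{\tau}{T}\Big)\int_{T^\gamma K\times T^\gamma K}C^n(\|x-y\|,\tau)\,dx\,dy\,d\tau,$$ where $C^n$ is the $n$-th power of $C$, and $\sigma_{n,K}(T)$ is its nonnegative square root. *)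

theory Defs
  imports "HOL-Probability.Probability" "HOL-Library.Going_To_Filter"
begin

definition convex_body :: "'a::euclidean_space set \<Rightarrow> bool" where
  "convex_body K \<longleftrightarrow> compact K \<and> convex K \<and> interior K \<noteq> {}"

definition dilate :: "real \<Rightarrow> 'a::real_vector set \<Rightarrow> 'a set" where
  "dilate r K = (\<lambda>x. r *\<^sub>R x) ` K"

(* Solves (d/dz)^n phi(z) = (-1)^n H_n(z) phi(z), phi the standard normal density, for H_n(z). *)
definition hermite :: "nat \<Rightarrow> real \<Rightarrow> real" where
  "hermite n z = (-1) ^ n * (deriv ^^ n) std_normal_density z / std_normal_density z"

definition hermite_coeff :: "(real \<Rightarrow> real) \<Rightarrow> nat \<Rightarrow> real" where
  "hermite_coeff G n = (LINT z|lborel. G z * hermite n z * std_normal_density z)"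

definition hermite_rank :: "(real \<Rightarrow> real) \<Rightarrow> nat \<Rightarrow> bool" where
  "hermite_rank G m \<longleftrightarrow>
     1 \<le> m \<and> hermite_coeff G m \<noteq> 0 \<and> (\<forall>n. 1 \<le> n \<and> n \<le> m - 1 \<longrightarrow> hermite_coeff G n = 0)"

definition sq_integrable :: "'w measure \<Rightarrow> ('w \<Rightarrow> real) \<Rightarrow> bool" where
  "sq_integrable M X \<longleftrightarrow> X \<in> borel_measurable M \<and> integrable M (\<lambda>\<omega>. (X \<omega>)\<^sup>2)"

definition covariance :: "'w measure \<Rightarrow> ('w \<Rightarrow> real) \<Rightarrow> ('w \<Rightarrow> real) \<Rightarrow> real" where
  "covariance M X Y =
     (LINT \<omega>|M. (X \<omega> - (LINT \<omega>'|M. X \<omega>')) * (Y \<omega> - (LINT \<omega>'|M. Y \<omega>')))"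

(* Point masses count as (degenerate) normal laws. *)
definition gaussian_rv :: "'w measure \<Rightarrow> ('w \<Rightarrow> real) \<Rightarrow> bool" where
  "gaussian_rv M X \<longleftrightarrow> X \<in> borel_measurable M \<and>
     ((\<exists>\<mu> \<sigma>. 0 < \<sigma> \<and> distributed M lborel X (\<lambda>x. ennreal (normal_density \<mu> \<sigma> x))) \<or>
      (\<exists>\<mu>. AE \<omega> in M. X \<omega> = \<mu>))"

(* All finite-dimensional distributions are multivariate normal, i.e. all finite
   linear combinations are normal. *)
definition gaussian_field :: "'w measure \<Rightarrow> ('i \<Rightarrow> 'w \<Rightarrow> real) \<Rightarrow> bool" where
  "gaussian_field M X \<longleftrightarrow>
     (\<forall>I c. finite I \<longrightarrow> gaussian_rv M (\<lambda>\<omega>. \<Sum>i\<in>I. c i * X i \<omega>))"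

definition measurable_field ::
  "'w measure \<Rightarrow> ('i::topological_space \<Rightarrow> 'w \<Rightarrow> real) \<Rightarrow> bool" where
  "measurable_field M X \<longleftrightarrow> (\<lambda>(p, \<omega>). X p \<omega>) \<in> borel_measurable (borel \<Otimes>\<^sub>M M)"

definition ms_continuous ::
  "'w measure \<Rightarrow> ('i::topological_space \<Rightarrow> 'w \<Rightarrow> real) \<Rightarrow> bool" where
  "ms_continuous M X \<longleftrightarrow> (\<forall>p. sq_integrable M (X p)) \<and>
     (\<forall>p. ((\<lambda>q. LINT \<omega>|M. (X q \<omega> - X p \<omega>)\<^sup>2) \<longlongrightarrow> 0) (at p))"

(* Homogeneity, isotropy and stationarity in the wide sense (invariance of first and
   second moments); for Gaussian fields this is equivalent to invariance of the
   finite-dimensional distributions. *)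
definition moments_invariant ::
  "'w measure \<Rightarrow> ('i \<Rightarrow> 'w \<Rightarrow> real) \<Rightarrow> ('i \<Rightarrow> 'i) \<Rightarrow> bool" where
  "moments_invariant M X g \<longleftrightarrow>
     (\<forall>p. (LINT \<omega>|M. X (g p) \<omega>) = (LINT \<omega>|M. X p \<omega>)) \<and>
     (\<forall>p q. covariance M (X (g p)) (X (g q)) = covariance M (X p) (X q))"

definition homogeneous_in_space ::
  "'w measure \<Rightarrow> ('a::euclidean_space \<times> real \<Rightarrow> 'w \<Rightarrow> real) \<Rightarrow> bool" where
  "homogeneous_in_space M X \<longleftrightarrow> (\<forall>h. moments_invariant M X (\<lambda>(x, t). (x + h, t)))"

definition isotropic_in_space ::
  "'w measure \<Rightarrow> ('a::euclidean_space \<times> real \<Rightarrow> 'w \<Rightarrow> real) \<Rightarrow> bool" where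
  "isotropic_in_space M X \<longleftrightarrow>
     (\<forall>Q. orthogonal_transformation Q \<longrightarrow> moments_invariant M X (\<lambda>(x, t). (Q x, t)))"

definition stationary_in_time ::
  "'w measure \<Rightarrow> ('a::euclidean_space \<times> real \<Rightarrow> 'w \<Rightarrow> real) \<Rightarrow> bool" where
  "stationary_in_time M X \<longleftrightarrow> (\<forall>h. moments_invariant M X (\<lambda>(x, t). (x, t + h)))"

(* The mean-square Riemann integral over a bounded set S: the integrand is extended by
   zero to a box, and the Riemann sums converge to I in L^2(M) as the mesh tends to 0. *)
definition has_ms_integral ::
  "'w measure \<Rightarrow> 'i::euclidean_space set \<Rightarrow> ('i \<Rightarrow> 'w \<Rightarrow> real) \<Rightarrow> ('w \<Rightarrow> real) \<Rightarrow> bool" where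
  "has_ms_integral M S X I \<longleftrightarrow>
     bounded S \<and> (\<forall>p\<in>S. sq_integrable M (X p)) \<and> sq_integrable M I \<and>
     (\<forall>a b. S \<subseteq> cbox a b \<longrightarrow>
       (\<forall>e>0. \<exists>d>0. \<forall>D. D tagged_division_of cbox a b \<and> (\<lambda>p. ball p d) fine D \<longrightarrow>
          (LINT \<omega>|M. ((\<Sum>(p, k)\<in>D. if p \<in> S then measure lborel k * X p \<omega> else 0) - I \<omega>)\<^sup>2) < e))"

(* The integral is determined only up to almost sure equality; this picks a version. *)
definition ms_integral ::
  "'w measure \<Rightarrow> 'i::euclidean_space set \<Rightarrow> ('i \<Rightarrow> 'w \<Rightarrow> real) \<Rightarrow> 'w \<Rightarrow> real" where
  "ms_integral M S X = (SOME I. has_ms_integral M S X I)"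

(* The integral of g(Z(x,t)) over x in T^gamma K and t in [0,T]. *)
definition st_functional ::
  "'w measure \<Rightarrow> ('a::euclidean_space \<times> real \<Rightarrow> 'w \<Rightarrow> real) \<Rightarrow> 'a set \<Rightarrow> real \<Rightarrow>
     (real \<Rightarrow> real) \<Rightarrow> real \<Rightarrow> 'w \<Rightarrow> real" where
  "st_functional M Z K \<gamma> g T =
     ms_integral M (dilate (T powr \<gamma>) K \<times> {0..T}) (\<lambda>p \<omega>. g (Z p \<omega>))"

definition sigma2 ::
  "'w measure \<Rightarrow> ('a::euclidean_space \<times> real \<Rightarrow> 'w \<Rightarrow> real) \<Rightarrow> 'a set \<Rightarrow> real \<Rightarrow>
     nat \<Rightarrow> real \<Rightarrow> real" where
  "sigma2 M Z K \<gamma> n T = prob_space.variance M (st_functional M Z K \<gamma> (hermite n) T)"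

(* Convergence in distribution as T tends to infinity through the reals; the library's
   weak_conv_m is restricted to sequences. *)
definition conv_in_distr ::
  "'w measure \<Rightarrow> (real \<Rightarrow> 'w \<Rightarrow> real) \<Rightarrow> real measure \<Rightarrow> bool" where
  "conv_in_distr M Y \<mu> \<longleftrightarrow>
     (\<forall>x. isCont (cdf \<mu>) x \<longrightarrow>
        ((\<lambda>T. cdf (distr M borel (Y T)) x) \<longlongrightarrow> cdf \<mu> x) at_top)"

end

theory Submission
  imports Defs
begin

text \<open>
  For a standard Gaussian pair with correlation \<open>\<rho>\<close> one has
  \<open>E[H\<^sub>n(X) H\<^sub>k(Y)] = \<delta>\<^sub>n\<^sub>k n! \<rho>\<^sup>n\<close>. As the Hermite polynomials are complete, a function
  \<open>g\<close> orthogonal to \<open>H\<^sub>0, \<dots>, H\<^sub>m\<close> satisfies \<open>E[g(X) g(Y)] \<le> \<rho>\<^bsup>m+1\<^esup> E[g(X)\<^sup>2]\<close>. Apply this to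
  \<open>g = G - J\<^sub>0 - (J\<^sub>m/m!) H\<^sub>m\<close>. Since \<open>0 \<le> C \<le> 1\<close> and \<open>C \<le> \<epsilon>\<close> unless both the spatial and the
  temporal distance are at most some \<open>R\<close>, we get \<open>C\<^bsup>m+1\<^esup> \<le> \<epsilon> C\<^sup>m + 1\<^bsub>near\<^esub>\<close>, so the second moment
  of the integral of \<open>g(Z)\<close> is at most a constant times \<open>\<epsilon> \<sigma>\<^sup>2 + c(R) T\<^bsup>1+\<gamma>d\<^esup>\<close>, where
  \<open>\<sigma>\<^sup>2\<close> is the variance of the integral of \<open>H\<^sub>m(Z)\<close>. The growth condition makes
  \<open>T\<^bsup>1+\<gamma>d\<^esup>\<close> negligible against \<open>\<sigma>\<^sup>2\<close>, hence the difference of the two normalized functionals tends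
  to zero in mean square. The second moments are compared on the level of Riemann sums, which
  avoids iterated integrals of the covariance.
\<close>

section \<open>Hermite polynomials and jointly Gaussian pairs\<close>

text \<open>A Gaussian field is given only through the laws of its linear combinations, and two of
  its values may coincide or be fully correlated, so no bivariate density is available. The product
  formula for Hermite polynomials is therefore extracted from the moments of
  \<open>a X + b Y\<close>: comparing coefficients in \<open>b\<close> yields Gaussian integration
  by parts for polynomials, and that is all the formula needs. Other functions are reached by
  approximation in mean square, for which the marginal laws suffice.

  The second obstacle is the integral. It is a version, chosen by \<open>SOME\<close>, of a limit of
  Riemann sums, so its existence has to be proved, for a field whose paths may be discontinuous, and
  the chosen versions need not be linear in the integrand. Hence the functional of \<open>G\<close>,
  the functional of \<open>H_m\<close> and the remainder are compared on one common division, where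
  the algebra is exact, and only the errors are sent to zero. As \<open>sigma2\<close> is a variance
  by definition, everything is estimated relative to it and it is never evaluated.\<close>

fun hermite_poly :: "nat \<Rightarrow> real poly" where
  "hermite_poly 0 = 1"
| "hermite_poly (Suc n) = [:0, 1:] * hermite_poly n - pderiv (hermite_poly n)"

text \<open>Since \<phi>' = - z \<phi>, differentiating p \<phi> gives - (z p - p') \<phi>; the
  recursion of \<open>hermite_poly\<close> is this operation without the sign. Positivity of \<phi>
  permits the final cancellation.\<close>

lemma hermite_eq_poly: "hermite n z = poly (hermite_poly n) z"
proof -
  have d: "(std_normal_density has_real_derivative (- x * std_normal_density x)) (at x)" for x
  proof -
    have "((\<lambda>x. exp (- x\<^sup>2 / 2)) has_real_derivative (- x * exp (- x\<^sup>2 / 2))) (at x)"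
      by (auto intro!: derivative_eq_intros)
    from DERIV_cmult[OF this, of "1 / sqrt (2 * pi)"] show ?thesis
      unfolding std_normal_density_def by (simp add: mult_ac)
  qed
  have "(deriv ^^ n) std_normal_density = (\<lambda>z. (-1) ^ n * poly (hermite_poly n) z * std_normal_density z)"
  proof (induction n)
    case (Suc n)
    have "((\<lambda>z. (-1) ^ n * poly (hermite_poly n) z * std_normal_density z) has_real_derivative
      (-1) ^ Suc n * poly (hermite_poly (Suc n)) z * std_normal_density z) (at z)" for z
      by (auto intro!: derivative_eq_intros d simp: algebra_simps)
    then have "deriv (\<lambda>z. (-1) ^ n * poly (hermite_poly n) z * std_normal_density z) =
      (\<lambda>z. (-1) ^ Suc n * poly (hermite_poly (Suc n)) z * std_normal_density z)"
      by (intro ext DERIV_imp_deriv)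
    with Suc show ?case by simp
  qed simp
  then show ?thesis
    by (simp add: hermite_def normal_density_pos[THEN less_imp_neq, symmetric]
        flip: power_mult_distrib mult.assoc)
qed

text \<open>Differentiating the recursion and inserting the claim one order down leaves a multiple
  of z \<open>H_n\<close> - \<open>H_n\<close>', which is the next polynomial again. This lowering
  relation later acts on the second variable.\<close>

lemma pderiv_hermite_poly_Suc:
  "pderiv (hermite_poly (Suc n)) = smult (real (Suc n)) (hermite_poly n)"
proof (induction n)
  case (Suc n)
  have "pderiv (hermite_poly (Suc (Suc n))) =
    hermite_poly (Suc n) + smult (real (Suc n)) ([:0, 1:] * hermite_poly n - pderiv (hermite_poly n))"
    by (subst hermite_poly.simps)
      (simp only: pderiv_diff pderiv_mult Suc pderiv_smult, simp add: pderiv_pCons algebra_simps smult_diff_right)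
  also have "\<dots> = hermite_poly (Suc n) + smult (real (Suc n)) (hermite_poly (Suc n))"
    by (simp only: hermite_poly.simps)
  also have "\<dots> = smult (real (Suc (Suc n))) (hermite_poly (Suc n))"
    by (simp only: of_nat_Suc smult_add_left smult_1_left ac_simps)
  finally show ?case .
qed (simp add: pderiv_pCons)

declare hermite_poly.simps(2) [simp del]

lemma hermite_measurable [measurable]: "hermite n \<in> borel_measurable borel"
  unfolding hermite_eq_poly[abs_def]
  by (intro borel_measurable_continuous_onI continuous_intros)

lemma poly_measurable [measurable]: "poly (p :: real poly) \<in> borel_measurable borel"
  by (intro borel_measurable_continuous_onI continuous_intros)

text \<open>Expectations are linear in each polynomial, so their identities need checking on
  monomials only; with the coefficient included there is no separate case for scaling.\<close>

lemma poly_induct_monom [case_names monom add]: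
  assumes "\<And>c n. P (monom c n)" and "\<And>p q. P p \<Longrightarrow> P q \<Longrightarrow> P (p + q)"
  shows "P (p :: 'a::comm_monoid_add poly)"
proof -
  have "P (\<Sum>i\<in>A. monom (coeff p i) i)" if "finite A" for A
    using that
  proof (induction A)
    case empty
    show ?case using assms(1)[of 0 0] by simp
  qed (use assms in simp)
  then have "P (\<Sum>i\<le>degree p. monom (coeff p i) i)" by simp
  then show ?thesis by (simp add: poly_as_sum_of_monoms)
qed

lemma abs_mult_le_sum_squares: "\<bar>x * y\<bar> \<le> \<bar>x\<^sup>2 + y\<^sup>2\<bar>" for x y :: real
proof -
  have "2 * \<bar>x * y\<bar> \<le> x\<^sup>2 + y\<^sup>2"
    using sum_squares_bound[of "\<bar>x\<bar>" "\<bar>y\<bar>"] by (simp add: abs_mult)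
  then show ?thesis by linarith
qed

locale gaussian_pair = prob_space M for M :: "'w measure" +
  fixes X Y :: "'w \<Rightarrow> real" and \<rho> :: real
  assumes X_measurable [measurable]: "X \<in> borel_measurable M"
    and Y_measurable [measurable]: "Y \<in> borel_measurable M"
    and even_moments: "\<And>(a::real) (b::real) k. has_bochner_integral M (\<lambda>\<omega>. (a * X \<omega> + b * Y \<omega>) ^ (2 * k))
      (fact (2 * k) / (2 ^ k * fact k) * (a\<^sup>2 + 2 * a * b * \<rho> + b\<^sup>2) ^ k)"
    and odd_moments: "\<And>(a::real) (b::real) k. has_bochner_integral M (\<lambda>\<omega>. (a * X \<omega> + b * Y \<omega>) ^ (2 * k + 1)) 0"
begin

lemma swap: "gaussian_pair M Y X \<rho>"
proof unfold_locales
  fix a b k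
  show "has_bochner_integral M (\<lambda>\<omega>. (a * Y \<omega> + b * X \<omega>) ^ (2 * k))
      (fact (2 * k) / (2 ^ k * fact k) * (a\<^sup>2 + 2 * a * b * \<rho> + b\<^sup>2) ^ k)"
    using even_moments[of b a k] by (simp add: ac_simps)
  show "has_bochner_integral M (\<lambda>\<omega>. (a * Y \<omega> + b * X \<omega>) ^ (2 * k + 1)) 0"
    using odd_moments[of b a k] by (simp only: add.commute)
qed simp_all

lemma integrable_monom: "integrable M (\<lambda>\<omega>. X \<omega> ^ i * Y \<omega> ^ j)"
proof -
  have "integrable M (\<lambda>\<omega>. X \<omega> ^ (2 * i) + Y \<omega> ^ (2 * j))"
    using integrable.intros[OF even_moments[of 1 0 i]] integrable.intros[OF even_moments[of 0 1 j]]
    by (intro Bochner_Integration.integrable_add) simp_all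
  then show ?thesis
  proof (rule Bochner_Integration.integrable_bound)
    have "\<bar>x ^ i * y ^ j\<bar> \<le> \<bar>x ^ (2 * i) + y ^ (2 * j)\<bar>" for x y :: real
      using abs_mult_le_sum_squares[of "x ^ i" "y ^ j"] by (simp only: mult.commute[of 2] power_mult)
    then show "AE \<omega> in M. norm (X \<omega> ^ i * Y \<omega> ^ j) \<le> norm (X \<omega> ^ (2 * i) + Y \<omega> ^ (2 * j))"
      by simp
  qed simp
qed

lemma integrable_poly: "integrable M (\<lambda>\<omega>. poly p (X \<omega>) * poly q (Y \<omega>))"
proof (induction p rule: poly_induct_monom)
  case (monom c i)
  show ?case
  proof (induction q rule: poly_induct_monom)
    case (monom d j)
    have "integrable M (\<lambda>\<omega>. c * d * (X \<omega> ^ i * Y \<omega> ^ j))"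
      by (intro integrable_mult_right integrable_monom)
    then show ?case by (simp add: poly_monom ac_simps)
  qed (simp add: algebra_simps)
qed (simp add: algebra_simps)

definition mixed_moment :: "nat \<Rightarrow> nat \<Rightarrow> real" where
  "mixed_moment i j = expectation (\<lambda>\<omega>. X \<omega> ^ i * Y \<omega> ^ j)"

lemma expectation_linear_power:
  fixes a b :: real
  shows "expectation (\<lambda>\<omega>. (a * X \<omega> + b * Y \<omega>) ^ n) = (\<Sum>j\<le>n. (n choose j) * b ^ j * a ^ (n - j) * mixed_moment (n - j) j)"
proof -
  have "(a * X \<omega> + b * Y \<omega>) ^ n =
      (\<Sum>j\<le>n. (n choose j) * b ^ j * a ^ (n - j) * (X \<omega> ^ (n - j) * Y \<omega> ^ j))" for \<omega>
    by (subst add.commute, subst binomial_ring) (simp add: power_mult_distrib ac_simps)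
  then show ?thesis
    unfolding mixed_moment_def by (simp add: Bochner_Integration.integral_sum integrable_monom del: binomial_Suc_Suc)
qed

text \<open>Integration by parts for powers of a linear combination. For n = 2k the inner derivative
  at a = 1 is 2 (1 + b \<rho>), and the double factorials satisfy c_{k+1} (2k+2) = (n+2)(n+1) c_k,
  so the next lower even moment reappears. For odd n both moments vanish.\<close>

lemma DERIV_linear_power_moment:
  fixes b :: real
  shows "((\<lambda>a. expectation (\<lambda>\<omega>. (a * X \<omega> + b * Y \<omega>) ^ (n + 2))) has_real_derivative
     (real n + 2) * (real n + 1) * (1 + b * \<rho>) * expectation (\<lambda>\<omega>. (1 * X \<omega> + b * Y \<omega>) ^ n)) (at 1)"
proof (cases "even n")
  case True
  then obtain k where n: "n = 2 * k" by auto
  define c where "c k = (fact (2 * k) / (2 ^ k * fact k) :: real)" for k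
  have c: "c (Suc k) * (real k + 1) * 2 = (real n + 2) * (real n + 1) * c k"
    unfolding c_def n by (simp add: divide_simps) (simp add: algebra_simps)
  have e: "expectation (\<lambda>\<omega>. (a * X \<omega> + b * Y \<omega>) ^ (2 * k)) = c k * (a\<^sup>2 + 2 * a * b * \<rho> + b\<^sup>2) ^ k" for a k
    unfolding c_def by (rule has_bochner_integral_integral_eq[OF even_moments])
  have "((\<lambda>a. c (Suc k) * (a\<^sup>2 + 2 * a * b * \<rho> + b\<^sup>2) ^ Suc k) has_real_derivative
      c (Suc k) * (real k + 1) * 2 * (1 + b * \<rho>) * (1\<^sup>2 + 2 * 1 * b * \<rho> + b\<^sup>2) ^ k) (at 1)"
  proof -
    have "((\<lambda>a. a\<^sup>2 + 2 * a * b * \<rho> + b\<^sup>2) has_real_derivative 2 * (1 + b * \<rho>)) (at 1)"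
      by (auto intro!: derivative_eq_intros simp: algebra_simps)
    then show ?thesis
      by (rule DERIV_cong[OF DERIV_cmult[OF DERIV_power[of _ _ _ _ "Suc k"]]]) (simp add: algebra_simps)
  qed
  moreover have "n + 2 = 2 * Suc k" using n by simp
  ultimately show ?thesis
    using e[of _ "Suc k"] e[of 1 k] unfolding c by (simp add: n mult_ac)
next
  case False
  then obtain k where n: "n = 2 * k + 1" by (auto elim: oddE)
  have e: "expectation (\<lambda>\<omega>. (a * X \<omega> + b * Y \<omega>) ^ (2 * k + 1)) = 0" for a k
    by (rule has_bochner_integral_integral_eq[OF odd_moments])
  moreover have "n + 2 = 2 * Suc k + 1" using n by simp
  ultimately show ?thesis
    by (simp only: n) simp
qed

text \<open>
  Both expressions for the derivative of \<open>E[(a X + b Y)\<^bsup>n+2\<^esup>]\<close> in \<open>a\<close> at \<open>a = 1\<close> are polynomials in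
  \<open>b\<close>; the recursion compares their coefficients of \<open>b\<^sup>j\<close>.
\<close>

lemma mixed_moment_binomial_recursion:
  assumes "j \<le> n + 2"
  shows "((n + 2) choose j) * real (n + 2 - j) * mixed_moment (n + 2 - j) j =
    (real n + 2) * (real n + 1) *
      ((n choose j) * mixed_moment (n - j) j + \<rho> * (if j = 0 then 0 else (n choose (j - 1)) * mixed_moment (n - (j - 1)) (j - 1)))"
proof -
  define P where "P = (\<Sum>j\<le>n+2. monom (((n + 2) choose j) * real (n + 2 - j) * mixed_moment (n + 2 - j) j) j)"
  define R where "R = (\<Sum>j\<le>n. monom ((n choose j) * mixed_moment (n - j) j) j)"
  have coeff_sum_monom: "coeff (\<Sum>j\<le>N. monom (f j) j) i = (if i \<le> N then f i else 0)" for f :: "nat \<Rightarrow> real" and N i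
    by (simp add: coeff_sum coeff_monom)
  have cR: "coeff R i = (n choose i) * mixed_moment (n - i) i" for i
    by (simp add: R_def coeff_sum_monom binomial_eq_0)
  have "poly P b = poly (smult ((real n + 2) * (real n + 1)) ([:1, \<rho>:] * R)) b" for b
  proof -
    have "((\<lambda>a. \<Sum>j\<le>n+2. ((n + 2) choose j) * b ^ j * a ^ (n + 2 - j) * mixed_moment (n + 2 - j) j) has_real_derivative
        (\<Sum>j\<le>n+2. ((n + 2) choose j) * b ^ j * real (n + 2 - j) * mixed_moment (n + 2 - j) j)) (at 1)"
      by (auto intro!: derivative_eq_intros sum.cong simp del: binomial_Suc_Suc)
    then have d: "((\<lambda>a. \<Sum>j\<le>n+2. ((n + 2) choose j) * b ^ j * a ^ (n + 2 - j) * mixed_moment (n + 2 - j) j) has_real_derivative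
        poly P b) (at 1)"
      by (simp add: P_def poly_sum poly_monom mult_ac del: binomial_Suc_Suc)
    have "(\<Sum>j\<le>n. (n choose j) * b ^ j * 1 ^ (n - j) * mixed_moment (n - j) j) = poly R b"
      by (simp add: R_def poly_sum poly_monom mult_ac)
    moreover have "poly P b = (real n + 2) * (real n + 1) * (1 + b * \<rho>) *
        expectation (\<lambda>\<omega>. (1 * X \<omega> + b * Y \<omega>) ^ n)"
    proof (rule DERIV_unique[OF d])
      have "(\<lambda>a. \<Sum>j\<le>n+2. ((n + 2) choose j) * b ^ j * a ^ (n + 2 - j) * mixed_moment (n + 2 - j) j) =
          (\<lambda>a. expectation (\<lambda>\<omega>. (a * X \<omega> + b * Y \<omega>) ^ (n + 2)))"
        by (rule ext, rule expectation_linear_power[symmetric])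
      then show "((\<lambda>a. \<Sum>j\<le>n+2. ((n + 2) choose j) * b ^ j * a ^ (n + 2 - j) * mixed_moment (n + 2 - j) j) has_real_derivative
         (real n + 2) * (real n + 1) * (1 + b * \<rho>) * expectation (\<lambda>\<omega>. (1 * X \<omega> + b * Y \<omega>) ^ n)) (at 1)"
        using DERIV_linear_power_moment[of b n] by (simp only:)
    qed
    moreover have "expectation (\<lambda>\<omega>. (1 * X \<omega> + b * Y \<omega>) ^ n) = (\<Sum>j\<le>n. (n choose j) * b ^ j * 1 ^ (n - j) * mixed_moment (n - j) j)"
      by (rule expectation_linear_power)
    ultimately have "poly P b = (real n + 2) * (real n + 1) * (1 + b * \<rho>) * poly R b" by (simp only:)
    then show ?thesis by (simp add: algebra_simps)
  qed
  then have "P = smult ((real n + 2) * (real n + 1)) ([:1, \<rho>:] * R)"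
    by (simp add: poly_eq_poly_eq_iff[symmetric] fun_eq_iff)
  then have "coeff P j = coeff (smult ((real n + 2) * (real n + 1)) ([:1, \<rho>:] * R)) j" by simp
  moreover have "coeff P j = ((n + 2) choose j) * real (n + 2 - j) * mixed_moment (n + 2 - j) j"
    using assms by (simp only: P_def coeff_sum_monom if_True)
  ultimately show ?thesis
    by (cases j) (simp_all add: cR coeff_pCons del: binomial_Suc_Suc)
qed

text \<open>This is the coefficient recursion in total degree n + 2 = i + j + 1, divided by F =
  (n+2)!/(i! j!): each binomial with its factors is F times 1, i or j. The case i + j = 0 is
  separate because n would be -1; there the claim is E X = 0.\<close>

lemma stein_monom:
  "mixed_moment (Suc i) j = i * mixed_moment (i - 1) j + \<rho> * j * mixed_moment i (j - 1)"
proof (cases "i + j = 0")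
  case True
  then show ?thesis
    using has_bochner_integral_integral_eq[OF odd_moments[of 1 0 0]] by (simp add: mixed_moment_def)
next
  case False
  define n where "n = i + j - 1"
  with False have n: "n + 1 = i + j" by simp
  have r: "((n + 2) choose j) * real (Suc i) * mixed_moment (Suc i) j =
    (real n + 2) * (real n + 1) *
      ((n choose j) * mixed_moment (n - j) j + \<rho> * (if j = 0 then 0 else (n choose (j - 1)) * mixed_moment (n - (j - 1)) (j - 1)))"
  proof -
    have "n + 2 - j = Suc i" "j \<le> n + 2" using n by auto
    then show ?thesis using mixed_moment_binomial_recursion[of j n] by simp
  qed
  have b: "((n + 2) choose j) * real (Suc i) = fact (n + 2) / (fact j * fact i)"
    using binomial_fact[of j "n + 2", where 'a=real] n by (simp add: Suc_diff_le del: binomial_Suc_Suc fact_Suc)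
      (simp add: divide_simps del: binomial_Suc_Suc)
  have b1: "(real n + 2) * (real n + 1) * (n choose j) = fact (n + 2) / (fact j * fact i) * i"
  proof (cases i)
    case 0
    then show ?thesis using n by (simp add: binomial_eq_0)
  next
    case (Suc i')
    then have "real (n choose j) = fact n / (fact j * fact i')"
      using binomial_fact[of j n, where 'a=real] n by simp
    then show ?thesis by (simp only: Suc) (simp add: divide_simps, simp add: algebra_simps)
  qed
  have b2: "(real n + 2) * (real n + 1) * (n choose (j - 1)) = fact (n + 2) / (fact j * fact i) * j" if nz: "j \<noteq> 0"
  proof -
    obtain j' where j: "j = Suc j'" using nz by (cases j) auto
    then have "real (n choose j') = fact n / (fact j' * fact i)"
      using binomial_fact[of j' n, where 'a=real] n by simp
    then show ?thesis by (simp only: j diff_Suc_1) (simp add: divide_simps, simp add: algebra_simps)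
  qed
  define F where "F = (fact (n + 2) / (fact j * fact i) :: real)"
  have "F * mixed_moment (Suc i) j =
      ((real n + 2) * (real n + 1) * (n choose j)) * mixed_moment (n - j) j +
      \<rho> * (if j = 0 then 0 else ((real n + 2) * (real n + 1) * (n choose (j - 1))) * mixed_moment (n - (j - 1)) (j - 1))"
    using r unfolding b F_def[symmetric] by (cases "j = 0") (simp_all add: algebra_simps del: binomial_Suc_Suc)
  also have "\<dots> = F * (i * mixed_moment (n - j) j) + \<rho> * (F * (j * mixed_moment (n - (j - 1)) (j - 1)))"
    unfolding b1 F_def[symmetric] using b2 by (simp add: F_def)
  also have "real i * mixed_moment (n - j) j = i * mixed_moment (i - 1) j"
    using n by (cases i) auto
  also have "real j * mixed_moment (n - (j - 1)) (j - 1) = j * mixed_moment i (j - 1)"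
    using n by (cases j) auto
  finally have "F * mixed_moment (Suc i) j = F * (i * mixed_moment (i - 1) j + \<rho> * j * mixed_moment i (j - 1))"
    by (simp add: algebra_simps)
  moreover have "F \<noteq> 0" by (simp add: F_def del: fact_Suc)
  ultimately show ?thesis by simp
qed

text \<open>Gaussian integration by parts, obtained as the bilinear extension of
  \<open>stein_monom\<close> and thus valid for degenerate pairs as well.\<close>

lemma stein:
  "expectation (\<lambda>\<omega>. X \<omega> * poly p (X \<omega>) * poly q (Y \<omega>)) =
   expectation (\<lambda>\<omega>. poly (pderiv p) (X \<omega>) * poly q (Y \<omega>)) + \<rho> * expectation (\<lambda>\<omega>. poly p (X \<omega>) * poly (pderiv q) (Y \<omega>))"
proof -
  have i: "integrable M (\<lambda>\<omega>. X \<omega> * poly p (X \<omega>) * poly q (Y \<omega>))" for p q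
    using integrable_poly[of "[:0, 1:] * p" q] by simp
  show ?thesis
  proof (induction p rule: poly_induct_monom)
    case (monom c i)
    show ?case
    proof (induction q rule: poly_induct_monom)
      case (monom d j)
      have "expectation (\<lambda>\<omega>. c * d * (X \<omega> ^ Suc i * Y \<omega> ^ j)) =
        expectation (\<lambda>\<omega>. c * d * i * (X \<omega> ^ (i - 1) * Y \<omega> ^ j)) + \<rho> * expectation (\<lambda>\<omega>. c * d * j * (X \<omega> ^ i * Y \<omega> ^ (j - 1)))"
        using stein_monom[of i j] unfolding mixed_moment_def integral_mult_right_zero by (simp add: algebra_simps)
      then show ?case
        by (simp add: pderiv_monom poly_monom ac_simps)
    next
      case (add p' q')
      from add show ?case
        by (simp add: pderiv_add distrib_left distrib_right i integrable_poly Bochner_Integration.integral_add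
            del: integral_mult_right_zero)
    qed
  next
    case (add p' q')
    from add show ?case
      by (simp add: pderiv_add distrib_left distrib_right i integrable_poly Bochner_Integration.integral_add)
  qed
qed

text \<open>The derivative subtracted in the Hermite recursion cancels the first term of
  \<open>stein\<close>. What remains trades one Hermite order in X for a derivative in Y and a
  factor \<rho>.\<close>

lemma expectation_hermite_Suc:
  "expectation (\<lambda>\<omega>. poly (hermite_poly (Suc n)) (X \<omega>) * poly q (Y \<omega>)) =
   \<rho> * expectation (\<lambda>\<omega>. poly (hermite_poly n) (X \<omega>) * poly (pderiv q) (Y \<omega>))"
proof -
  have i: "integrable M (\<lambda>\<omega>. X \<omega> * poly p (X \<omega>) * poly q (Y \<omega>))" for p q
    using integrable_poly[of "[:0, 1:] * p" q] by simp
  have "expectation (\<lambda>\<omega>. poly (hermite_poly (Suc n)) (X \<omega>) * poly q (Y \<omega>)) =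
    expectation (\<lambda>\<omega>. X \<omega> * poly (hermite_poly n) (X \<omega>) * poly q (Y \<omega>)) -
    expectation (\<lambda>\<omega>. poly (pderiv (hermite_poly n)) (X \<omega>) * poly q (Y \<omega>))"
    by (simp add: hermite_poly.simps i integrable_poly left_diff_distrib flip: Bochner_Integration.integral_diff)
  then show ?thesis using stein[of "hermite_poly n" q] by simp
qed

lemma expectation_hermite_Suc_Suc:
  "expectation (\<lambda>\<omega>. hermite (Suc n) (X \<omega>) * hermite (Suc k) (Y \<omega>)) =
   \<rho> * (real k + 1) * expectation (\<lambda>\<omega>. hermite n (X \<omega>) * hermite k (Y \<omega>))"
proof -
  have "(\<lambda>\<omega>. poly (hermite_poly n) (X \<omega>) * poly (pderiv (hermite_poly (Suc k))) (Y \<omega>)) =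
    (\<lambda>\<omega>. (real k + 1) * (poly (hermite_poly n) (X \<omega>) * poly (hermite_poly k) (Y \<omega>)))"
    by (simp only: pderiv_hermite_poly_Suc) (auto simp: algebra_simps)
  then show ?thesis
    using expectation_hermite_Suc[of n "hermite_poly (Suc k)"]
    by (simp only: hermite_eq_poly integral_mult_right_zero mult.assoc)
qed

lemma expectation_hermite_0_Suc: "expectation (\<lambda>\<omega>. hermite (Suc n) (X \<omega>) * hermite 0 (Y \<omega>)) = 0"
  using expectation_hermite_Suc[of n 1] by (simp add: hermite_eq_poly)

end

text \<open>Each step lowers both orders at the price of a factor \<rho> and the current order. If
  one order reaches zero before the other, its constant polynomial has derivative zero; should this
  be the order at X, the roles are exchanged by \<open>swap\<close>.\<close>

lemma (in gaussian_pair) expectation_hermite: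
  "expectation (\<lambda>\<omega>. hermite n (X \<omega>) * hermite k (Y \<omega>)) = (if n = k then fact n * \<rho> ^ n else 0)"
proof (induction n arbitrary: k)
  case 0
  show ?case
  proof (cases k)
    case 0
    then show ?thesis by (simp add: hermite_eq_poly prob_space)
  next
    case (Suc k')
    then show ?thesis
      using gaussian_pair.expectation_hermite_0_Suc[OF swap, of k'] by (simp add: mult.commute)
  qed
next
  case (Suc n)
  show ?case
  proof (cases k)
    case 0
    then show ?thesis using expectation_hermite_0_Suc[of n] by simp
  next
    case (Suc k')
    then show ?thesis using Suc.IH[of k'] by (simp add: expectation_hermite_Suc_Suc)
  qed
qed

section \<open>Completeness of the space of square integrable random variables\<close>

text \<open>The discriminant inequality, including c = 0, where the quadratic is affine and must
  have slope zero. It yields Cauchy-Schwarz both for random variables and for Riemann sum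
  errors.\<close>

lemma quadratic_nonneg_imp:
  fixes a b c :: real
  assumes q: "\<And>t. 0 \<le> a + 2 * t * b + t\<^sup>2 * c" and c: "c \<ge> 0"
  shows "b\<^sup>2 \<le> a * c"
proof (cases "c = 0")
  case True
  have "b = 0"
  proof (rule ccontr)
    assume "b \<noteq> 0"
    \<comment> \<open>At this t the affine function a + 2 t b takes the value -1.\<close>
    then have "2 * (- (a + 1) / (2 * b)) * b = - (a + 1)" by simp
    with q[of "- (a + 1) / (2 * b)"] True show False by simp
  qed
  then show ?thesis using True by simp
next
  case False
  with c have c: "c > 0" by simp
  have "a + 2 * (- b / c) * b + (- b / c)\<^sup>2 * c = a - b\<^sup>2 / c"
    using c by (simp add: field_simps power2_eq_square)
  then have "b\<^sup>2 / c \<le> a" using q[of "- b / c"] by linarith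
  then show ?thesis using c by (simp add: field_simps)
qed

context prob_space
begin

lemma sq_integrable_mult:
  assumes "sq_integrable M X" "sq_integrable M Y"
  shows "integrable M (\<lambda>\<omega>. X \<omega> * Y \<omega>)"
proof (rule Bochner_Integration.integrable_bound)
  show "integrable M (\<lambda>\<omega>. (X \<omega>)\<^sup>2 + (Y \<omega>)\<^sup>2)"
    using assms by (auto simp: sq_integrable_def)
  show "AE \<omega> in M. norm (X \<omega> * Y \<omega>) \<le> norm ((X \<omega>)\<^sup>2 + (Y \<omega>)\<^sup>2)"
    using abs_mult_le_sum_squares by simp
qed (use assms in \<open>auto simp: sq_integrable_def\<close>)

lemma sq_integrable_measurable [measurable_dest]: "sq_integrable M X \<Longrightarrow> X \<in> borel_measurable M"
  by (simp add: sq_integrable_def)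

lemma sq_integrable_power2: "sq_integrable M X \<Longrightarrow> integrable M (\<lambda>\<omega>. (X \<omega>)\<^sup>2)"
  by (simp add: sq_integrable_def)

lemma sq_integrable_integrable: "sq_integrable M X \<Longrightarrow> integrable M X"
  by (auto simp: sq_integrable_def intro: square_integrable_imp_integrable)

lemma sq_integrable_const [simp]: "sq_integrable M (\<lambda>_. c)"
  by (simp add: sq_integrable_def)

lemma sq_integrable_add [intro]:
  assumes "sq_integrable M X" "sq_integrable M Y"
  shows "sq_integrable M (\<lambda>\<omega>. X \<omega> + Y \<omega>)"
  using assms sq_integrable_mult[OF assms] by (auto simp: sq_integrable_def power2_sum mult.assoc)

lemma sq_integrable_cmult [intro]: "sq_integrable M X \<Longrightarrow> sq_integrable M (\<lambda>\<omega>. c * X \<omega>)"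
  by (auto simp: sq_integrable_def power_mult_distrib)

lemma sq_integrable_diff [intro]:
  assumes "sq_integrable M X" "sq_integrable M Y"
  shows "sq_integrable M (\<lambda>\<omega>. X \<omega> - Y \<omega>)"
  using sq_integrable_add[OF assms(1) sq_integrable_cmult[OF assms(2), of "-1"]] by simp

lemma sq_integrable_sum [intro]:
  "(\<And>i. i \<in> I \<Longrightarrow> sq_integrable M (X i)) \<Longrightarrow> sq_integrable M (\<lambda>\<omega>. \<Sum>i\<in>I. X i \<omega>)"
  by (induction I rule: infinite_finite_induct) auto

lemma Cauchy_Schwarz:
  assumes "sq_integrable M X" "sq_integrable M Y"
  shows "(expectation (\<lambda>\<omega>. X \<omega> * Y \<omega>))\<^sup>2 \<le> expectation (\<lambda>\<omega>. (X \<omega>)\<^sup>2) * expectation (\<lambda>\<omega>. (Y \<omega>)\<^sup>2)"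
proof -
  let ?A = "expectation (\<lambda>\<omega>. (X \<omega>)\<^sup>2)" and ?B = "expectation (\<lambda>\<omega>. X \<omega> * Y \<omega>)" and ?C = "expectation (\<lambda>\<omega>. (Y \<omega>)\<^sup>2)"
  note [simp] = sq_integrable_power2[OF assms(1)] sq_integrable_power2[OF assms(2)] sq_integrable_mult[OF assms]
  have q: "0 \<le> ?A + 2 * t * ?B + t\<^sup>2 * ?C" for t
  proof -
    have "0 \<le> expectation (\<lambda>\<omega>. (X \<omega> + t * Y \<omega>)\<^sup>2)" by simp
    also have "(\<lambda>\<omega>. (X \<omega> + t * Y \<omega>)\<^sup>2) = (\<lambda>\<omega>. (X \<omega>)\<^sup>2 + 2 * t * (X \<omega> * Y \<omega>) + t\<^sup>2 * (Y \<omega>)\<^sup>2)"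
      by (auto simp: power2_eq_square algebra_simps)
    finally show ?thesis by simp
  qed
  show ?thesis by (rule quadratic_nonneg_imp[OF q]) simp
qed

lemma expectation_square_le:
  assumes "sq_integrable M X" shows "(expectation X)\<^sup>2 \<le> expectation (\<lambda>\<omega>. (X \<omega>)\<^sup>2)"
  using Cauchy_Schwarz[OF assms sq_integrable_const[of 1]] by (simp add: prob_space)

lemma expectation_square_add_le:
  assumes "sq_integrable M X" "sq_integrable M Y"
  shows "expectation (\<lambda>\<omega>. (X \<omega> + Y \<omega>)\<^sup>2) \<le> 2 * expectation (\<lambda>\<omega>. (X \<omega>)\<^sup>2) + 2 * expectation (\<lambda>\<omega>. (Y \<omega>)\<^sup>2)"
proof -
  have "expectation (\<lambda>\<omega>. (X \<omega> + Y \<omega>)\<^sup>2) \<le> expectation (\<lambda>\<omega>. 2 * (X \<omega>)\<^sup>2 + 2 * (Y \<omega>)\<^sup>2)"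
  proof (rule integral_mono)
    show "(X \<omega> + Y \<omega>)\<^sup>2 \<le> 2 * (X \<omega>)\<^sup>2 + 2 * (Y \<omega>)\<^sup>2" for \<omega>
      using sum_squares_bound[of "X \<omega>" "Y \<omega>"] by (simp add: power2_sum)
  qed (use assms sq_integrable_add[OF assms] in \<open>auto simp: sq_integrable_def\<close>)
  then show ?thesis using assms by (simp add: sq_integrable_def)
qed

lemma expectation_square_diff_le:
  assumes "sq_integrable M X" "sq_integrable M Y"
  shows "expectation (\<lambda>\<omega>. (X \<omega> - Y \<omega>)\<^sup>2) \<le> 2 * expectation (\<lambda>\<omega>. (X \<omega>)\<^sup>2) + 2 * expectation (\<lambda>\<omega>. (Y \<omega>)\<^sup>2)"
  using expectation_square_add_le[OF assms(1) sq_integrable_cmult[OF assms(2), of "-1"]] by simp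

lemma L2_tendsto_mult_null:
  assumes "\<And>n. sq_integrable M (u n)" "\<And>n. sq_integrable M (v n)"
    and "(\<lambda>n. expectation (\<lambda>\<omega>. (u n \<omega>)\<^sup>2)) \<longlonglongrightarrow> 0" "(\<lambda>n. expectation (\<lambda>\<omega>. (v n \<omega>)\<^sup>2)) \<longlonglongrightarrow> c"
  shows "(\<lambda>n. expectation (\<lambda>\<omega>. u n \<omega> * v n \<omega>)) \<longlonglongrightarrow> 0"
proof (rule Lim_null_comparison)
  have "\<bar>expectation (\<lambda>\<omega>. u n \<omega> * v n \<omega>)\<bar> \<le> sqrt (expectation (\<lambda>\<omega>. (u n \<omega>)\<^sup>2) * expectation (\<lambda>\<omega>. (v n \<omega>)\<^sup>2))" for n
    using Cauchy_Schwarz[OF assms(1,2)] by (intro real_le_rsqrt) simp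
  then show "\<forall>\<^sub>F n in sequentially. norm (expectation (\<lambda>\<omega>. u n \<omega> * v n \<omega>)) \<le> sqrt (expectation (\<lambda>\<omega>. (u n \<omega>)\<^sup>2) * expectation (\<lambda>\<omega>. (v n \<omega>)\<^sup>2))"
    by simp
  show "(\<lambda>n. sqrt (expectation (\<lambda>\<omega>. (u n \<omega>)\<^sup>2) * expectation (\<lambda>\<omega>. (v n \<omega>)\<^sup>2))) \<longlonglongrightarrow> 0"
    using tendsto_real_sqrt[OF tendsto_mult[OF assms(3,4)]] by simp
qed

lemma L2_tendsto_mult:
  assumes f: "\<And>n. sq_integrable M (f n)" "sq_integrable M f'" and g: "\<And>n. sq_integrable M (g n)" "sq_integrable M g'"
    and lim: "(\<lambda>n. expectation (\<lambda>\<omega>. (f n \<omega> - f' \<omega>)\<^sup>2)) \<longlonglongrightarrow> 0" "(\<lambda>n. expectation (\<lambda>\<omega>. (g n \<omega> - g' \<omega>)\<^sup>2)) \<longlonglongrightarrow> 0"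
  shows "(\<lambda>n. expectation (\<lambda>\<omega>. f n \<omega> * g n \<omega>)) \<longlonglongrightarrow> expectation (\<lambda>\<omega>. f' \<omega> * g' \<omega>)"
proof -
  note fd = sq_integrable_diff[OF f] and gd = sq_integrable_diff[OF g]
  have "expectation (\<lambda>\<omega>. f n \<omega> * g n \<omega>) = expectation (\<lambda>\<omega>. (f n \<omega> - f' \<omega>) * (g n \<omega> - g' \<omega>)) +
      expectation (\<lambda>\<omega>. (f n \<omega> - f' \<omega>) * g' \<omega>) + expectation (\<lambda>\<omega>. (g n \<omega> - g' \<omega>) * f' \<omega>) +
      expectation (\<lambda>\<omega>. f' \<omega> * g' \<omega>)" for n
  proof -
    have "(\<lambda>\<omega>. f n \<omega> * g n \<omega>) = (\<lambda>\<omega>. (f n \<omega> - f' \<omega>) * (g n \<omega> - g' \<omega>) +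
      (f n \<omega> - f' \<omega>) * g' \<omega> + (g n \<omega> - g' \<omega>) * f' \<omega> + f' \<omega> * g' \<omega>)"
      by (auto simp: algebra_simps)
    then show ?thesis
      using sq_integrable_mult[OF fd gd] sq_integrable_mult[OF fd g(2)] sq_integrable_mult[OF gd f(2)] sq_integrable_mult[OF f(2) g(2)]
      by simp
  qed
  moreover have "(\<lambda>n. expectation (\<lambda>\<omega>. (f n \<omega> - f' \<omega>) * (g n \<omega> - g' \<omega>)) +
      expectation (\<lambda>\<omega>. (f n \<omega> - f' \<omega>) * g' \<omega>) + expectation (\<lambda>\<omega>. (g n \<omega> - g' \<omega>) * f' \<omega>) +
      expectation (\<lambda>\<omega>. f' \<omega> * g' \<omega>)) \<longlonglongrightarrow> 0 + 0 + 0 + expectation (\<lambda>\<omega>. f' \<omega> * g' \<omega>)"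
    by (intro tendsto_add L2_tendsto_mult_null[OF fd gd lim] L2_tendsto_mult_null[OF fd g(2) lim(1) tendsto_const]
        L2_tendsto_mult_null[OF gd f(2) lim(2) tendsto_const] tendsto_const)
  ultimately show ?thesis by simp
qed

text \<open>Along a subsequence with consecutive distances at most 2^-k the increments are summable
  in mean, so it converges almost surely. Fatou's lemma then turns the Cauchy bound into a bound for
  the distance to the pointwise limit.\<close>

theorem Riesz_Fischer:
  assumes f: "\<And>n. sq_integrable M (f n)"
    and Cauchy: "\<And>e. e > 0 \<Longrightarrow> \<exists>N. \<forall>m\<ge>N. \<forall>n\<ge>N. expectation (\<lambda>\<omega>. (f m \<omega> - f n \<omega>)\<^sup>2) \<le> e"
  obtains g where "sq_integrable M g" "(\<lambda>n. expectation (\<lambda>\<omega>. (f n \<omega> - g \<omega>)\<^sup>2)) \<longlonglongrightarrow> 0"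
proof -
  have [measurable]: "f n \<in> borel_measurable M" for n using f by (simp add: sq_integrable_def)
  have "\<exists>N. \<forall>k. \<forall>m\<ge>N k. \<forall>n\<ge>N k. expectation (\<lambda>\<omega>. (f m \<omega> - f n \<omega>)\<^sup>2) \<le> (1/4) ^ k"
    by (rule choice) (intro allI Cauchy, simp)
  then obtain N where N: "\<And>k m n. m \<ge> N k \<Longrightarrow> n \<ge> N k \<Longrightarrow> expectation (\<lambda>\<omega>. (f m \<omega> - f n \<omega>)\<^sup>2) \<le> (1/4) ^ k"
    by blast
  \<comment> \<open>The sum puts \<open>r k\<close> and \<open>r (Suc k)\<close> above
    \<open>N k\<close> although \<open>N\<close> need not be monotone; the summand k drives r to
    infinity.\<close>
  define r where "r k = (\<Sum>i\<le>k. N i) + k" for k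
  have r: "r k \<ge> N k" "r (Suc k) \<ge> N k" "r k \<ge> k" for k
  proof -
    have "N k \<le> (\<Sum>i\<le>k. N i)" by (rule member_le_sum) auto
    then show "r k \<ge> N k" "r (Suc k) \<ge> N k" "r k \<ge> k" by (simp_all add: r_def)
  qed
  define D where "D k \<omega> = f (r (Suc k)) \<omega> - f (r k) \<omega>" for k \<omega>
  have [measurable]: "D k \<in> borel_measurable M" for k unfolding D_def by measurable
  have D2: "sq_integrable M (D k)" for k unfolding D_def[abs_def] by (intro sq_integrable_diff f)
  have ED: "expectation (\<lambda>\<omega>. \<bar>D k \<omega>\<bar>) \<le> (1/2) ^ k" for k
  proof (rule power2_le_imp_le)
    have "(expectation (\<lambda>\<omega>. \<bar>D k \<omega>\<bar>))\<^sup>2 \<le> expectation (\<lambda>\<omega>. (\<bar>D k \<omega>\<bar>)\<^sup>2)"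
      using D2 by (intro expectation_square_le) (simp add: sq_integrable_def)
    also have "\<dots> \<le> (1/4) ^ k" using N[OF r(2,1)] by (simp add: D_def)
    also have "\<dots> = ((1/2) ^ k)\<^sup>2" by (simp add: power2_eq_square flip: power_mult_distrib)
    finally show "(expectation (\<lambda>\<omega>. \<bar>D k \<omega>\<bar>))\<^sup>2 \<le> ((1/2) ^ k)\<^sup>2" .
  qed simp
  have "(\<integral>\<^sup>+\<omega>. (\<Sum>k. ennreal \<bar>D k \<omega>\<bar>) \<partial>M) = (\<Sum>k. \<integral>\<^sup>+\<omega>. ennreal \<bar>D k \<omega>\<bar> \<partial>M)"
    by (rule nn_integral_suminf) simp
  also have "\<dots> = (\<Sum>k. ennreal (expectation (\<lambda>\<omega>. \<bar>D k \<omega>\<bar>)))"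
    using sq_integrable_integrable[OF D2] by (simp add: nn_integral_eq_integral)
  also have "\<dots> \<le> (\<Sum>k. ennreal ((1/2) ^ k))"
    by (intro suminf_le ennreal_leI ED summableI)
  also have "\<dots> < \<infinity>"
  proof -
    have "(\<Sum>k. ennreal ((1/2) ^ k)) \<noteq> top"
      by (intro ennreal_suminf_neq_top summable_geometric) auto
    then show ?thesis by (metis infinity_ennreal_def top.not_eq_extremum)
  qed
  finally have "AE \<omega> in M. (\<Sum>k. ennreal \<bar>D k \<omega>\<bar>) \<noteq> \<infinity>"
    by (intro nn_integral_PInf_AE) auto
  then have conv: "AE \<omega> in M. convergent (\<lambda>k. f (r k) \<omega>)"
  proof eventually_elim
    case (elim \<omega>)
    then have "summable (\<lambda>k. \<bar>D k \<omega>\<bar>)" by (intro summable_suminf_not_top) auto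
    then have "summable (\<lambda>k. D k \<omega>)" by (rule summable_rabs_cancel)
    then have "convergent (\<lambda>n. (\<Sum>k<n. D k \<omega>))" by (simp add: summable_iff_convergent)
    then have "convergent (\<lambda>n. f (r n) \<omega> - f (r 0) \<omega>)" using sum_lessThan_telescope[of "\<lambda>k. f (r k) \<omega>"] by (simp add: D_def)
    then have "convergent (\<lambda>n. (f (r n) \<omega> - f (r 0) \<omega>) + f (r 0) \<omega>)"
      by (intro convergent_add convergent_const)
    then show ?case by simp
  qed
  \<comment> \<open>Where the subsequence diverges, \<open>lim\<close> has an unspecified value; by
    \<open>conv\<close> this happens almost nowhere.\<close>
  define g where "g \<omega> = lim (\<lambda>k. f (r k) \<omega>)" for \<omega>
  have [measurable]: "g \<in> borel_measurable M" unfolding g_def[abs_def] by measurable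
  have bound: "(\<integral>\<^sup>+\<omega>. ennreal ((f n \<omega> - g \<omega>)\<^sup>2) \<partial>M) \<le> ennreal e"
    if "\<forall>m\<ge>N. \<forall>n\<ge>N. expectation (\<lambda>\<omega>. (f m \<omega> - f n \<omega>)\<^sup>2) \<le> e" "n \<ge> N" for n e N
  proof -
    have "AE \<omega> in M. ennreal ((f n \<omega> - g \<omega>)\<^sup>2) = liminf (\<lambda>k. ennreal ((f n \<omega> - f (r k) \<omega>)\<^sup>2))"
      using conv
    proof eventually_elim
      case (elim \<omega>)
      then have "(\<lambda>k. f (r k) \<omega>) \<longlonglongrightarrow> g \<omega>" by (simp add: g_def convergent_LIMSEQ_iff)
      then have "(\<lambda>k. ennreal ((f n \<omega> - f (r k) \<omega>)\<^sup>2)) \<longlonglongrightarrow> ennreal ((f n \<omega> - g \<omega>)\<^sup>2)"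
        by (intro tendsto_intros)
      then show ?case by (rule lim_imp_Liminf[OF sequentially_bot, symmetric])
    qed
    then have "(\<integral>\<^sup>+\<omega>. ennreal ((f n \<omega> - g \<omega>)\<^sup>2) \<partial>M) = (\<integral>\<^sup>+\<omega>. liminf (\<lambda>k. ennreal ((f n \<omega> - f (r k) \<omega>)\<^sup>2)) \<partial>M)"
      by (rule nn_integral_cong_AE)
    also have "\<dots> \<le> liminf (\<lambda>k. \<integral>\<^sup>+\<omega>. ennreal ((f n \<omega> - f (r k) \<omega>)\<^sup>2) \<partial>M)"
      by (rule nn_integral_liminf) simp
    also have "\<dots> \<le> liminf (\<lambda>k. ennreal e)"
    proof (rule Liminf_mono)
      show "\<forall>\<^sub>F k in sequentially. (\<integral>\<^sup>+\<omega>. ennreal ((f n \<omega> - f (r k) \<omega>)\<^sup>2) \<partial>M) \<le> ennreal e"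
        using eventually_ge_at_top[of N]
      proof eventually_elim
        case (elim k)
        then have "r k \<ge> N" using r(3)[of k] by simp
        then have "expectation (\<lambda>\<omega>. (f n \<omega> - f (r k) \<omega>)\<^sup>2) \<le> e" using that by blast
        then show ?case
          using sq_integrable_diff[OF f f, of n "r k"]
          by (subst nn_integral_eq_integral) (auto simp: sq_integrable_def intro: ennreal_leI)
      qed
    qed
    finally show ?thesis by (simp add: Liminf_const)
  qed
  have int: "integrable M (\<lambda>\<omega>. (f n \<omega> - g \<omega>)\<^sup>2) \<and> expectation (\<lambda>\<omega>. (f n \<omega> - g \<omega>)\<^sup>2) \<le> e"
    if "\<forall>m\<ge>N. \<forall>n\<ge>N. expectation (\<lambda>\<omega>. (f m \<omega> - f n \<omega>)\<^sup>2) \<le> e" "n \<ge> N" for n e N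
  proof
    have "0 \<le> expectation (\<lambda>\<omega>. (f n \<omega> - f n \<omega>)\<^sup>2)" by simp
    then have e: "e \<ge> 0" using that by (meson order_trans)
    show i: "integrable M (\<lambda>\<omega>. (f n \<omega> - g \<omega>)\<^sup>2)"
      using bound[OF that] by (intro integrableI_bounded) (auto simp: le_less_trans[OF _ ennreal_less_top])
    show "expectation (\<lambda>\<omega>. (f n \<omega> - g \<omega>)\<^sup>2) \<le> e"
      using bound[OF that] e by (subst (asm) nn_integral_eq_integral[OF i]) auto
  qed
  obtain N1 where N1: "\<forall>m\<ge>N1. \<forall>n\<ge>N1. expectation (\<lambda>\<omega>. (f m \<omega> - f n \<omega>)\<^sup>2) \<le> 1"
    using Cauchy[of 1] by auto
  then have "sq_integrable M (\<lambda>\<omega>. f N1 \<omega> - g \<omega>)"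
    using int[OF N1 order_refl] by (simp add: sq_integrable_def)
  from sq_integrable_diff[OF f[of N1] this] have "sq_integrable M g" by simp
  moreover have "(\<lambda>n. expectation (\<lambda>\<omega>. (f n \<omega> - g \<omega>)\<^sup>2)) \<longlonglongrightarrow> 0"
  proof (rule LIMSEQ_I)
    fix e :: real assume "e > 0"
    then obtain N where N: "\<forall>m\<ge>N. \<forall>n\<ge>N. expectation (\<lambda>\<omega>. (f m \<omega> - f n \<omega>)\<^sup>2) \<le> e / 2"
      using Cauchy[of "e / 2"] by auto
    then have "norm (expectation (\<lambda>\<omega>. (f n \<omega> - g \<omega>)\<^sup>2) - 0) < e" if "n \<ge> N" for n
      using int[OF N that] \<open>e > 0\<close> by auto
    then show "\<exists>no. \<forall>n\<ge>no. norm (expectation (\<lambda>\<omega>. (f n \<omega> - g \<omega>)\<^sup>2) - 0) < e" by blast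
  qed
  ultimately show ?thesis by (rule that)
qed

end

section \<open>Hermite expansions\<close>

text \<open>The degenerate pair X = Y makes orthogonality of the Hermite polynomials under the
  normal law an instance of the pair formula with \<rho> = 1.\<close>

lemma gaussian_pair_std_normal: "gaussian_pair std_normal_distribution (\<lambda>x. x) (\<lambda>x. x) 1"
proof -
  interpret N: prob_space std_normal_distribution by (simp add: prob_space_normal_density)
  have lin: "a * x + b * x = (a + b) * x" for a b x :: real by (simp add: algebra_simps)
  have sq: "a\<^sup>2 + 2 * a * b * 1 + b\<^sup>2 = (a + b)\<^sup>2" for a b :: real by (simp add: power2_sum)
  show ?thesis
  proof unfold_locales
    fix a b :: real and k
    have "has_bochner_integral std_normal_distribution (\<lambda>x. x ^ (2 * k)) (fact (2 * k) / (2 ^ k * fact k))"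
      using std_normal_distribution_even_moments[of k] by (simp add: has_bochner_integral_iff)
    from has_bochner_integral_mult_right[OF this, of "(a + b) ^ (2 * k)"]
    show "has_bochner_integral std_normal_distribution (\<lambda>x. (a * x + b * x) ^ (2 * k))
      (fact (2 * k) / (2 ^ k * fact k) * (a\<^sup>2 + 2 * a * b * 1 + b\<^sup>2) ^ k)"
      unfolding lin sq by (simp add: power_mult_distrib mult.commute flip: power_mult)
    have "has_bochner_integral std_normal_distribution (\<lambda>x. x ^ (2 * k + 1)) 0"
      using integrable_std_normal_distribution_moment[of "2 * k + 1"] integral_std_normal_distribution_moment_odd[of "2 * k + 1"]
      by (simp add: has_bochner_integral_iff)
    from has_bochner_integral_mult_right[OF this, of "(a + b) ^ (2 * k + 1)"]
    show "has_bochner_integral std_normal_distribution (\<lambda>x. (a * x + b * x) ^ (2 * k + 1)) 0"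
      unfolding lin power_mult_distrib by simp
  qed simp_all
qed

lemma integrable_exp_abs_std_normal: "integrable std_normal_distribution (\<lambda>x. exp (s * \<bar>x\<bar>))"
proof (rule Bochner_Integration.integrable_bound)
  have e: "integrable std_normal_distribution (\<lambda>x. exp (s * x))" for s
  proof -
    \<comment> \<open>Completing the square: an exponential factor shifts the mean to s.\<close>
    have "std_normal_density x * exp (s * x) = exp (s\<^sup>2 / 2) * normal_density s 1 x" for x
      by (simp add: normal_density_def power2_diff add_divide_distrib diff_divide_distrib flip: exp_add)
    then show ?thesis
      by (simp add: integrable_density normal_density_nonneg)
  qed
  show "integrable std_normal_distribution (\<lambda>x. exp (s * x) + exp (- s * x))"
    by (intro Bochner_Integration.integrable_add e)
  have "exp (s * \<bar>x\<bar>) \<le> exp (s * x) + exp (- s * x)" for x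
    by (cases "x \<ge> 0") auto
  then show "AE x in std_normal_distribution. norm (exp (s * \<bar>x\<bar>)) \<le> norm (exp (s * x) + exp (- s * x))"
    by (simp add: add_pos_pos)
qed simp

lemma AE_zero_of_char_zero:
  fixes g :: "real \<Rightarrow> real"
  assumes N: "real_distribution N" and g: "integrable N g"
    and char0: "\<And>t. (CLINT x|N. g x * iexp (t * x)) = 0"
  shows "AE x in N. g x = 0"
proof -
  interpret N: real_distribution N by fact
  have [measurable]: "g \<in> borel_measurable borel" using g by auto
  define p where "p x = max (g x) 0" for x
  define q where "q x = max (- g x) 0" for x
  have [measurable]: "p \<in> borel_measurable borel" "q \<in> borel_measurable borel" unfolding p_def[abs_def] q_def[abs_def] by measurable
  have g_eq: "g x = p x - q x" for x by (simp add: p_def q_def)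
  have nonneg: "p x \<ge> 0" "q x \<ge> 0" for x by (simp_all add: p_def q_def)
  have ip: "integrable N p" and iq: "integrable N q"
    using g by (auto simp: p_def[abs_def] q_def[abs_def] intro!: Bochner_Integration.integrable_max)
  have iexp: "integrable N (\<lambda>x. of_real (f x) * iexp (t * x))" if "integrable N f" for f t
    by (rule Bochner_Integration.integrable_bound[OF that]) (use that in \<open>auto simp: norm_mult\<close>)
  have eq: "(CLINT x|N. p x * iexp (t * x)) = (CLINT x|N. q x * iexp (t * x))" for t
    using char0[of t] iexp[OF ip, of t] iexp[OF iq, of t] by (simp add: g_eq left_diff_distrib)
  define c where "c = integral\<^sup>L N p"
  \<comment> \<open>At t = 0 the transforms are the total masses, so one constant normalizes both
    parts.\<close>
  have c: "c = integral\<^sup>L N q"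
    using eq[of 0] by (simp add: c_def)
  show ?thesis
  proof (cases "c = 0")
    case True
    then have "AE x in N. p x = 0" "AE x in N. q x = 0"
      using integral_nonneg_eq_0_iff_AE[OF ip] integral_nonneg_eq_0_iff_AE[OF iq] c nonneg by (auto simp: c_def)
    then show ?thesis by eventually_elim (simp add: g_eq)
  next
    case False
    moreover have "c \<ge> 0" by (simp add: c_def nonneg)
    ultimately have c0: "c > 0" by simp
    have dist: "real_distribution (density N (\<lambda>x. ennreal (f x / c)))"
      and char: "char (density N (\<lambda>x. ennreal (f x / c))) t = (CLINT x|N. f x * iexp (t * x)) / c"
      if f: "integrable N f" "\<And>x. f x \<ge> 0" "integral\<^sup>L N f = c" for f t
    proof -
      have [measurable]: "f \<in> borel_measurable borel" using f by auto
      have "(\<integral>\<^sup>+x. ennreal (f x / c) \<partial>N) = ennreal (integral\<^sup>L N (\<lambda>x. f x / c))"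
        using f c0 by (intro nn_integral_eq_integral) auto
      also have "\<dots> = 1" using f c0 by simp
      finally have "prob_space (density N (\<lambda>x. ennreal (f x / c)))"
        by (intro prob_spaceI) (simp add: emeasure_density cong: nn_integral_cong)
      then show "real_distribution (density N (\<lambda>x. ennreal (f x / c)))"
        by (simp add: real_distribution_def real_distribution_axioms_def)
      have "char (density N (\<lambda>x. ennreal (f x / c))) t = (CLINT x|N. (f x / c) *\<^sub>R iexp (t * x))"
        unfolding char_def using f c0 by (subst integral_density) auto
      also have "\<dots> = (CLINT x|N. (f x * iexp (t * x)) / c)"
        by (simp add: scaleR_conv_of_real)
      also have "\<dots> = (CLINT x|N. f x * iexp (t * x)) / c"
        using iexp[OF f(1), of t] by simp
      finally show "char (density N (\<lambda>x. ennreal (f x / c))) t = (CLINT x|N. f x * iexp (t * x)) / c" .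
    qed
    have "density N (\<lambda>x. ennreal (p x / c)) = density N (\<lambda>x. ennreal (q x / c))"
    proof (intro Levy_uniqueness dist ext)
      fix t
      show "char (density N (\<lambda>x. ennreal (p x / c))) t = char (density N (\<lambda>x. ennreal (q x / c))) t"
        unfolding char[OF ip nonneg(1) c_def[symmetric]] char[OF iq nonneg(2) c[symmetric]] eq ..
    qed (use c c_def nonneg ip iq in auto)
    then have "AE x in N. ennreal (p x / c) = ennreal (q x / c)"
      by (intro N.density_unique) auto
    then show ?thesis
    proof eventually_elim
      case (elim x)
      then show ?case using c0 nonneg[of x] by (simp add: g_eq)
    qed
  qed
qed

text \<open>
  Exponential integrability lets the exponential series be integrated term by term, so that
  vanishing moments force a vanishing characteristic function; Levy's uniqueness theorem,
  applied to the normalized positive and negative parts, then gives \<open>g = 0\<close>.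
\<close>

lemma std_normal_AE_zero_of_moments_zero:
  assumes g: "sq_integrable std_normal_distribution g"
    and moments: "\<And>n. (LINT x|std_normal_distribution. g x * x ^ n) = 0"
  shows "AE x in std_normal_distribution. g x = 0"
proof -
  let ?N = std_normal_distribution
  interpret N: real_distribution ?N by (rule real_dist_normal_dist)
  have [measurable]: "g \<in> borel_measurable borel" using g by (simp add: sq_integrable_def)
  have sqx: "sq_integrable ?N (\<lambda>x. x ^ n)" for n
    using integrable_std_normal_distribution_moment[of "2 * n"]
    by (simp add: sq_integrable_def power_mult[symmetric] mult.commute)
  have sqexp: "sq_integrable ?N (\<lambda>x. exp (s * \<bar>x\<bar>))" for s
    using integrable_exp_abs_std_normal[of "2 * s"]
    by (simp add: sq_integrable_def power2_eq_square algebra_simps flip: exp_add)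
  have "(CLINT x|?N. g x * iexp (t * x)) = 0" for t
  proof -
    define s where "s n x = of_real (g x) * (\<Sum>k<n. (\<i> * (t * x)) ^ k / fact k)" for n x
    have s0: "integral\<^sup>L ?N (s n) = 0" for n
    proof -
      have "s n = (\<lambda>x. \<Sum>k<n. (\<i> * t) ^ k / fact k * of_real (g x * x ^ k))"
        by (auto simp: s_def sum_distrib_left power_mult_distrib mult_ac intro!: sum.cong)
      moreover have "integrable ?N (\<lambda>x. (\<i> * t) ^ k / fact k * of_real (g x * x ^ k))" for k
        by (intro integrable_mult_right integrable_of_real N.sq_integrable_mult g sqx)
      ultimately show ?thesis
        by (simp add: moments del: of_real_mult of_real_power)
    qed
    have "(\<lambda>n. integral\<^sup>L ?N (s n)) \<longlonglongrightarrow> (CLINT x|?N. g x * iexp (t * x))"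
    proof (rule integral_dominated_convergence)
      \<comment> \<open>The majorant is a product of two square integrable functions, the square of
        the exponential being an exponential of the same kind.\<close>
      show "integrable ?N (\<lambda>x. \<bar>g x\<bar> * exp (\<bar>t\<bar> * \<bar>x\<bar>))"
        using g by (intro N.sq_integrable_mult sqexp) (simp add: sq_integrable_def)
      have "(\<lambda>n. s n x) \<longlonglongrightarrow> g x * iexp (t * x)" for x
        unfolding s_def using exp_converges[of "\<i> * (t * x)"]
        by (intro tendsto_mult_left) (simp add: sums_def divide_inverse scaleR_conv_of_real mult.commute)
      then show "AE x in ?N. (\<lambda>n. s n x) \<longlonglongrightarrow> g x * iexp (t * x)" by simp
      have "norm (s n x) \<le> \<bar>g x\<bar> * exp (\<bar>t\<bar> * \<bar>x\<bar>)" for n x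
      proof -
        have "norm (\<Sum>k<n. (\<i> * (t * x)) ^ k / fact k :: complex) \<le> (\<Sum>k<n. (\<bar>t\<bar> * \<bar>x\<bar>) ^ k / fact k)"
          by (rule sum_norm_le) (simp add: norm_divide norm_power norm_mult abs_mult)
        also have "\<dots> \<le> exp (\<bar>t\<bar> * \<bar>x\<bar>)"
          unfolding exp_def using summable_exp[of "\<bar>t\<bar> * \<bar>x\<bar>"]
          by (simp add: divide_inverse mult.commute) (intro sum_le_suminf, auto)
        finally show ?thesis by (simp add: s_def norm_mult mult_left_mono)
      qed
      then show "AE x in ?N. norm (s n x) \<le> \<bar>g x\<bar> * exp (\<bar>t\<bar> * \<bar>x\<bar>)" for n by simp
    qed (simp_all add: s_def[abs_def])
    then show ?thesis by (simp add: s0 LIMSEQ_const_iff)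
  qed
  from AE_zero_of_char_zero[OF N.real_distribution_axioms N.sq_integrable_integrable[OF g] this] show ?thesis .
qed

lemma (in gaussian_pair) integrable_hermite_mult: "integrable M (\<lambda>\<omega>. hermite i (X \<omega>) * hermite j (Y \<omega>))"
  unfolding hermite_eq_poly by (rule integrable_poly)

lemma (in gaussian_pair) expectation_hermite_sums:
  assumes "finite A"
  shows "expectation (\<lambda>\<omega>. (\<Sum>k\<in>A. c k * hermite k (X \<omega>)) * (\<Sum>k\<in>A. d k * hermite k (Y \<omega>))) =
    (\<Sum>k\<in>A. c k * d k * fact k * \<rho> ^ k)"
proof -
  have "expectation (\<lambda>\<omega>. (\<Sum>k\<in>A. c k * hermite k (X \<omega>)) * (\<Sum>k\<in>A. d k * hermite k (Y \<omega>))) =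
    expectation (\<lambda>\<omega>. \<Sum>i\<in>A. \<Sum>j\<in>A. c i * d j * (hermite i (X \<omega>) * hermite j (Y \<omega>)))"
    by (simp add: sum_product mult_ac)
  also have "\<dots> = (\<Sum>i\<in>A. \<Sum>j\<in>A. c i * d j * expectation (\<lambda>\<omega>. hermite i (X \<omega>) * hermite j (Y \<omega>)))"
    by (simp add: Bochner_Integration.integral_sum integrable_hermite_mult)
  also have "\<dots> = (\<Sum>k\<in>A. c k * d k * fact k * \<rho> ^ k)"
    using assms by (intro sum.cong) (simp_all add: expectation_hermite if_distrib sum.delta cong: if_cong)
  finally show ?thesis .
qed

interpretation std_normal: real_distribution std_normal_distribution
  by (rule real_dist_normal_dist)

lemmas std_normal_integrable_poly = gaussian_pair.integrable_poly[OF gaussian_pair_std_normal]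
lemmas std_normal_integrable_hermite_mult = gaussian_pair.integrable_hermite_mult[OF gaussian_pair_std_normal]
lemmas std_normal_expectation_hermite = gaussian_pair.expectation_hermite[OF gaussian_pair_std_normal]
lemmas std_normal_expectation_hermite_sums = gaussian_pair.expectation_hermite_sums[OF gaussian_pair_std_normal]

lemma sq_integrable_hermite: "sq_integrable std_normal_distribution (hermite n)"
  using std_normal_integrable_hermite_mult[of n n] by (simp add: sq_integrable_def power2_eq_square)

lemma hermite_coeff_std_normal:
  assumes [measurable]: "G \<in> borel_measurable borel"
  shows "hermite_coeff G n = (LINT x|std_normal_distribution. G x * hermite n x)"
  unfolding hermite_coeff_def by (subst integral_density) (auto simp: normal_density_nonneg mult_ac)

text \<open>The orthogonal projection onto the span of \<open>H_0\<close>, ...,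
  \<open>H_{n-1}\<close>; the division by k! is due to the squared norm k! of
  \<open>H_k\<close>.\<close>

definition hermite_sum :: "(real \<Rightarrow> real) \<Rightarrow> nat \<Rightarrow> real \<Rightarrow> real" where
  "hermite_sum G n x = (\<Sum>k<n. hermite_coeff G k / fact k * hermite k x)"

lemma sq_integrable_hermite_sum: "sq_integrable std_normal_distribution (hermite_sum G n)"
  unfolding hermite_sum_def[abs_def]
  by (intro std_normal.sq_integrable_sum std_normal.sq_integrable_cmult sq_integrable_hermite)

lemma hermite_sum_measurable [measurable]: "hermite_sum G n \<in> borel_measurable borel"
  unfolding hermite_sum_def[abs_def] by measurable

lemma hermite_recurrence: "x * hermite n x = hermite (Suc n) x + n * hermite (n - 1) x"
proof (cases n)
  case 0
  then show ?thesis by (simp add: hermite_eq_poly hermite_poly.simps)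
next
  case (Suc k)
  have "poly (hermite_poly (Suc n)) x = x * poly (hermite_poly n) x - poly (pderiv (hermite_poly n)) x"
    by (simp add: hermite_poly.simps)
  then show ?thesis by (simp only: Suc hermite_eq_poly pderiv_hermite_poly_Suc) simp
qed

text \<open>The three-term recurrence absorbs one power of x at the cost of changing the Hermite
  order. The induction therefore treats x^n \<open>H_k\<close> for all k at once, and the moments
  are the case k = 0.\<close>

lemma hermite_coeff_zero_imp_AE_zero:
  assumes g: "sq_integrable std_normal_distribution g"
    and coeff0: "\<And>n. (LINT x|std_normal_distribution. g x * hermite n x) = 0"
  shows "AE x in std_normal_distribution. g x = 0"
proof (rule std_normal_AE_zero_of_moments_zero[OF g])
  have i: "integrable std_normal_distribution (\<lambda>x. g x * (x ^ n * hermite k x))" for n k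
  proof (rule std_normal.sq_integrable_mult[OF g])
    show "sq_integrable std_normal_distribution (\<lambda>x. x ^ n * hermite k x)"
    proof -
      have "poly (monom 1 n * hermite_poly k * (monom 1 n * hermite_poly k)) x = (x ^ n * hermite k x)\<^sup>2" for x
        by (simp add: poly_monom hermite_eq_poly power2_eq_square)
      then show ?thesis
        using std_normal_integrable_poly[of "monom 1 n * hermite_poly k * (monom 1 n * hermite_poly k)" 1]
        by (simp add: sq_integrable_def)
    qed
  qed
  have "(LINT x|std_normal_distribution. g x * (x ^ n * hermite k x)) = 0" for n k
  proof (induction n arbitrary: k)
    case 0
    then show ?case using coeff0 by simp
  next
    case (Suc n)
    have "g x * (x ^ Suc n * hermite k x) = g x * (x ^ n * hermite (Suc k) x) + k * (g x * (x ^ n * hermite (k - 1) x))" for x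
    proof -
      have "g x * (x ^ Suc n * hermite k x) = g x * (x ^ n * (x * hermite k x))" by simp
      then show ?thesis unfolding hermite_recurrence by (simp add: algebra_simps)
    qed
    then show ?case by (simp add: i Suc)
  qed
  from this[of _ 0] show "(LINT x|std_normal_distribution. g x * x ^ n) = 0" for n
    by (simp add: hermite_eq_poly)
qed

lemma hermite_sum_inner_self:
  "(LINT x|std_normal_distribution. hermite_sum G n x * hermite_sum G n x) = (\<Sum>k<n. (hermite_coeff G k)\<^sup>2 / fact k)"
  unfolding hermite_sum_def by (subst std_normal_expectation_hermite_sums) (auto simp: power2_eq_square)

context
  fixes G :: "real \<Rightarrow> real"
  assumes G: "sq_integrable std_normal_distribution G"
begin

lemma hermite_coeff_inner: "(LINT x|std_normal_distribution. G x * hermite n x) = hermite_coeff G n"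
  using hermite_coeff_std_normal[of G] G by (simp add: sq_integrable_def)

lemma hermite_sum_inner:
  "(LINT x|std_normal_distribution. hermite_sum G n x * hermite k x) = (if k < n then hermite_coeff G k else 0)"
proof -
  have "(LINT x|std_normal_distribution. hermite_sum G n x * hermite k x) =
    (LINT x|std_normal_distribution. (\<Sum>i<n. hermite_coeff G i / fact i * (hermite i x * hermite k x)))"
    by (simp add: hermite_sum_def sum_distrib_right mult.assoc)
  also have "\<dots> = (\<Sum>i<n. hermite_coeff G i / fact i * (LINT x|std_normal_distribution. hermite i x * hermite k x))"
    by (simp add: Bochner_Integration.integral_sum std_normal_integrable_hermite_mult)
  finally show ?thesis
    by (simp add: std_normal_expectation_hermite if_distrib sum.delta cong: if_cong)
qed

lemma hermite_Bessel: "(\<Sum>k<n. (hermite_coeff G k)\<^sup>2 / fact k) \<le> (LINT x|std_normal_distribution. (G x)\<^sup>2)"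
proof -
  let ?S = "\<Sum>k<n. (hermite_coeff G k)\<^sup>2 / fact k"
  note S = sq_integrable_hermite_sum[of G n]
  have "(LINT x|std_normal_distribution. G x * hermite_sum G n x) =
    (LINT x|std_normal_distribution. (\<Sum>k<n. hermite_coeff G k / fact k * (G x * hermite k x)))"
    by (simp add: hermite_sum_def sum_distrib_left mult_ac)
  also have "\<dots> = (\<Sum>k<n. hermite_coeff G k / fact k * (LINT x|std_normal_distribution. G x * hermite k x))"
    by (simp add: Bochner_Integration.integral_sum std_normal.sq_integrable_mult[OF G sq_integrable_hermite])
  also have "\<dots> = ?S" by (simp add: hermite_coeff_inner power2_eq_square)
  finally have GS: "(LINT x|std_normal_distribution. G x * hermite_sum G n x) = ?S" .
  have "0 \<le> (LINT x|std_normal_distribution. (G x - hermite_sum G n x)\<^sup>2)" by simp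
  also have "(\<lambda>x. (G x - hermite_sum G n x)\<^sup>2) =
    (\<lambda>x. (G x)\<^sup>2 - 2 * (G x * hermite_sum G n x) + hermite_sum G n x * hermite_sum G n x)"
    by (auto simp: power2_eq_square algebra_simps)
  also have "integral\<^sup>L std_normal_distribution \<dots> = (LINT x|std_normal_distribution. (G x)\<^sup>2) - 2 * ?S + ?S"
    using G std_normal.sq_integrable_mult[OF G S] std_normal.sq_integrable_mult[OF S S]
    by (simp add: sq_integrable_def hermite_sum_inner_self GS)
  finally show ?thesis by simp
qed

text \<open>By Bessel's inequality the partial sums are Cauchy, which only gives some limit s. The
  difference G - s is orthogonal to every \<open>H_k\<close>, so completeness identifies s with G
  almost everywhere.\<close>

lemma hermite_expansion:
  "(\<lambda>n. LINT x|std_normal_distribution. (G x - hermite_sum G n x)\<^sup>2) \<longlonglongrightarrow> 0"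
proof -
  let ?N = std_normal_distribution
  define f where "f k = (hermite_coeff G k)\<^sup>2 / fact k" for k
  have dist: "(LINT x|?N. (hermite_sum G m x - hermite_sum G n x)\<^sup>2) = sum f {n..<m}" if "n \<le> m" for m n
  proof -
    have "hermite_sum G m x - hermite_sum G n x = (\<Sum>k\<in>{n..<m}. hermite_coeff G k / fact k * hermite k x)" for x
      using sum_diff_nat_ivl[of 0 n m "\<lambda>k. hermite_coeff G k / fact k * hermite k x"] that
      by (simp add: hermite_sum_def atLeast0LessThan)
    then have "(LINT x|?N. (hermite_sum G m x - hermite_sum G n x)\<^sup>2) =
      (\<Sum>k\<in>{n..<m}. hermite_coeff G k / fact k * (hermite_coeff G k / fact k) * fact k * 1 ^ k)"
      using std_normal_expectation_hermite_sums[of "{n..<m}" "\<lambda>k. hermite_coeff G k / fact k" "\<lambda>k. hermite_coeff G k / fact k"]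
      by (simp only: power2_eq_square) simp
    then show ?thesis by (simp add: f_def power2_eq_square)
  qed
  have "summable f"
    using hermite_Bessel by (intro bounded_imp_summable[where B = "LINT x|?N. (G x)\<^sup>2"])
      (simp_all only: f_def lessThan_Suc_atMost[symmetric], simp)
  then have C: "\<exists>N. \<forall>m\<ge>N. \<forall>n. norm (sum f {m..<n}) < e" if "e > 0" for e
    using that by (simp add: summable_Cauchy)
  have "\<exists>N. \<forall>m\<ge>N. \<forall>n\<ge>N. (LINT x|?N. (hermite_sum G m x - hermite_sum G n x)\<^sup>2) \<le> e" if epos: "e > 0" for e
  proof -
    obtain N where N: "\<And>m n. m \<ge> N \<Longrightarrow> norm (sum f {m..<n}) < e" using C[OF epos] by blast
    have "(LINT x|?N. (hermite_sum G m x - hermite_sum G n x)\<^sup>2) \<le> e" if "m \<ge> N" "n \<ge> N" for m n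
    proof (cases "n \<le> m")
      case True
      then show ?thesis using dist[OF True] N[OF that(2), of m] by simp
    next
      case False
      then show ?thesis using dist[of m n] N[OF that(1), of n] by (simp add: power2_commute)
    qed
    then show ?thesis by blast
  qed
  from std_normal.Riesz_Fischer[OF sq_integrable_hermite_sum this]
  obtain s where s: "sq_integrable ?N s" "(\<lambda>n. LINT x|?N. (hermite_sum G n x - s x)\<^sup>2) \<longlonglongrightarrow> 0"
    by blast
  have "(LINT x|?N. (G x - s x) * hermite k x) = 0" for k
  proof -
    have "(\<lambda>n. LINT x|?N. hermite_sum G n x * hermite k x) \<longlonglongrightarrow> (LINT x|?N. s x * hermite k x)"
      by (rule std_normal.L2_tendsto_mult[OF sq_integrable_hermite_sum s(1) sq_integrable_hermite sq_integrable_hermite s(2)]) simp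
    moreover have "(\<lambda>n. LINT x|?N. hermite_sum G n x * hermite k x) \<longlonglongrightarrow> hermite_coeff G k"
      using eventually_gt_at_top[of k] by (rule tendsto_eventually[OF eventually_mono]) (simp add: hermite_sum_inner)
    ultimately have "(LINT x|?N. s x * hermite k x) = (LINT x|?N. G x * hermite k x)"
      unfolding hermite_coeff_inner by (rule LIMSEQ_unique)
    then show ?thesis
      by (simp add: left_diff_distrib std_normal.sq_integrable_mult[OF G sq_integrable_hermite]
          std_normal.sq_integrable_mult[OF s(1) sq_integrable_hermite])
  qed
  then have "AE x in ?N. G x - s x = 0"
    by (intro hermite_coeff_zero_imp_AE_zero std_normal.sq_integrable_diff G s)
  then have "(LINT x|?N. (G x - hermite_sum G n x)\<^sup>2) = (LINT x|?N. (hermite_sum G n x - s x)\<^sup>2)" for n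
    using G s(1) by (intro integral_cong_AE) (auto simp: power2_commute sq_integrable_def)
  then show ?thesis using s(2) by simp
qed

end

text \<open>Moments suffice for polynomials; for general square integrable functions the marginal
  laws are added. The joint law still enters only through the moments, because mixed expectations
  are limits of those of Hermite sums.\<close>

locale std_gaussian_pair = gaussian_pair +
  assumes distr_X: "distr M borel X = std_normal_distribution"
    and distr_Y: "distr M borel Y = std_normal_distribution"
begin

lemma expectation_X: "f \<in> borel_measurable borel \<Longrightarrow> expectation (\<lambda>\<omega>. f (X \<omega>)) = (LINT x|std_normal_distribution. f x :: real)"
  unfolding distr_X[symmetric] by (subst integral_distr) auto

lemma expectation_Y: "f \<in> borel_measurable borel \<Longrightarrow> expectation (\<lambda>\<omega>. f (Y \<omega>)) = (LINT x|std_normal_distribution. f x :: real)"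
  unfolding distr_Y[symmetric] by (subst integral_distr) auto

lemma sq_integrable_X:
  assumes "sq_integrable std_normal_distribution f" shows "sq_integrable M (\<lambda>\<omega>. f (X \<omega>))"
proof -
  have [measurable]: "f \<in> borel_measurable borel" using assms by (simp add: sq_integrable_def)
  show ?thesis
    using assms integrable_distr_eq[OF X_measurable, of "\<lambda>x. (f x)\<^sup>2"] by (simp add: sq_integrable_def distr_X)
qed

lemma sq_integrable_Y:
  assumes "sq_integrable std_normal_distribution f" shows "sq_integrable M (\<lambda>\<omega>. f (Y \<omega>))"
proof -
  have [measurable]: "f \<in> borel_measurable borel" using assms by (simp add: sq_integrable_def)
  show ?thesis
    using assms integrable_distr_eq[OF Y_measurable, of "\<lambda>x. (f x)\<^sup>2"] by (simp add: sq_integrable_def distr_Y)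
qed

text \<open>For a Hermite sum the mixed expectation is diagonal with terms \<open>J_k\<close>^2
  \<rho>^k / k!. Those with k < r vanish, in the others \<rho>^k is at most \<rho>^r, and Bessel's
  inequality makes the bound uniform in the truncation.\<close>

lemma expectation_mult_le:
  assumes G: "sq_integrable std_normal_distribution G"
    and coeff0: "\<And>k. k < r \<Longrightarrow> hermite_coeff G k = 0"
    and \<rho>: "0 \<le> \<rho>" "\<rho> \<le> 1"
  shows "expectation (\<lambda>\<omega>. G (X \<omega>) * G (Y \<omega>)) \<le> \<rho> ^ r * (LINT x|std_normal_distribution. (G x)\<^sup>2)"
proof (rule LIMSEQ_le_const2)
  have [measurable]: "G \<in> borel_measurable borel" using G by (simp add: sq_integrable_def)
  have lim: "(\<lambda>n. LINT x|std_normal_distribution. (hermite_sum G n x - G x)\<^sup>2) \<longlonglongrightarrow> 0"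
    using hermite_expansion[OF G] by (simp add: power2_commute)
  show "(\<lambda>n. expectation (\<lambda>\<omega>. hermite_sum G n (X \<omega>) * hermite_sum G n (Y \<omega>))) \<longlonglongrightarrow> expectation (\<lambda>\<omega>. G (X \<omega>) * G (Y \<omega>))"
    using lim expectation_X[of "\<lambda>x. (hermite_sum G _ x - G x)\<^sup>2"] expectation_Y[of "\<lambda>x. (hermite_sum G _ x - G x)\<^sup>2"]
    by (intro L2_tendsto_mult sq_integrable_X sq_integrable_Y sq_integrable_hermite_sum G) auto
  have "expectation (\<lambda>\<omega>. hermite_sum G n (X \<omega>) * hermite_sum G n (Y \<omega>)) \<le> \<rho> ^ r * (LINT x|std_normal_distribution. (G x)\<^sup>2)" for n
  proof -
    have "expectation (\<lambda>\<omega>. hermite_sum G n (X \<omega>) * hermite_sum G n (Y \<omega>)) =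
      (\<Sum>k<n. (hermite_coeff G k)\<^sup>2 / fact k * \<rho> ^ k)"
      unfolding hermite_sum_def by (subst expectation_hermite_sums) (auto simp: power2_eq_square)
    also have "\<dots> \<le> (\<Sum>k<n. (hermite_coeff G k)\<^sup>2 / fact k * \<rho> ^ r)"
    proof (rule sum_mono)
      fix k
      show "(hermite_coeff G k)\<^sup>2 / fact k * \<rho> ^ k \<le> (hermite_coeff G k)\<^sup>2 / fact k * \<rho> ^ r"
      proof (cases "k < r")
        case False
        then show ?thesis using \<rho> by (intro mult_left_mono power_decreasing) auto
      qed (simp add: coeff0)
    qed
    also have "\<dots> = \<rho> ^ r * (\<Sum>k<n. (hermite_coeff G k)\<^sup>2 / fact k)"
      by (simp add: sum_distrib_left mult.commute)
    also have "\<dots> \<le> \<rho> ^ r * (LINT x|std_normal_distribution. (G x)\<^sup>2)"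
      using hermite_Bessel[OF G] \<rho> by (intro mult_left_mono) auto
    finally show ?thesis .
  qed
  then show "\<exists>N. \<forall>n\<ge>N. expectation (\<lambda>\<omega>. hermite_sum G n (X \<omega>) * hermite_sum G n (Y \<omega>))
      \<le> \<rho> ^ r * (LINT x|std_normal_distribution. (G x)\<^sup>2)"
    by blast
qed

lemma expectation_hermite_sum_diff_square:
  "expectation (\<lambda>\<omega>. (hermite_sum G n (X \<omega>) - hermite_sum G n (Y \<omega>))\<^sup>2) =
    (\<Sum>k<n. 2 * (hermite_coeff G k)\<^sup>2 / fact k * (1 - \<rho> ^ k))"
proof -
  let ?S = "\<lambda>x. hermite_sum G n x"
  note sX = sq_integrable_X[OF sq_integrable_hermite_sum[of G n]] and sY = sq_integrable_Y[OF sq_integrable_hermite_sum[of G n]]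
  have "(\<lambda>\<omega>. (?S (X \<omega>) - ?S (Y \<omega>))\<^sup>2) = (\<lambda>\<omega>. ?S (X \<omega>) * ?S (X \<omega>) + ?S (Y \<omega>) * ?S (Y \<omega>) - 2 * (?S (X \<omega>) * ?S (Y \<omega>)))"
    by (auto simp: power2_eq_square algebra_simps)
  then have "expectation (\<lambda>\<omega>. (?S (X \<omega>) - ?S (Y \<omega>))\<^sup>2) =
    expectation (\<lambda>\<omega>. ?S (X \<omega>) * ?S (X \<omega>)) + expectation (\<lambda>\<omega>. ?S (Y \<omega>) * ?S (Y \<omega>)) - 2 * expectation (\<lambda>\<omega>. ?S (X \<omega>) * ?S (Y \<omega>))"
    using sq_integrable_mult[OF sX sX] sq_integrable_mult[OF sY sY] sq_integrable_mult[OF sX sY] by simp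
  also have "expectation (\<lambda>\<omega>. ?S (X \<omega>) * ?S (X \<omega>)) = (\<Sum>k<n. (hermite_coeff G k)\<^sup>2 / fact k)"
  proof -
    have "expectation (\<lambda>\<omega>. ?S (X \<omega>) * ?S (X \<omega>)) = (LINT x|std_normal_distribution. ?S x * ?S x)"
      by (rule expectation_X) measurable
    then show ?thesis by (simp add: hermite_sum_inner_self)
  qed
  also have "expectation (\<lambda>\<omega>. ?S (Y \<omega>) * ?S (Y \<omega>)) = (\<Sum>k<n. (hermite_coeff G k)\<^sup>2 / fact k)"
  proof -
    have "expectation (\<lambda>\<omega>. ?S (Y \<omega>) * ?S (Y \<omega>)) = (LINT x|std_normal_distribution. ?S x * ?S x)"
      by (rule expectation_Y) measurable
    then show ?thesis by (simp add: hermite_sum_inner_self)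
  qed
  also have "expectation (\<lambda>\<omega>. ?S (X \<omega>) * ?S (Y \<omega>)) = (\<Sum>k<n. (hermite_coeff G k)\<^sup>2 / fact k * \<rho> ^ k)"
    unfolding hermite_sum_def by (subst expectation_hermite_sums) (auto simp: power2_eq_square)
  finally show ?thesis
    by (simp add: sum_distrib_left sum_subtractf right_diff_distrib mult.assoc flip: sum.distrib)
qed

end

text \<open>One \<eta> has to serve all pairs, so that the field gets a uniform modulus of
  continuity. A finite Hermite sum contributes a polynomial in \<rho> that vanishes at 1, and its
  tail is controlled by the marginal laws, whatever \<rho> is.\<close>

lemma gaussian_subordinated_L2_continuous:
  assumes G: "sq_integrable std_normal_distribution G" and e: "e > 0"
  obtains \<eta> where "\<eta> > 0"
    "\<And>(M :: 'w measure) X Y \<rho>. std_gaussian_pair M X Y \<rho> \<Longrightarrow> \<bar>\<rho> - 1\<bar> < \<eta> \<Longrightarrow> (LINT \<omega>|M. (G (X \<omega>) - G (Y \<omega>))\<^sup>2) \<le> e"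
proof -
  let ?N = std_normal_distribution
  have [measurable]: "G \<in> borel_measurable borel" using G by (simp add: sq_integrable_def)
  \<comment> \<open>Two uses of (x + y)^2 \<le> 2 x^2 + 2 y^2 multiply the tail by 8, giving e/2;
    the Hermite sum is allowed e/4, which is doubled once.\<close>
  obtain n where n: "(LINT x|?N. (G x - hermite_sum G n x)\<^sup>2) < e / 16"
    using order_tendstoD(2)[OF hermite_expansion[OF G], of "e / 16"] e by (auto simp: eventually_sequentially)
  define p where "p \<rho> = (\<Sum>k<n. 2 * (hermite_coeff G k)\<^sup>2 / fact k * (1 - \<rho> ^ k))" for \<rho> :: real
  have "isCont p 1" unfolding p_def by (intro continuous_intros) auto
  then obtain \<eta> where \<eta>: "\<eta> > 0" "\<And>\<rho>. \<bar>\<rho> - 1\<bar> < \<eta> \<Longrightarrow> \<bar>p \<rho>\<bar> < e / 4"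
    unfolding continuous_at_eps_delta using e by (auto simp: dist_real_def p_def dest: spec[of _ "e / 4"])
  show ?thesis
  proof (rule that[OF \<eta>(1)])
    fix M :: "'w measure" and X Y \<rho>
    assume "std_gaussian_pair M X Y \<rho>" and \<rho>: "\<bar>\<rho> - 1\<bar> < \<eta>"
    then interpret std_gaussian_pair M X Y \<rho> by simp
    define R where "R x = G x - hermite_sum G n x" for x
    have [measurable]: "R \<in> borel_measurable borel" unfolding R_def[abs_def] by measurable
    have R: "sq_integrable ?N R" unfolding R_def[abs_def] by (intro std_normal.sq_integrable_diff G sq_integrable_hermite_sum)
    note sX = sq_integrable_X[OF sq_integrable_hermite_sum[of G n]] and sY = sq_integrable_Y[OF sq_integrable_hermite_sum[of G n]]
    have "expectation (\<lambda>\<omega>. (G (X \<omega>) - G (Y \<omega>))\<^sup>2) =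
      expectation (\<lambda>\<omega>. ((R (X \<omega>) - R (Y \<omega>)) + (hermite_sum G n (X \<omega>) - hermite_sum G n (Y \<omega>)))\<^sup>2)"
      by (simp add: R_def)
    also have "\<dots> \<le> 2 * expectation (\<lambda>\<omega>. (R (X \<omega>) - R (Y \<omega>))\<^sup>2) +
        2 * expectation (\<lambda>\<omega>. (hermite_sum G n (X \<omega>) - hermite_sum G n (Y \<omega>))\<^sup>2)"
      by (intro expectation_square_add_le sq_integrable_diff sX sY sq_integrable_X sq_integrable_Y R)
    also have "expectation (\<lambda>\<omega>. (R (X \<omega>) - R (Y \<omega>))\<^sup>2) \<le> 2 * expectation (\<lambda>\<omega>. (R (X \<omega>))\<^sup>2) + 2 * expectation (\<lambda>\<omega>. (R (Y \<omega>))\<^sup>2)"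
      by (intro expectation_square_diff_le sq_integrable_X sq_integrable_Y R)
    also have "\<dots> \<le> e / 4"
      using n expectation_X[of "\<lambda>x. (R x)\<^sup>2"] expectation_Y[of "\<lambda>x. (R x)\<^sup>2"] by (simp add: R_def)
    also have "expectation (\<lambda>\<omega>. (hermite_sum G n (X \<omega>) - hermite_sum G n (Y \<omega>))\<^sup>2) \<le> e / 4"
      using \<eta>(2)[OF \<rho>] by (simp add: expectation_hermite_sum_diff_square p_def)
    finally show "expectation (\<lambda>\<omega>. (G (X \<omega>) - G (Y \<omega>))\<^sup>2) \<le> e" by simp
  qed
qed

section \<open>Existence of mean-square integrals\<close>

lemma set_integrable_cbox:
  fixes f :: "'a::euclidean_space \<Rightarrow> real"
  shows "integrable lborel f \<Longrightarrow> set_integrable lborel (cbox u v) f"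
  unfolding set_integrable_def by (rule integrable_mult_indicator) simp_all

lemma set_integrable_const_cbox: "set_integrable lborel (cbox u v :: 'a::euclidean_space set) (\<lambda>_. c :: real)"
proof -
  have "emeasure lborel (cbox u v :: 'a set) < \<infinity>" by (rule emeasure_compact_finite) simp
  then show ?thesis unfolding set_integrable_def by (intro integrable_scaleR_left integrable_real_indicator) simp_all
qed

text \<open>Cells share faces, which are null sets; the additivity is inherited from the gauge
  integral.\<close>

lemma set_integral_tagged_division:
  fixes f :: "'a::euclidean_space \<Rightarrow> real"
  assumes f: "set_integrable lborel (cbox a b) f" and D: "D tagged_division_of cbox a b"
  shows "(\<Sum>(p, k)\<in>D. LINT q:k|lborel. f q) = (LINT q:cbox a b|lborel. f q)"
proof -
  have "(LINT q:k|lborel. f q) = integral k f" if "(p, k) \<in> D" for p k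
  proof -
    obtain u v where k: "k = cbox u v" "k \<subseteq> cbox a b"
      using tagged_division_ofD(3,4)[OF D \<open>(p, k) \<in> D\<close>] by blast
    have "set_integrable lborel k f" by (rule set_integrable_subset[OF f _ k(2)]) (simp add: k(1))
    then show ?thesis by (rule set_borel_integral_eq_integral)
  qed
  then have "(\<Sum>(p, k)\<in>D. LINT q:k|lborel. f q) = (\<Sum>(p, k)\<in>D. integral k f)"
    by (intro sum.cong) auto
  also have "\<dots> = integral (cbox a b) f"
    using has_integral_combine_tagged_division_topdown[OF set_borel_integral_eq_integral(1)[OF f] D]
    by (simp add: integral_unique)
  finally show ?thesis by (simp add: set_borel_integral_eq_integral(2)[OF f])
qed

text \<open>The error is the integral over the box of the function equal to f p - f q on the cell of
  tag p, and Cauchy-Schwarz is applied to it and the constant 1. In discriminant form this needs no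
  function glued together from cells that overlap in their faces.\<close>

lemma Riemann_sum_error_square_le:
  fixes f :: "'a::euclidean_space \<Rightarrow> real"
  assumes f: "integrable lborel f" and f2: "integrable lborel (\<lambda>q. (f q)\<^sup>2)"
    and f0: "\<And>q. q \<notin> cbox a b \<Longrightarrow> f q = 0" and D: "D tagged_division_of cbox a b"
  shows "((\<Sum>(p, k)\<in>D. measure lborel k * f p) - integral\<^sup>L lborel f)\<^sup>2
    \<le> (\<Sum>(p, k)\<in>D. LINT q:k|lborel. (f p - f q)\<^sup>2) * measure lborel (cbox a b)"
proof (rule quadratic_nonneg_imp)
  fix t :: real
  have box: "\<exists>u v. k = cbox u v" if "(p, k) \<in> D" for p k
    using tagged_division_ofD(4)[OF D that] .
  have i: "set_integrable lborel k f" "set_integrable lborel k (\<lambda>q. (f q)\<^sup>2)" "set_integrable lborel k (\<lambda>q. c :: real)"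
    if "(p, k) \<in> D" for p k c
    using box[OF that] f f2 by (auto intro: set_integrable_cbox set_integrable_const_cbox)
  have "(LINT q:cbox a b|lborel. f q) = integral\<^sup>L lborel f"
    unfolding set_lebesgue_integral_def using f0
    by (intro Bochner_Integration.integral_cong) (auto simp: indicator_def)
  then have If: "integral\<^sup>L lborel f = (\<Sum>(p, k)\<in>D. LINT q:k|lborel. f q)"
    using set_integral_tagged_division[OF set_integrable_cbox[OF f] D] by simp
  have V: "measure lborel (cbox a b) = (\<Sum>(p, k)\<in>D. measure lborel k)"
    using additive_content_tagged_division[OF D] by simp
  have "0 \<le> (\<Sum>(p, k)\<in>D. LINT q:k|lborel. (f p - f q + t)\<^sup>2)"
    by (intro sum_nonneg) (auto simp: set_lebesgue_integral_def)
  also have "\<dots> = (\<Sum>(p, k)\<in>D. (LINT q:k|lborel. (f p - f q)\<^sup>2) + 2 * t * (measure lborel k * f p - (LINT q:k|lborel. f q)) + t\<^sup>2 * measure lborel k)"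
  proof (intro sum.cong refl, clarify)
    fix p k assume pk: "(p, k) \<in> D"
    have fin: "emeasure lborel k < \<infinity>" "k \<in> sets lborel" using box[OF pk] by (auto simp: emeasure_lborel_cbox_eq)
    have c: "(LINT q:k|lborel. c) = c * measure lborel k" for c :: real
      using fin by (simp add: set_lebesgue_integral_def mult.commute)
    have sq: "set_integrable lborel k (\<lambda>q. (f p - f q)\<^sup>2)"
    proof -
      have "(\<lambda>q. (f p - f q)\<^sup>2) = (\<lambda>q. (f p)\<^sup>2 - 2 * f p * f q + (f q)\<^sup>2)"
        by (auto simp: power2_diff algebra_simps)
      then show ?thesis using i[OF pk] by simp
    qed
    have "(LINT q:k|lborel. (f p - f q + t)\<^sup>2) = (LINT q:k|lborel. (f p - f q)\<^sup>2 + (2 * t) * (f p - f q) + t\<^sup>2)"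
    proof -
      have "(x + t)\<^sup>2 = x\<^sup>2 + 2 * t * x + t\<^sup>2" for x :: real
        by (simp add: power2_eq_square algebra_simps)
      then show ?thesis by (simp only:)
    qed
    also have "\<dots> = (LINT q:k|lborel. (f p - f q)\<^sup>2) + 2 * t * (LINT q:k|lborel. f p - f q) + (LINT q:k|lborel. t\<^sup>2)"
      using sq i[OF pk] by (simp only: set_integral_add set_integral_diff set_integrable_mult_right set_integral_mult_right)
    also have "(LINT q:k|lborel. f p - f q) = measure lborel k * f p - (LINT q:k|lborel. f q)"
      using i[OF pk] by (simp only: set_integral_diff c mult.commute)
    finally show "(LINT q:k|lborel. (f p - f q + t)\<^sup>2) = (LINT q:k|lborel. (f p - f q)\<^sup>2) + 2 * t * (measure lborel k * f p - (LINT q:k|lborel. f q)) + t\<^sup>2 * measure lborel k"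
      by (simp only: c)
  qed
  also have "\<dots> = (\<Sum>(p, k)\<in>D. LINT q:k|lborel. (f p - f q)\<^sup>2) + 2 * t * ((\<Sum>(p, k)\<in>D. measure lborel k * f p) - integral\<^sup>L lborel f)
      + t\<^sup>2 * measure lborel (cbox a b)"
    unfolding If V by (simp add: split_def sum.distrib sum_subtractf flip: sum_distrib_left)
  finally show "0 \<le> \<dots>" .
qed simp

text \<open>
  The mean-square integral is realized by the pathwise Lebesgue integral: unlike an
  \<open>L\<^sup>2\<close> limit of Riemann sums, it does not depend on the enclosing box.
\<close>

locale L2_continuous_field = prob_space M for M :: "'w measure" +
  fixes X :: "'i::euclidean_space \<Rightarrow> 'w \<Rightarrow> real" and B :: real and S :: "'i set"
  assumes X_measurable: "measurable_field M X"
    and sq_integrable_X: "\<And>p. sq_integrable M (X p)"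
    and second_moment_le: "\<And>p. expectation (\<lambda>\<omega>. (X p \<omega>)\<^sup>2) \<le> B"
    and L2_continuous: "\<And>e. e > 0 \<Longrightarrow> \<exists>d>0. \<forall>p q. dist p q < d \<longrightarrow> expectation (\<lambda>\<omega>. (X p \<omega> - X q \<omega>)\<^sup>2) \<le> e"
    and compact_S: "compact S" and negligible_frontier: "negligible (frontier S)"
begin

definition cutoff :: "'i \<Rightarrow> 'w \<Rightarrow> real" where
  "cutoff p \<omega> = indicator S p * X p \<omega>"

text \<open>A path that is not integrable gets the default value 0; almost surely this does not
  occur, by \<open>AE_integrable_cutoff\<close>.\<close>

definition path_integral :: "'w \<Rightarrow> real" where
  "path_integral \<omega> = (LINT p|lborel. cutoff p \<omega>)"

lemma B_nonneg: "B \<ge> 0"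
  using order_trans[OF _ second_moment_le[of undefined]] by simp

lemma S_measurable [measurable]: "S \<in> sets borel"
  using compact_S by (simp add: compact_imp_closed borel_closed)

lemma cutoff_measurable: "case_prod cutoff \<in> borel_measurable (lborel \<Otimes>\<^sub>M M)"
proof -
  have [measurable]: "(\<lambda>x. X (fst x) (snd x)) \<in> borel_measurable (lborel \<Otimes>\<^sub>M M)"
    using X_measurable by (simp add: measurable_field_def case_prod_beta' cong: measurable_cong_sets sets_pair_measure_cong)
  show ?thesis unfolding cutoff_def[abs_def] case_prod_beta' by measurable
qed

lemma cutoff_measurable_swap: "case_prod (\<lambda>\<omega> p. cutoff p \<omega>) \<in> borel_measurable (M \<Otimes>\<^sub>M lborel)"
  using cutoff_measurable by (subst (asm) measurable_pair_swap_iff) (simp add: case_prod_beta')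

lemma cutoff_measurable_section [measurable]: "\<omega> \<in> space M \<Longrightarrow> (\<lambda>p. cutoff p \<omega>) \<in> borel_measurable borel"
  using measurable_compose_Pair1[OF _ cutoff_measurable_swap, of \<omega>] by simp

lemma sq_integrable_cutoff: "sq_integrable M (cutoff p)"
  unfolding cutoff_def[abs_def] by (intro sq_integrable_cmult sq_integrable_X)

lemma path_integral_measurable [measurable]: "path_integral \<in> borel_measurable M"
  unfolding path_integral_def[abs_def] using cutoff_measurable_swap by measurable

text \<open>By Tonelli the expected integral of the square is at most B times the volume of S. On S
  the first power is bounded by 1 plus the square.\<close>

lemma AE_integrable_cutoff: "AE \<omega> in M. integrable lborel (\<lambda>p. cutoff p \<omega>) \<and> integrable lborel (\<lambda>p. (cutoff p \<omega>)\<^sup>2)"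
proof -
  interpret pair_sigma_finite lborel M ..
  have m2 [measurable]: "(\<lambda>(p, \<omega>). ennreal ((cutoff p \<omega>)\<^sup>2)) \<in> borel_measurable (lborel \<Otimes>\<^sub>M M)"
    using cutoff_measurable by measurable
  have S: "emeasure lborel S < \<infinity>" using compact_S by (rule emeasure_compact_finite)
  have "(\<integral>\<^sup>+\<omega>. \<integral>\<^sup>+p. ennreal ((cutoff p \<omega>)\<^sup>2) \<partial>lborel \<partial>M) = (\<integral>\<^sup>+p. \<integral>\<^sup>+\<omega>. ennreal ((cutoff p \<omega>)\<^sup>2) \<partial>M \<partial>lborel)"
    by (rule Fubini'[OF m2])
  also have "\<dots> \<le> (\<integral>\<^sup>+p. ennreal B * indicator S p \<partial>lborel)"
  proof (rule nn_integral_mono)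
    fix p
    have "(\<integral>\<^sup>+\<omega>. ennreal ((cutoff p \<omega>)\<^sup>2) \<partial>M) = ennreal (expectation (\<lambda>\<omega>. (cutoff p \<omega>)\<^sup>2))"
      using sq_integrable_cutoff by (intro nn_integral_eq_integral) (auto simp: sq_integrable_def)
    also have "\<dots> \<le> ennreal B * indicator S p"
      using second_moment_le[of p] by (auto simp: cutoff_def indicator_def intro: ennreal_leI)
    finally show "(\<integral>\<^sup>+\<omega>. ennreal ((cutoff p \<omega>)\<^sup>2) \<partial>M) \<le> ennreal B * indicator S p" .
  qed
  also have "\<dots> < \<infinity>" using S by (simp add: nn_integral_cmult_indicator ennreal_mult_less_top)
  finally have "(\<integral>\<^sup>+\<omega>. \<integral>\<^sup>+p. ennreal ((cutoff p \<omega>)\<^sup>2) \<partial>lborel \<partial>M) \<noteq> \<infinity>" by simp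
  moreover have "(\<lambda>\<omega>. \<integral>\<^sup>+p. ennreal ((cutoff p \<omega>)\<^sup>2) \<partial>lborel) \<in> borel_measurable M"
    using cutoff_measurable_swap by measurable
  ultimately have "AE \<omega> in M. (\<integral>\<^sup>+p. ennreal ((cutoff p \<omega>)\<^sup>2) \<partial>lborel) \<noteq> \<infinity>"
    by (intro nn_integral_PInf_AE)
  with AE_space show ?thesis
  proof eventually_elim
    case (elim \<omega>)
    then have i2: "integrable lborel (\<lambda>p. (cutoff p \<omega>)\<^sup>2)"
      by (intro integrableI_bounded) (auto simp: less_top[symmetric])
    have iS: "integrable lborel (indicator S :: 'i \<Rightarrow> real)" using S by simp
    have "integrable lborel (\<lambda>p. cutoff p \<omega>)"
    proof (rule Bochner_Integration.integrable_bound[OF Bochner_Integration.integrable_add[OF iS i2]])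
      have "\<bar>y\<bar> \<le> 1 + y\<^sup>2" for y :: real
        using sum_squares_bound[of 1 "\<bar>y\<bar>"] by simp
      then show "AE p in lborel. norm (cutoff p \<omega>) \<le> norm (indicator S p + (cutoff p \<omega>)\<^sup>2 :: real)"
        by (auto simp: cutoff_def indicator_def intro!: AE_I2)
    qed (use elim in simp)
    with i2 show ?case by simp
  qed
qed

text \<open>Paths may be discontinuous, so smallness appears only in the mean: the pathwise bound
  followed by Tonelli leaves the expected squared increments of \<open>cutoff\<close>. They are at
  most e if p and q both lie in S, and zero if neither does. Otherwise the segment between them
  meets the frontier, the increment is merely at most B, but q then lies in U, whose volume is at
  most e.\<close>

lemma Riemann_sum_error:
  assumes S: "S \<subseteq> cbox a b" and e: "e > 0"
    and U: "open U" "emeasure lborel U \<le> ennreal e" "frontier S \<subseteq> U"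
    and d1: "\<And>p q. dist p q < d \<Longrightarrow> expectation (\<lambda>\<omega>. (X p \<omega> - X q \<omega>)\<^sup>2) \<le> e"
    and d2: "(\<Union>x\<in>frontier S. ball x d) \<subseteq> U"
    and D: "D tagged_division_of cbox a b" "(\<lambda>p. ball p d) fine D"
  defines "A \<equiv> \<lambda>\<omega>. (\<Sum>(p, k)\<in>D. if p \<in> S then measure lborel k * X p \<omega> else 0) - path_integral \<omega>"
  shows "sq_integrable M A"
    and "expectation (\<lambda>\<omega>. (A \<omega>)\<^sup>2) \<le> measure lborel (cbox a b) * (e * measure lborel (cbox a b) + B * e)"
proof -
  interpret pair_sigma_finite lborel M ..
  let ?V = "measure lborel (cbox a b)"
  have A_eq: "A \<omega> = (\<Sum>(p, k)\<in>D. measure lborel k * cutoff p \<omega>) - integral\<^sup>L lborel (\<lambda>q. cutoff q \<omega>)" for \<omega>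
    unfolding A_def path_integral_def cutoff_def by (intro arg_cong2[where f=minus] sum.cong) auto
  have cutoff_outside: "cutoff q \<omega> = 0" if "q \<notin> cbox a b" for q \<omega>
    using S that by (auto simp: cutoff_def indicator_def)
  have Am [measurable]: "A \<in> borel_measurable M"
    unfolding A_eq[abs_def] path_integral_def[symmetric] split_def
    using sq_integrable_measurable[OF sq_integrable_cutoff] by measurable
  have [measurable]: "U \<in> sets borel" using U(1) by simp
  \<comment> \<open>This majorant of the mean squared increment does not depend on the tag p, so the
    integrals over the cells recombine into one over the box.\<close>
  define g where "g q = e + B * indicator U q" for q
  have g0: "g q \<ge> 0" for q using e B_nonneg by (simp add: g_def)
  have increment: "expectation (\<lambda>\<omega>. (cutoff p \<omega> - cutoff q \<omega>)\<^sup>2) \<le> g q" if pq: "dist p q < d" for p q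
  proof -
    consider "p \<in> S" "q \<in> S" | "p \<notin> S" "q \<notin> S" | "p \<in> S" "q \<notin> S" | "p \<notin> S" "q \<in> S" by blast
    then show ?thesis
    proof cases
      case 1
      then show ?thesis using d1[OF pq] B_nonneg by (simp add: cutoff_def g_def indicator_def)
    next
      case 2
      then show ?thesis using g0 by (simp add: cutoff_def)
    next
      case 3
      have "q \<in> U"
      proof -
        have "closed_segment p q \<inter> frontier S \<noteq> {}"
          using 3 by (intro connected_Int_frontier) auto
        then obtain z where z: "z \<in> closed_segment p q" "z \<in> frontier S" by blast
        have "dist z q \<le> dist p q" using dist_in_closed_segment[OF z(1)] by (simp add: dist_commute)
        with pq have "q \<in> ball z d" by simp
        with z d2 show ?thesis by blast
      qed
      then show ?thesis using 3 second_moment_le[of p] e by (simp add: cutoff_def g_def)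
    next
      case 4
      have "q \<in> U"
      proof -
        have "closed_segment q p \<inter> frontier S \<noteq> {}"
          using 4 by (intro connected_Int_frontier) auto
        then obtain z where z: "z \<in> closed_segment q p" "z \<in> frontier S" by blast
        have "dist z q \<le> dist p q" using dist_in_closed_segment[OF z(1)] by (simp add: dist_commute)
        with pq have "q \<in> ball z d" by simp
        with z d2 show ?thesis by blast
      qed
      then show ?thesis using 4 second_moment_le[of q] e by (simp add: cutoff_def g_def)
    qed
  qed
  have g_int: "set_integrable lborel (cbox a b) g"
    unfolding g_def[abs_def] set_integrable_def
    by (auto simp: algebra_simps simp flip: indicator_inter_arith
        intro!: Bochner_Integration.integrable_add integrable_mult_right)
      (simp_all add: emeasure_lborel_cbox_eq sets.Int order.strict_trans1[OF emeasure_mono, of _ "cbox a b"])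
  have increment_measurable: "(\<lambda>(q, \<omega>). ennreal (indicator k q * (cutoff p \<omega> - cutoff q \<omega>)\<^sup>2)) \<in> borel_measurable (lborel \<Otimes>\<^sub>M M)"
    if pk: "(p, k) \<in> D" for p k
  proof -
    obtain u v where k: "k = cbox u v" using tagged_division_ofD(4)[OF D(1) pk] by blast
    have [measurable]: "(\<lambda>x. cutoff (fst x) (snd x)) \<in> borel_measurable (lborel \<Otimes>\<^sub>M M)"
      using cutoff_measurable by (simp add: case_prod_beta')
    have [measurable]: "cutoff p \<in> borel_measurable M" using sq_integrable_cutoff[of p] by (simp add: sq_integrable_def)
    have [measurable]: "k \<in> sets lborel" by (simp add: k)
    show ?thesis unfolding case_prod_beta' by measurable
  qed
  have inner_measurable: "(\<lambda>\<omega>. \<integral>\<^sup>+q. ennreal (indicator k q * (cutoff p \<omega> - cutoff q \<omega>)\<^sup>2) \<partial>lborel) \<in> borel_measurable M"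
    if pk: "(p, k) \<in> D" for p k
    using increment_measurable[OF pk] by (subst (asm) measurable_pair_swap_iff)
      (auto simp: case_prod_beta' intro!: lborel.borel_measurable_nn_integral)
  have "(\<integral>\<^sup>+\<omega>. ennreal ((A \<omega>)\<^sup>2) \<partial>M) \<le> (\<integral>\<^sup>+\<omega>. (\<Sum>(p, k)\<in>D. (\<integral>\<^sup>+q. ennreal (indicator k q * (cutoff p \<omega> - cutoff q \<omega>)\<^sup>2) \<partial>lborel)) * ennreal ?V \<partial>M)"
  proof (rule nn_integral_mono_AE)
    show "AE \<omega> in M. ennreal ((A \<omega>)\<^sup>2) \<le> (\<Sum>(p, k)\<in>D. (\<integral>\<^sup>+q. ennreal (indicator k q * (cutoff p \<omega> - cutoff q \<omega>)\<^sup>2) \<partial>lborel)) * ennreal ?V"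
      using AE_integrable_cutoff
    proof eventually_elim
      case (elim \<omega>)
      have "(LINT q:k|lborel. (cutoff p \<omega> - cutoff q \<omega>)\<^sup>2) \<ge> 0 \<and> ennreal (LINT q:k|lborel. (cutoff p \<omega> - cutoff q \<omega>)\<^sup>2) = (\<integral>\<^sup>+q. ennreal (indicator k q * (cutoff p \<omega> - cutoff q \<omega>)\<^sup>2) \<partial>lborel)"
        if pk: "(p, k) \<in> D" for p k
      proof -
        obtain u v where k: "k = cbox u v" using tagged_division_ofD(4)[OF D(1) pk] by blast
        have "(\<lambda>q. (cutoff p \<omega> - cutoff q \<omega>)\<^sup>2) = (\<lambda>q. (cutoff p \<omega>)\<^sup>2 - 2 * cutoff p \<omega> * cutoff q \<omega> + (cutoff q \<omega>)\<^sup>2)"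
          by (auto simp: power2_diff algebra_simps)
        moreover have "set_integrable lborel k (\<lambda>q. cutoff q \<omega>)" "set_integrable lborel k (\<lambda>q. (cutoff q \<omega>)\<^sup>2)" "set_integrable lborel k (\<lambda>q. (cutoff p \<omega>)\<^sup>2)"
          using elim k by (auto intro: set_integrable_cbox set_integrable_const_cbox)
        ultimately have "set_integrable lborel k (\<lambda>q. (cutoff p \<omega> - cutoff q \<omega>)\<^sup>2)" by simp
        then show ?thesis
          unfolding set_lebesgue_integral_def set_integrable_def by (simp add: nn_integral_eq_integral)
      qed
      note * = this
      have "(A \<omega>)\<^sup>2 \<le> (\<Sum>(p, k)\<in>D. LINT q:k|lborel. (cutoff p \<omega> - cutoff q \<omega>)\<^sup>2) * ?V"
        unfolding A_eq using elim S by (intro Riemann_sum_error_square_le D) (auto simp: cutoff_outside)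
      then have "ennreal ((A \<omega>)\<^sup>2) \<le> ennreal ((\<Sum>(p, k)\<in>D. LINT q:k|lborel. (cutoff p \<omega> - cutoff q \<omega>)\<^sup>2) * ?V)"
        by (rule ennreal_leI)
      also have "\<dots> = (\<Sum>(p, k)\<in>D. ennreal (LINT q:k|lborel. (cutoff p \<omega> - cutoff q \<omega>)\<^sup>2)) * ennreal ?V"
        using * by (subst ennreal_mult) (auto intro!: sum_nonneg simp: split_def simp flip: sum_ennreal)
      also have "\<dots> = (\<Sum>(p, k)\<in>D. (\<integral>\<^sup>+q. ennreal (indicator k q * (cutoff p \<omega> - cutoff q \<omega>)\<^sup>2) \<partial>lborel)) * ennreal ?V"
        using * by (intro arg_cong2[where f="(*)"] sum.cong) auto
      finally show ?case .
    qed
  qed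
  also have "\<dots> = (\<Sum>(p, k)\<in>D. (\<integral>\<^sup>+\<omega>. \<integral>\<^sup>+q. ennreal (indicator k q * (cutoff p \<omega> - cutoff q \<omega>)\<^sup>2) \<partial>lborel \<partial>M)) * ennreal ?V"
    using inner_measurable
    by (subst nn_integral_multc) (auto simp: split_def nn_integral_sum intro!: borel_measurable_sum)
  also have "\<dots> \<le> (\<Sum>(p, k)\<in>D. ennreal (LINT q:k|lborel. g q)) * ennreal ?V"
  proof (intro mult_right_mono sum_mono, clarify)
    fix p k assume pk: "(p, k) \<in> D"
    obtain u v where k: "k = cbox u v" "k \<subseteq> cbox a b"
      using tagged_division_ofD(3,4)[OF D(1) pk] by blast
    have kd: "k \<subseteq> ball p d" using D(2) pk by (auto simp: fine_def)
    note m = increment_measurable[OF pk]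
    have "(\<integral>\<^sup>+\<omega>. \<integral>\<^sup>+q. ennreal (indicator k q * (cutoff p \<omega> - cutoff q \<omega>)\<^sup>2) \<partial>lborel \<partial>M) =
      (\<integral>\<^sup>+q. \<integral>\<^sup>+\<omega>. ennreal (indicator k q * (cutoff p \<omega> - cutoff q \<omega>)\<^sup>2) \<partial>M \<partial>lborel)"
      by (rule Fubini'[OF m])
    also have "\<dots> \<le> (\<integral>\<^sup>+q. ennreal (indicator k q * g q) \<partial>lborel)"
    proof (rule nn_integral_mono)
      fix q
      show "(\<integral>\<^sup>+\<omega>. ennreal (indicator k q * (cutoff p \<omega> - cutoff q \<omega>)\<^sup>2) \<partial>M) \<le> ennreal (indicator k q * g q)"
      proof (cases "q \<in> k")
        case True
        then have "(\<integral>\<^sup>+\<omega>. ennreal (indicator k q * (cutoff p \<omega> - cutoff q \<omega>)\<^sup>2) \<partial>M) = ennreal (expectation (\<lambda>\<omega>. (cutoff p \<omega> - cutoff q \<omega>)\<^sup>2))"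
          using sq_integrable_diff[OF sq_integrable_cutoff sq_integrable_cutoff, of p q]
          by (simp add: sq_integrable_def nn_integral_eq_integral)
        also have "\<dots> \<le> ennreal (g q)" using True kd by (intro ennreal_leI increment) auto
        finally show ?thesis using True by simp
      qed simp
    qed
    also have "\<dots> = ennreal (LINT q:k|lborel. g q)"
      using set_integrable_subset[OF g_int, of k] k g0
      unfolding set_lebesgue_integral_def set_integrable_def by (simp add: nn_integral_eq_integral)
    finally show "(\<integral>\<^sup>+\<omega>. \<integral>\<^sup>+q. ennreal (indicator k q * (cutoff p \<omega> - cutoff q \<omega>)\<^sup>2) \<partial>lborel \<partial>M) \<le> ennreal (LINT q:k|lborel. g q)" .
  qed simp
  also have "\<dots> = ennreal ((LINT q:cbox a b|lborel. g q) * ?V)"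
    unfolding set_integral_tagged_division[OF g_int D(1), symmetric] using g0
    by (subst ennreal_mult) (auto intro!: sum_nonneg Bochner_Integration.integral_nonneg simp: split_def set_lebesgue_integral_def simp flip: sum_ennreal)
  also have "\<dots> \<le> ennreal (?V * (e * ?V + B * e))"
  proof (rule ennreal_leI)
    have U': "emeasure lborel (cbox a b \<inter> U) \<le> ennreal e"
      using U(2) by (rule order_trans[rotated]) (auto intro: emeasure_mono)
    then have "measure lborel (cbox a b \<inter> U) \<le> e"
      using e by (simp add: measure_def enn2real_leI)
    moreover have "(LINT q:cbox a b|lborel. g q) = e * ?V + B * measure lborel (cbox a b \<inter> U)"
    proof -
      have "emeasure lborel (cbox a b \<inter> U) < \<infinity>" using U' by (simp add: order.strict_trans1[OF U'])
      then have "integrable lborel (indicator (cbox a b \<inter> U) :: 'i \<Rightarrow> real)" by simp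
      then have "(LINT q|lborel. e * indicator (cbox a b) q + B * indicator (cbox a b \<inter> U) q) = e * ?V + B * measure lborel (cbox a b \<inter> U)"
        by (simp add: emeasure_lborel_cbox_eq)
      then show ?thesis
        by (simp add: set_lebesgue_integral_def g_def algebra_simps indicator_inter_arith)
    qed
    ultimately show "(LINT q:cbox a b|lborel. g q) * ?V \<le> ?V * (e * ?V + B * e)"
      using B_nonneg by (simp add: mult.commute mult_left_mono)
  qed
  finally have bound: "(\<integral>\<^sup>+\<omega>. ennreal ((A \<omega>)\<^sup>2) \<partial>M) \<le> ennreal (?V * (e * ?V + B * e))" .
  then have i: "integrable M (\<lambda>\<omega>. (A \<omega>)\<^sup>2)"
    by (intro integrableI_bounded) (auto simp: order.strict_trans1)
  then show "sq_integrable M A" by (simp add: sq_integrable_def)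
  show "expectation (\<lambda>\<omega>. (A \<omega>)\<^sup>2) \<le> ?V * (e * ?V + B * e)"
    using bound e B_nonneg by (subst (asm) nn_integral_eq_integral[OF i]) auto
qed

lemma Riemann_sums_converge:
  assumes S: "S \<subseteq> cbox a b" and e: "e > 0"
  obtains d where "d > 0" "\<And>D. D tagged_division_of cbox a b \<Longrightarrow> (\<lambda>p. ball p d) fine D \<Longrightarrow>
    sq_integrable M (\<lambda>\<omega>. (\<Sum>(p, k)\<in>D. if p \<in> S then measure lborel k * X p \<omega> else 0) - path_integral \<omega>) \<and>
    expectation (\<lambda>\<omega>. ((\<Sum>(p, k)\<in>D. if p \<in> S then measure lborel k * X p \<omega> else 0) - path_integral \<omega>)\<^sup>2) < e"
proof -
  let ?V = "measure lborel (cbox a b)"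
  \<comment> \<open>With this c the bound of \<open>Riemann_sum_error\<close> is c e'. Dividing by c
    + 1 instead of c covers boxes of volume zero.\<close>
  define c where "c = ?V * (?V + B)"
  define e' where "e' = e / (2 * (c + 1))"
  have c: "c \<ge> 0" using B_nonneg by (simp add: c_def)
  then have e': "e' > 0" using e by (simp add: e'_def)
  have "?V * (e' * ?V + B * e') = c * e'" by (simp add: c_def algebra_simps)
  also have "\<dots> \<le> (c + 1) * e'" using e' by simp
  also have "\<dots> = e / 2" using c by (simp add: e'_def divide_simps)
  finally have small: "?V * (e' * ?V + B * e') < e" using e by simp
  have "frontier S \<in> null_sets lborel"
    using negligible_frontier null_sets_completion_iff[of "frontier S" lborel]
      borel_closed[OF frontier_closed[of S]]
    unfolding negligible_iff_null_sets sets_lborel by blast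
  then have null: "emeasure lborel (frontier S) = 0" by auto
  \<comment> \<open>Outer regularity surrounds the null frontier by an open set of small volume;
    compactness of the frontier then gives a uniform width inside it.\<close>
  obtain U where U: "open U" "frontier S \<subseteq> U" "emeasure lborel (U - frontier S) < e'"
    using outer_regular_lborel[of "frontier S" e'] e' by auto
  have "emeasure lborel U \<le> emeasure lborel (frontier S) + emeasure lborel (U - frontier S)"
    using U by (subst plus_emeasure) (auto intro: emeasure_mono)
  then have U': "emeasure lborel U \<le> ennreal e'" using U(3) by (simp add: null)
  obtain d2 where d2: "d2 > 0" "(\<Union>x\<in>frontier S. ball x d2) \<subseteq> U"
    using compact_subset_open_imp_ball_epsilon_subset[OF _ U(1,2)] compact_S by (auto simp: compact_frontier)
  obtain d1 where d1: "d1 > 0" "\<And>p q. dist p q < d1 \<Longrightarrow> expectation (\<lambda>\<omega>. (X p \<omega> - X q \<omega>)\<^sup>2) \<le> e'"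
    using L2_continuous[OF e'] by blast
  define d where "d = min d1 d2"
  show ?thesis
  proof (rule that[of d])
    show "d > 0" using d1 d2 by (simp add: d_def)
    fix D assume D: "D tagged_division_of cbox a b" "(\<lambda>p. ball p d) fine D"
    have dd: "dist p q < d \<Longrightarrow> expectation (\<lambda>\<omega>. (X p \<omega> - X q \<omega>)\<^sup>2) \<le> e'" for p q
      using d1(2) by (simp add: d_def)
    have du: "(\<Union>x\<in>frontier S. ball x d) \<subseteq> U"
      using d2(2) by (auto simp: d_def subset_eq)
    from Riemann_sum_error[OF S e' U(1) U' U(2) dd du D] small
    show "sq_integrable M (\<lambda>\<omega>. (\<Sum>(p, k)\<in>D. if p \<in> S then measure lborel k * X p \<omega> else 0) - path_integral \<omega>) \<and>
      expectation (\<lambda>\<omega>. ((\<Sum>(p, k)\<in>D. if p \<in> S then measure lborel k * X p \<omega> else 0) - path_integral \<omega>)\<^sup>2) < e"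
      by simp
  qed
qed

lemma sq_integrable_Riemann_sum:
  "sq_integrable M (\<lambda>\<omega>. \<Sum>(p, k)\<in>D. if p \<in> S then measure lborel k * X p \<omega> else 0)"
  unfolding split_def
proof (rule sq_integrable_sum)
  fix x
  show "sq_integrable M (\<lambda>\<omega>. if fst x \<in> S then measure lborel (snd x) * X (fst x) \<omega> else 0)"
    by (cases "fst x \<in> S") (auto intro: sq_integrable_X)
qed

lemma has_ms_integral_exists: "has_ms_integral M S X path_integral"
proof -
  have bS: "bounded S" using compact_S by (rule compact_imp_bounded)
  obtain a b where ab: "S \<subseteq> cbox a b" using bounded_subset_cbox_symmetric[OF bS] by metis
  obtain d where d: "d > 0" "\<And>D. D tagged_division_of cbox a b \<Longrightarrow> (\<lambda>p. ball p d) fine D \<Longrightarrow>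
    sq_integrable M (\<lambda>\<omega>. (\<Sum>(p, k)\<in>D. if p \<in> S then measure lborel k * X p \<omega> else 0) - path_integral \<omega>)"
    by (rule Riemann_sums_converge[OF ab zero_less_one]) blast
  obtain D where D: "D tagged_division_of cbox a b" "(\<lambda>p. ball p d) fine D"
    using fine_division_exists[of "\<lambda>p. ball p d" a b] d(1) by (auto simp: gauge_def)
  \<comment> \<open>Subtracting the square integrable error of one Riemann sum from that sum leaves
    the path integral.\<close>
  have "sq_integrable M (\<lambda>\<omega>. (\<Sum>(p, k)\<in>D. if p \<in> S then measure lborel k * X p \<omega> else 0) -
    ((\<Sum>(p, k)\<in>D. if p \<in> S then measure lborel k * X p \<omega> else 0) - path_integral \<omega>))"
    by (rule sq_integrable_diff[OF sq_integrable_Riemann_sum d(2)[OF D]])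
  then have "sq_integrable M path_integral" by simp
  moreover have "\<exists>d>0. \<forall>D. D tagged_division_of cbox a b \<and> (\<lambda>p. ball p d) fine D \<longrightarrow>
      expectation (\<lambda>\<omega>. ((\<Sum>(p, k)\<in>D. if p \<in> S then measure lborel k * X p \<omega> else 0) - path_integral \<omega>)\<^sup>2) < e"
    if "S \<subseteq> cbox a b" "e > 0" for a b e
    by (rule Riemann_sums_converge[OF that]) blast
  ultimately show ?thesis
    unfolding has_ms_integral_def using bS sq_integrable_X by blast
qed

end

section \<open>Convergence in distribution under small perturbations\<close>

lemma (in prob_space) Chebyshev_second_moment:
  assumes D: "sq_integrable M D" and e: "e > 0"
  shows "prob {\<omega> \<in> space M. e < \<bar>D \<omega>\<bar>} \<le> expectation (\<lambda>\<omega>. (D \<omega>)\<^sup>2) / e\<^sup>2"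
proof -
  have [measurable]: "D \<in> borel_measurable M" using D by (simp add: sq_integrable_def)
  have "prob {\<omega> \<in> space M. e < \<bar>D \<omega>\<bar>} \<le> prob {\<omega> \<in> space M. e\<^sup>2 \<le> (D \<omega>)\<^sup>2}"
  proof (rule finite_measure_mono)
    show "{\<omega> \<in> space M. e < \<bar>D \<omega>\<bar>} \<subseteq> {\<omega> \<in> space M. e\<^sup>2 \<le> (D \<omega>)\<^sup>2}"
      using e power_mono[of e "\<bar>D _\<bar>" 2] by (auto intro: less_imp_le)
  qed simp
  also have "\<dots> \<le> expectation (\<lambda>\<omega>. (D \<omega>)\<^sup>2) / e\<^sup>2"
    using D e by (intro integral_Markov_inequality_measure[of _ _ "{}"]) (auto simp: sq_integrable_def)
  finally show ?thesis .
qed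

text \<open>A Slutsky argument: the event that Y' is at most x is sandwiched between those of Y at x
  - e and x + e, up to the event that the two differ by more than e. Eventual hypotheses are enough
  for a limit at infinity.\<close>

lemma conv_in_distr_L2_close:
  assumes M: "prob_space M" and \<mu>: "real_distribution \<mu>"
    and Y: "\<forall>\<^sub>F T in at_top. Y T \<in> borel_measurable M" and Y': "\<forall>\<^sub>F T in at_top. Y' T \<in> borel_measurable M"
    and sq: "\<forall>\<^sub>F T in at_top. sq_integrable M (\<lambda>\<omega>. Y T \<omega> - Y' T \<omega>)"
    and close: "((\<lambda>T. LINT \<omega>|M. (Y T \<omega> - Y' T \<omega>)\<^sup>2) \<longlongrightarrow> 0) at_top"
    and conv: "conv_in_distr M Y \<mu>"
  shows "conv_in_distr M Y' \<mu>"
  unfolding conv_in_distr_def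
proof (intro allI impI)
  interpret prob_space M by fact
  interpret \<mu>: real_distribution \<mu> by fact
  fix x assume x: "isCont (cdf \<mu>) x"
  have cdf_eq: "cdf (distr M borel W) z = prob {\<omega> \<in> space M. W \<omega> \<le> z}" if "W \<in> borel_measurable M" for W z
    unfolding cdf_def using that by (subst measure_distr) (auto intro!: arg_cong[where f=prob])
  let ?F = "\<lambda>T. cdf (distr M borel (Y T))" and ?F' = "\<lambda>T. cdf (distr M borel (Y' T))"
  show "((\<lambda>T. ?F' T x) \<longlongrightarrow> cdf \<mu> x) at_top"
  proof (rule tendstoI)
    fix r :: real assume r: "r > 0"
    obtain \<delta> where \<delta>: "\<delta> > 0" "\<And>y. \<bar>y - x\<bar> < \<delta> \<Longrightarrow> \<bar>cdf \<mu> y - cdf \<mu> x\<bar> < r / 3"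
      using x r unfolding continuous_at_eps_delta by (metis dist_real_def divide_pos_pos zero_less_numeral)
    \<comment> \<open>Convergence is known at continuity points only. The discontinuities are
      countable, so some e below \<delta> makes both x + e and x - e continuity points.\<close>
    define N where "N = {z. \<not> isCont (cdf \<mu>) z}"
    have "countable N"
      using \<mu>.countable_atoms by (simp add: N_def \<mu>.isCont_cdf zero_less_measure_iff)
    then have "countable ((\<lambda>z. z - x) ` N \<union> (\<lambda>z. x - z) ` N)" by simp
    moreover have "uncountable {0<..<\<delta>}" using \<delta>(1) by (simp add: uncountable_open_interval)
    ultimately have "\<not> {0<..<\<delta>} \<subseteq> (\<lambda>z. z - x) ` N \<union> (\<lambda>z. x - z) ` N"
      by (meson countable_subset)
    then obtain e where e: "0 < e" "e < \<delta>" "e \<notin> (\<lambda>z. z - x) ` N" "e \<notin> (\<lambda>z. x - z) ` N"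
      unfolding subset_eq by (metis (no_types, lifting) UnI1 UnI2 greaterThanLessThan_iff)
    have "x + e \<notin> N" using e(3) by (metis add_diff_cancel_left' imageI)
    moreover have "x - e \<notin> N" using e(4) by (metis diff_diff_eq2 add_diff_cancel_left' imageI)
    ultimately have cont: "isCont (cdf \<mu>) (x + e)" "isCont (cdf \<mu>) (x - e)" by (simp_all add: N_def)
    have "\<forall>\<^sub>F T in at_top. dist (?F T (x + e)) (cdf \<mu> (x + e)) < r / 3"
      using conv cont(1) r unfolding conv_in_distr_def by (intro tendstoD) auto
    moreover have "\<forall>\<^sub>F T in at_top. dist (?F T (x - e)) (cdf \<mu> (x - e)) < r / 3"
      using conv cont(2) r unfolding conv_in_distr_def by (intro tendstoD) auto
    \<comment> \<open>The factor e^2 is the denominator in Chebyshev's inequality, so the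
      exceptional probability falls below r/3.\<close>
    moreover have "\<forall>\<^sub>F T in at_top. (LINT \<omega>|M. (Y T \<omega> - Y' T \<omega>)\<^sup>2) < r / 3 * e\<^sup>2"
      using r e by (intro order_tendstoD(2)[OF close]) simp
    ultimately show "\<forall>\<^sub>F T in at_top. dist (?F' T x) (cdf \<mu> x) < r"
      using Y Y' sq
    proof eventually_elim
      case (elim T)
      note [measurable] = elim(4,5)
      let ?P = "prob {\<omega> \<in> space M. e < \<bar>Y T \<omega> - Y' T \<omega>\<bar>}"
      have "?P \<le> expectation (\<lambda>\<omega>. (Y T \<omega> - Y' T \<omega>)\<^sup>2) / e\<^sup>2"
        by (rule Chebyshev_second_moment[OF elim(6) e(1)])
      also have "\<dots> < r / 3" using elim(3) e by (simp add: divide_simps)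
      finally have P: "?P < r / 3" .
      have "prob {\<omega> \<in> space M. Y' T \<omega> \<le> x} \<le> prob ({\<omega> \<in> space M. Y T \<omega> \<le> x + e} \<union> {\<omega> \<in> space M. e < \<bar>Y T \<omega> - Y' T \<omega>\<bar>})"
        by (intro finite_measure_mono) auto
      also have "\<dots> \<le> prob {\<omega> \<in> space M. Y T \<omega> \<le> x + e} + ?P"
        by (intro measure_Un_le) auto
      finally have up: "?F' T x \<le> ?F T (x + e) + ?P" by (simp add: cdf_eq)
      have "prob {\<omega> \<in> space M. Y T \<omega> \<le> x - e} \<le> prob ({\<omega> \<in> space M. Y' T \<omega> \<le> x} \<union> {\<omega> \<in> space M. e < \<bar>Y T \<omega> - Y' T \<omega>\<bar>})"
        by (intro finite_measure_mono) auto
      also have "\<dots> \<le> prob {\<omega> \<in> space M. Y' T \<omega> \<le> x} + ?P"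
        by (intro measure_Un_le) auto
      finally have low: "?F T (x - e) \<le> ?F' T x + ?P" by (simp add: cdf_eq)
      have "\<bar>cdf \<mu> (x + e) - cdf \<mu> x\<bar> < r / 3" "\<bar>cdf \<mu> (x - e) - cdf \<mu> x\<bar> < r / 3"
        using \<delta>(2)[of "x + e"] \<delta>(2)[of "x - e"] e by simp_all
      then show ?case
        using up low P elim(1,2) unfolding dist_real_def by linarith
    qed
  qed
qed

section \<open>Integral functionals of a Gaussian random field\<close>

lemma (in prob_space) gaussian_rv_moments:
  assumes W: "gaussian_rv M W" "sq_integrable M W" and mean: "expectation W = 0" and var: "expectation (\<lambda>\<omega>. (W \<omega>)\<^sup>2) = v"
  shows "has_bochner_integral M (\<lambda>\<omega>. W \<omega> ^ (2 * k)) (fact (2 * k) / (2 ^ k * fact k) * v ^ k)"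
    and "has_bochner_integral M (\<lambda>\<omega>. W \<omega> ^ (2 * k + 1)) 0"
proof -
  have [measurable]: "W \<in> borel_measurable M" using W by (simp add: gaussian_rv_def)
  consider (normal) \<mu> \<sigma> where "0 < \<sigma>" "distributed M lborel W (\<lambda>x. ennreal (normal_density \<mu> \<sigma> x))"
    | (const) \<mu> where "AE \<omega> in M. W \<omega> = \<mu>"
    using W unfolding gaussian_rv_def by blast
  then have "has_bochner_integral M (\<lambda>\<omega>. W \<omega> ^ (2 * k)) (fact (2 * k) / (2 ^ k * fact k) * v ^ k) \<and>
    has_bochner_integral M (\<lambda>\<omega>. W \<omega> ^ (2 * k + 1)) 0"
  proof cases
    case normal
    have \<mu>: "\<mu> = 0" using normal_distributed_expectation[OF normal] mean by simp
    have \<sigma>: "\<sigma>\<^sup>2 = v" using normal_distributed_variance[OF normal] mean var by simp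
    have tr: "has_bochner_integral M (\<lambda>\<omega>. W \<omega> ^ n) c"
      if "has_bochner_integral lborel (\<lambda>x. normal_density \<mu> \<sigma> x * (x - \<mu>) ^ n) c" for n c
      using that distributed_integral[OF normal(2), of "\<lambda>x. x ^ n"] distributed_integrable[OF normal(2), of "\<lambda>x. x ^ n"]
      by (simp add: has_bochner_integral_iff \<mu>)
    from tr[OF normal_moment_even[OF normal(1), of \<mu> k]] tr[OF normal_moment_odd[OF normal(1), of \<mu> k]]
    show ?thesis by (simp add: \<sigma> power_divide)
  next
    \<comment> \<open>The mean forces the constant to be 0. Writing the moments as 0 ^ n keeps the
      one of order 0 equal to 1, in agreement with v ^ 0.\<close>
    case const
    have "expectation W = \<mu>"
      using integral_cong_AE[of W M "\<lambda>_. \<mu>"] const by (simp add: prob_space)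
    then have \<mu>: "\<mu> = 0" using mean by simp
    have "v = 0"
      using integral_cong_AE[of "\<lambda>\<omega>. (W \<omega>)\<^sup>2" M "\<lambda>_. 0"] const var by (simp add: \<mu>)
    have "has_bochner_integral M (\<lambda>\<omega>. W \<omega> ^ n) (0 ^ n)" for n
    proof -
      have "has_bochner_integral M (\<lambda>_. 0 ^ n :: real) (0 ^ n)"
        by (simp add: has_bochner_integral_iff prob_space)
      moreover have "AE \<omega> in M. 0 ^ n = W \<omega> ^ n" using const by eventually_elim (simp add: \<mu>)
      ultimately show ?thesis by (subst has_bochner_integral_cong_AE[where g="\<lambda>_. 0 ^ n"]) (auto simp: eq_commute)
    qed
    from this[of "2 * k"] this[of "2 * k + 1"] show ?thesis
      by (cases k) (simp_all add: \<open>v = 0\<close>)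
  qed
  then show "has_bochner_integral M (\<lambda>\<omega>. W \<omega> ^ (2 * k)) (fact (2 * k) / (2 ^ k * fact k) * v ^ k)"
    and "has_bochner_integral M (\<lambda>\<omega>. W \<omega> ^ (2 * k + 1)) 0" by simp_all
qed

text \<open>Mean zero and second moment one exclude the point masses that \<open>gaussian_rv\<close>
  admits.\<close>

lemma (in prob_space) gaussian_rv_distr_std_normal:
  assumes W: "gaussian_rv M W" and mean: "expectation W = 0" and var: "expectation (\<lambda>\<omega>. (W \<omega>)\<^sup>2) = 1"
  shows "distr M borel W = std_normal_distribution"
proof -
  have [measurable]: "W \<in> borel_measurable M" using W by (simp add: gaussian_rv_def)
  have "\<not> (AE \<omega> in M. W \<omega> = \<mu>)" for \<mu>
  proof
    assume c: "AE \<omega> in M. W \<omega> = \<mu>"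
    have "\<mu> = 0" using integral_cong_AE[of W M "\<lambda>_. \<mu>"] c mean by (simp add: prob_space)
    then show False
      using integral_cong_AE[of "\<lambda>\<omega>. (W \<omega>)\<^sup>2" M "\<lambda>_. 0"] c var by simp
  qed
  with W obtain \<mu> \<sigma> where d: "0 < \<sigma>" "distributed M lborel W (\<lambda>x. ennreal (normal_density \<mu> \<sigma> x))"
    unfolding gaussian_rv_def by blast
  have "\<mu> = 0" using normal_distributed_expectation[OF d] mean by simp
  moreover have "\<sigma>\<^sup>2 = 1" using normal_distributed_variance[OF d] mean var by simp
  then have "\<sigma> = 1" using d(1) by (simp add: power2_eq_1_iff)
  ultimately have "distributed M lborel W (\<lambda>x. ennreal (std_normal_density x))" using d(2) by simp
  then have "distr M lborel W = std_normal_distribution" by (simp add: distributed_distr_eq_density)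
  moreover have "distr M borel W = distr M lborel W" by (rule distr_cong) simp_all
  ultimately show ?thesis by simp
qed

locale gaussian_random_field = prob_space M for M :: "'w measure" +
  fixes Z :: "'a::euclidean_space \<times> real \<Rightarrow> 'w \<Rightarrow> real" and C :: "real \<Rightarrow> real \<Rightarrow> real"
  assumes Z_measurable: "measurable_field M Z" and Z_ms_continuous: "ms_continuous M Z"
    and Z_gaussian: "gaussian_field M Z"
    and Z_mean: "\<And>p. expectation (Z p) = 0"
    and Z_var: "\<And>p. expectation (\<lambda>\<omega>. (Z p \<omega>)\<^sup>2) = 1"
    and Z_cov: "\<And>p q. expectation (\<lambda>\<omega>. Z p \<omega> * Z q \<omega>) = C (norm (fst p - fst q)) \<bar>snd p - snd q\<bar>"
    and C_nonneg: "\<And>p q :: 'a \<times> real. C (norm (fst p - fst q)) \<bar>snd p - snd q\<bar> \<ge> 0"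
begin

definition corr :: "'a \<times> real \<Rightarrow> 'a \<times> real \<Rightarrow> real" where
  "corr p q = C (norm (fst p - fst q)) \<bar>snd p - snd q\<bar>"

lemma Z_sq_integrable: "sq_integrable M (Z p)"
  using Z_ms_continuous unfolding ms_continuous_def by blast

lemma Z_section_measurable [measurable]: "Z p \<in> borel_measurable M"
  using Z_sq_integrable by (simp add: sq_integrable_def)

lemma corr_nonneg: "0 \<le> corr p q"
  by (simp add: corr_def C_nonneg)

lemma corr_le_1: "corr p q \<le> 1"
proof -
  have "(corr p q)\<^sup>2 \<le> 1\<^sup>2"
    using Cauchy_Schwarz[OF Z_sq_integrable Z_sq_integrable, of p q] by (simp add: Z_var Z_cov corr_def)
  then show ?thesis by (rule power2_le_imp_le) simp
qed

lemma pair: "std_gaussian_pair M (Z p) (Z q) (corr p q)"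
proof unfold_locales
  have g: "gaussian_rv M (\<lambda>\<omega>. a * Z p \<omega> + b * Z q \<omega>)" for a b
  \<comment> \<open>For p = q the index set {p, q} collapses to a singleton, so the two coefficients
    have to be added first.\<close>
  proof (cases "p = q")
    case True
    have "gaussian_rv M (\<lambda>\<omega>. \<Sum>i\<in>{p}. (a + b) * Z i \<omega>)"
      using Z_gaussian[unfolded gaussian_field_def, rule_format, of "{p}" "\<lambda>_. a + b"] by simp
    then show ?thesis using True by (simp add: distrib_right)
  next
    case False
    have "gaussian_rv M (\<lambda>\<omega>. \<Sum>i\<in>{p, q}. (if i = p then a else b) * Z i \<omega>)"
      using Z_gaussian[unfolded gaussian_field_def, rule_format, of "{p, q}" "\<lambda>i. if i = p then a else b"] by simp
    then show ?thesis using False by simp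
  qed
  have sq: "sq_integrable M (\<lambda>\<omega>. a * Z p \<omega> + b * Z q \<omega>)" for a b
    by (intro sq_integrable_add sq_integrable_cmult Z_sq_integrable)
  have mean: "expectation (\<lambda>\<omega>. a * Z p \<omega> + b * Z q \<omega>) = 0" for a b
    using sq_integrable_integrable[OF Z_sq_integrable] by (simp add: Z_mean)
  have var: "expectation (\<lambda>\<omega>. (a * Z p \<omega> + b * Z q \<omega>)\<^sup>2) = a\<^sup>2 + 2 * a * b * corr p q + b\<^sup>2" for a b
  proof -
    have "(\<lambda>\<omega>. (a * Z p \<omega> + b * Z q \<omega>)\<^sup>2) = (\<lambda>\<omega>. a\<^sup>2 * (Z p \<omega>)\<^sup>2 + 2 * a * b * (Z p \<omega> * Z q \<omega>) + b\<^sup>2 * (Z q \<omega>)\<^sup>2)"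
      by (auto simp: power2_eq_square algebra_simps)
    then show ?thesis
      using sq_integrable_power2[OF Z_sq_integrable] sq_integrable_mult[OF Z_sq_integrable Z_sq_integrable]
      by (simp add: Z_var Z_cov corr_def)
  qed
  show "has_bochner_integral M (\<lambda>\<omega>. (a * Z p \<omega> + b * Z q \<omega>) ^ (2 * k))
      (fact (2 * k) / (2 ^ k * fact k) * (a\<^sup>2 + 2 * a * b * corr p q + b\<^sup>2) ^ k)" for a b k
    by (rule gaussian_rv_moments(1)[OF g sq mean var])
  show "has_bochner_integral M (\<lambda>\<omega>. (a * Z p \<omega> + b * Z q \<omega>) ^ (2 * k + 1)) 0" for a b k
    by (rule gaussian_rv_moments(2)[OF g sq mean var])
  show "distr M borel (Z p) = std_normal_distribution"
    using g[of 1 0] by (intro gaussian_rv_distr_std_normal Z_mean Z_var) simp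
  show "distr M borel (Z q) = std_normal_distribution"
    using g[of 0 1] by (intro gaussian_rv_distr_std_normal Z_mean Z_var) simp
qed simp_all

text \<open>The mean squared increment is 2 (1 - corr), and corr depends on p - q only, so
  mean-square continuity at the origin is already uniform. Coinciding points are handled apart
  because the filter \<open>at 0\<close> omits its centre.\<close>

lemma corr_continuous:
  assumes "\<eta> > 0"
  obtains d where "d > 0" "\<And>p q. dist p q < d \<Longrightarrow> \<bar>corr p q - 1\<bar> < \<eta>"
proof -
  have sq: "expectation (\<lambda>\<omega>. (Z q \<omega> - Z p \<omega>)\<^sup>2) = 2 * (1 - corr q p)" for p q
  proof -
    have "(\<lambda>\<omega>. (Z q \<omega> - Z p \<omega>)\<^sup>2) = (\<lambda>\<omega>. (Z q \<omega>)\<^sup>2 - 2 * (Z q \<omega> * Z p \<omega>) + (Z p \<omega>)\<^sup>2)"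
      by (auto simp: power2_eq_square algebra_simps)
    then show ?thesis
      using sq_integrable_power2[OF Z_sq_integrable] sq_integrable_mult[OF Z_sq_integrable Z_sq_integrable]
      by (simp add: Z_var Z_cov corr_def)
  qed
  have "((\<lambda>q. 2 * (1 - corr q 0)) \<longlongrightarrow> 0) (at 0)"
    using Z_ms_continuous unfolding ms_continuous_def sq by blast
  from tendstoD[OF this, of "2 * \<eta>"] assms
  obtain d where d: "d > 0" "\<And>q. q \<noteq> 0 \<Longrightarrow> dist q 0 < d \<Longrightarrow> dist (2 * (1 - corr q 0)) 0 < 2 * \<eta>"
    unfolding eventually_at by auto
  have "\<bar>corr p q - 1\<bar> < \<eta>" if pq: "dist p q < d" for p q
  proof -
    have e: "corr p q = corr (p - q) 0" by (simp add: corr_def)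
    show ?thesis
    proof (cases "p = q")
      case True
      then have "corr p q = 1" using Z_var[of p] Z_cov[of p p] by (simp add: corr_def power2_eq_square)
      then show ?thesis using assms by simp
    next
      case False
      then show ?thesis using d(2)[of "p - q"] pq unfolding e by (simp add: dist_norm abs_minus_commute)
    qed
  qed
  with d(1) show ?thesis by (rule that)
qed

lemma sq_integrable_subordinated:
  "sq_integrable std_normal_distribution g \<Longrightarrow> sq_integrable M (\<lambda>\<omega>. g (Z p \<omega>))"
  by (rule std_gaussian_pair.sq_integrable_X[OF pair])

lemma expectation_subordinated:
  "g \<in> borel_measurable borel \<Longrightarrow> expectation (\<lambda>\<omega>. g (Z p \<omega>)) = (LINT x|std_normal_distribution. g x :: real)"
  by (rule std_gaussian_pair.expectation_X[OF pair])

lemma L2_continuous_field_subordinated: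
  assumes g: "sq_integrable std_normal_distribution g" and S: "compact S" "negligible (frontier S)"
  shows "L2_continuous_field M (\<lambda>p \<omega>. g (Z p \<omega>)) (LINT x|std_normal_distribution. (g x)\<^sup>2) S"
proof unfold_locales
  have [measurable]: "g \<in> borel_measurable borel" using g by (simp add: sq_integrable_def)
  show "measurable_field M (\<lambda>p \<omega>. g (Z p \<omega>))"
    using measurable_compose[of "\<lambda>(p, \<omega>). Z p \<omega>" _ borel g borel] Z_measurable
    by (simp add: measurable_field_def case_prod_beta')
  show "sq_integrable M (\<lambda>\<omega>. g (Z p \<omega>))" for p by (rule sq_integrable_subordinated[OF g])
  show "expectation (\<lambda>\<omega>. (g (Z p \<omega>))\<^sup>2) \<le> (LINT x|std_normal_distribution. (g x)\<^sup>2)" for p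
    using expectation_subordinated[of "\<lambda>x. (g x)\<^sup>2" p] by simp
  show "\<exists>d>0. \<forall>p q. dist p q < d \<longrightarrow> expectation (\<lambda>\<omega>. (g (Z p \<omega>) - g (Z q \<omega>))\<^sup>2) \<le> e" if epos: "e > 0" for e
  proof -
    obtain \<eta> where \<eta>: "\<eta> > 0" "\<And>(M :: 'w measure) X Y \<rho>. std_gaussian_pair M X Y \<rho> \<Longrightarrow> \<bar>\<rho> - 1\<bar> < \<eta> \<Longrightarrow>
        (LINT \<omega>|M. (g (X \<omega>) - g (Y \<omega>))\<^sup>2) \<le> e"
      using gaussian_subordinated_L2_continuous[OF g epos, where 'w='w] by blast
    obtain d where "d > 0" "\<And>p q. dist p q < d \<Longrightarrow> \<bar>corr p q - 1\<bar> < \<eta>" using corr_continuous[OF \<eta>(1)] by blast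
    then show ?thesis using \<eta>(2)[OF pair] by blast
  qed
qed (use S in auto)

text \<open>Existence guarantees that the version picked by \<open>SOME\<close> really is a
  mean-square limit; from here on this is the only property of it that is used.\<close>

lemma has_ms_integral_subordinated:
  assumes "sq_integrable std_normal_distribution g" "compact S" "negligible (frontier S)"
  shows "has_ms_integral M S (\<lambda>p \<omega>. g (Z p \<omega>)) (ms_integral M S (\<lambda>p \<omega>. g (Z p \<omega>)))"
  unfolding ms_integral_def
  by (rule someI[where P = "has_ms_integral M S (\<lambda>p \<omega>. g (Z p \<omega>))"])
    (rule L2_continuous_field.has_ms_integral_exists[OF L2_continuous_field_subordinated[OF assms]])

section \<open>Second moments of Riemann sums\<close>

definition Riemann_sum :: "('a \<times> real) set \<Rightarrow> (('a \<times> real) \<times> ('a \<times> real) set) set \<Rightarrow> (real \<Rightarrow> real) \<Rightarrow> 'w \<Rightarrow> real" where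
  "Riemann_sum S D g \<omega> = (\<Sum>(p, k)\<in>D. if p \<in> S then measure lborel k * g (Z p \<omega>) else 0)"

text \<open>Absorbing the test for tags in S makes all Riemann sums over D share the same
  nonnegative weights, so that double sums can be compared term by term.\<close>

definition weight :: "('a \<times> real) set \<Rightarrow> ('a \<times> real) \<times> ('a \<times> real) set \<Rightarrow> real" where
  "weight S x = (if fst x \<in> S then measure lborel (snd x) else 0)"

lemma weight_nonneg: "weight S x \<ge> 0" and weight_le: "weight S x \<le> measure lborel (snd x)"
  by (simp_all add: weight_def)

lemma Riemann_sum_eq: "Riemann_sum S D g \<omega> = (\<Sum>x\<in>D. weight S x * g (Z (fst x) \<omega>))"
  unfolding Riemann_sum_def weight_def by (intro sum.cong) auto

lemma sq_integrable_Riemann_sum: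
  "sq_integrable std_normal_distribution g \<Longrightarrow> sq_integrable M (Riemann_sum S D g)"
  unfolding Riemann_sum_eq[abs_def]
  by (intro sq_integrable_sum sq_integrable_cmult sq_integrable_subordinated)

lemma expectation_Riemann_sum:
  assumes g: "sq_integrable std_normal_distribution g"
  shows "expectation (Riemann_sum S D g) = (\<Sum>x\<in>D. weight S x) * (LINT x|std_normal_distribution. g x)"
  using sq_integrable_integrable[OF sq_integrable_subordinated[OF g]] expectation_subordinated[of g] g
  unfolding Riemann_sum_eq[abs_def]
  by (simp add: Bochner_Integration.integral_sum sum_distrib_right sq_integrable_def)

lemma expectation_Riemann_sum_square:
  assumes g: "sq_integrable std_normal_distribution g"
  shows "expectation (\<lambda>\<omega>. (Riemann_sum S D g \<omega>)\<^sup>2) =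
    (\<Sum>x\<in>D. \<Sum>y\<in>D. weight S x * weight S y * expectation (\<lambda>\<omega>. g (Z (fst x) \<omega>) * g (Z (fst y) \<omega>)))"
proof -
  have "(Riemann_sum S D g \<omega>)\<^sup>2 =
    (\<Sum>x\<in>D. \<Sum>y\<in>D. weight S x * weight S y * (g (Z (fst x) \<omega>) * g (Z (fst y) \<omega>)))" for \<omega>
    by (simp add: Riemann_sum_eq power2_eq_square sum_product mult_ac)
  then show ?thesis
    using sq_integrable_mult[OF sq_integrable_subordinated[OF g] sq_integrable_subordinated[OF g]]
    by (simp add: Bochner_Integration.integral_sum)
qed

text \<open>Cells are disjoint up to null sets, and those with a tag near p lie in one ball about p:
  the tag is within R + R of p, and the cell within 1 of its tag by fineness. By translation
  invariance the bound does not depend on p.\<close>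

lemma sum_weight_near_le:
  assumes D: "D tagged_division_of cbox a b" "(\<lambda>p. ball p 1) fine D" and R: "R \<ge> 0"
  shows "(\<Sum>y\<in>D. weight S y * of_bool (norm (fst p - fst (fst y)) \<le> R \<and> \<bar>snd p - snd (fst y)\<bar> \<le> R))
    \<le> measure lborel (ball (0 :: 'a \<times> real) (2 * R + 1))"
proof -
  let ?b = "ball p (2 * R + 1)"
  have i: "integrable lborel (indicator ?b :: 'a \<times> real \<Rightarrow> real)"
    by (intro integrable_real_indicator emeasure_bounded_finite) simp_all
  have "(\<Sum>y\<in>D. weight S y * of_bool (norm (fst p - fst (fst y)) \<le> R \<and> \<bar>snd p - snd (fst y)\<bar> \<le> R))
    \<le> (\<Sum>(q, k)\<in>D. LINT z:k|lborel. indicator ?b z)"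
  proof (rule sum_mono, clarify)
    fix q k assume qk: "(q, k) \<in> D"
    obtain u v where k: "k = cbox u v" using tagged_division_ofD(4)[OF D(1) qk] by blast
    show "weight S (q, k) * of_bool (norm (fst p - fst (fst (q, k))) \<le> R \<and> \<bar>snd p - snd (fst (q, k))\<bar> \<le> R)
      \<le> (LINT z:k|lborel. indicator ?b z)"
    proof (cases "norm (fst p - fst q) \<le> R \<and> \<bar>snd p - snd q\<bar> \<le> R")
      case True
      have "dist p q \<le> norm (fst p - fst q) + \<bar>snd p - snd q\<bar>"
        using norm_Pair_le[of "fst p - fst q" "snd p - snd q"] by (simp add: dist_norm minus_prod_def)
      then have pq: "dist p q \<le> 2 * R" using True by linarith
      have "k \<subseteq> ?b"
      proof
        fix z assume "z \<in> k"
        moreover have "k \<subseteq> ball q 1" using D(2) qk unfolding fine_def by blast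
        ultimately have "dist q z < 1" by auto
        then show "z \<in> ?b" using pq dist_triangle[of p z q] by simp
      qed
      then have "(LINT z:k|lborel. indicator ?b z) = (LINT z|lborel. indicator k z :: real)"
        unfolding set_lebesgue_integral_def by (intro Bochner_Integration.integral_cong) (auto simp: indicator_def)
      also have "\<dots> = measure lborel k" by (simp add: k)
      finally show ?thesis using weight_le[of S "(q, k)"] True by simp
    next
      case False
      then show ?thesis by (auto simp: set_lebesgue_integral_def)
    qed
  qed
  also have "\<dots> = (LINT z:cbox a b|lborel. indicator ?b z)"
    by (rule set_integral_tagged_division[OF set_integrable_cbox[OF i] D(1)])
  also have "\<dots> \<le> (LINT z|lborel. indicator ?b z :: real)"
    unfolding set_lebesgue_integral_def
    by (rule integral_mono[OF set_integrable_cbox[OF i, unfolded set_integrable_def] i]) (simp add: indicator_def)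
  also have "\<dots> = measure lborel (ball (0 :: 'a \<times> real) (2 * R + 1))"
    using R content_ball[of "2 * R + 1" p] content_ball[of "2 * R + 1" "0 :: 'a \<times> real"] by simp
  finally show ?thesis .
qed

text \<open>As corr^m is the mixed expectation of \<open>H_m\<close> divided by m!, the \<epsilon>
  part is the second moment of the Riemann sum of \<open>H_m\<close> over the same division. The
  near part costs the volume of the box for the first point times that of one ball for the
  second.\<close>

lemma expectation_Riemann_sum_square_le:
  assumes g: "sq_integrable std_normal_distribution g" and coeff0: "\<And>k. k \<le> m \<Longrightarrow> hermite_coeff g k = 0"
    and D: "D tagged_division_of cbox a b" "(\<lambda>p. ball p 1) fine D"
    and far: "\<And>p q :: 'a \<times> real. norm (fst p - fst q) > R \<or> \<bar>snd p - snd q\<bar> > R \<Longrightarrow> corr p q \<le> \<epsilon>"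
    and R: "R \<ge> 0" and \<epsilon>: "\<epsilon> > 0"
  shows "expectation (\<lambda>\<omega>. (Riemann_sum S D g \<omega>)\<^sup>2) \<le> (LINT x|std_normal_distribution. (g x)\<^sup>2) *
    (\<epsilon> * expectation (\<lambda>\<omega>. (Riemann_sum S D (hermite m) \<omega>)\<^sup>2) / fact m +
     measure lborel (cbox a b) * measure lborel (ball (0 :: 'a \<times> real) (2 * R + 1)))"
proof -
  let ?A = "LINT x|std_normal_distribution. (g x)\<^sup>2"
  let ?V = "measure lborel (ball (0 :: 'a \<times> real) (2 * R + 1))"
  define w where "w = weight S"
  define near where "near x y = (of_bool (norm (fst (fst x) - fst (fst y)) \<le> R \<and> \<bar>snd (fst x) - snd (fst y)\<bar> \<le> R) :: real)"
    for x y :: "('a \<times> real) \<times> ('a \<times> real) set"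
  have A: "?A \<ge> 0" by simp
  have w: "w x \<ge> 0" for x by (simp add: w_def weight_nonneg)
  have E: "expectation (\<lambda>\<omega>. g (Z p \<omega>) * g (Z q \<omega>)) \<le> corr p q ^ Suc m * ?A" for p q
    using coeff0 by (intro std_gaussian_pair.expectation_mult_le[OF pair g] corr_nonneg corr_le_1) simp
  have H: "expectation (\<lambda>\<omega>. hermite m (Z p \<omega>) * hermite m (Z q \<omega>)) = fact m * corr p q ^ m" for p q
    using gaussian_pair.expectation_hermite[OF std_gaussian_pair.axioms(1)[OF pair], of m p m q] by simp
  have c: "corr (fst x) (fst y) ^ Suc m \<le> \<epsilon> * corr (fst x) (fst y) ^ m + near x y" for x y
  proof (cases "near x y = 0")
    case True
    then have "corr (fst x) (fst y) \<le> \<epsilon>" by (intro far) (auto simp: near_def not_le)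
    then have "corr (fst x) (fst y) * corr (fst x) (fst y) ^ m \<le> \<epsilon> * corr (fst x) (fst y) ^ m"
      by (intro mult_right_mono zero_le_power corr_nonneg)
    then show ?thesis using True by simp
  next
    case False
    then have "near x y = 1" by (simp add: near_def split: if_splits)
    moreover have "corr (fst x) (fst y) ^ Suc m \<le> 1" by (intro power_le_one corr_nonneg corr_le_1)
    moreover have "0 \<le> \<epsilon> * corr (fst x) (fst y) ^ m" using \<epsilon> by (simp add: corr_nonneg)
    ultimately show ?thesis by linarith
  qed
  have "expectation (\<lambda>\<omega>. (Riemann_sum S D g \<omega>)\<^sup>2) \<le>
    (\<Sum>x\<in>D. \<Sum>y\<in>D. w x * w y * ((\<epsilon> * corr (fst x) (fst y) ^ m + near x y) * ?A))"
    unfolding expectation_Riemann_sum_square[OF g] w_def[symmetric]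
    by (intro sum_mono mult_left_mono order_trans[OF E] mult_right_mono[OF c] mult_nonneg_nonneg w A)
  also have "\<dots> = ?A * (\<epsilon> * (\<Sum>x\<in>D. \<Sum>y\<in>D. w x * w y * corr (fst x) (fst y) ^ m) + (\<Sum>x\<in>D. w x * (\<Sum>y\<in>D. w y * near x y)))"
    by (simp add: sum_distrib_left sum_distrib_right sum.distrib algebra_simps)
  also have "\<epsilon> * (\<Sum>x\<in>D. \<Sum>y\<in>D. w x * w y * corr (fst x) (fst y) ^ m) = \<epsilon> * expectation (\<lambda>\<omega>. (Riemann_sum S D (hermite m) \<omega>)\<^sup>2) / fact m"
    unfolding expectation_Riemann_sum_square[OF sq_integrable_hermite] H w_def
    by (simp add: sum_distrib_left sum_divide_distrib mult.assoc)
  also have "(\<Sum>x\<in>D. w x * (\<Sum>y\<in>D. w y * near x y)) \<le> (\<Sum>x\<in>D. measure lborel (snd x) * ?V)"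
    unfolding w_def near_def
    by (intro sum_mono mult_mono weight_le sum_weight_near_le[OF D R] sum_nonneg mult_nonneg_nonneg weight_nonneg) auto
  also have "\<dots> = measure lborel (cbox a b) * ?V"
    using additive_content_tagged_division[OF D(1)] by (simp add: sum_distrib_right[symmetric] split_def)
  finally show ?thesis
    using A by (simp add: mult_left_mono)
qed

end

section \<open>From Riemann sums to integrals\<close>

context gaussian_random_field
begin

lemma has_ms_integral_Riemann_sum:
  assumes I: "has_ms_integral M S (\<lambda>p \<omega>. g (Z p \<omega>)) I" and S: "S \<subseteq> cbox a b" and e: "e > 0"
  obtains d where "d > 0" "\<And>D. D tagged_division_of cbox a b \<Longrightarrow> (\<lambda>p. ball p d) fine D \<Longrightarrow>
      expectation (\<lambda>\<omega>. (Riemann_sum S D g \<omega> - I \<omega>)\<^sup>2) < e"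
  using I[unfolded has_ms_integral_def, THEN conjunct2, THEN conjunct2, THEN conjunct2, rule_format, OF S e]
  unfolding Riemann_sum_def by (elim exE conjE) simp

text \<open>One division has to serve both integrals at once, and the mesh bound 1 is what
  \<open>sum_weight_near_le\<close> requires.\<close>

lemma approximating_division:
  assumes I1: "has_ms_integral M S (\<lambda>p \<omega>. g1 (Z p \<omega>)) I1" and I2: "has_ms_integral M S (\<lambda>p \<omega>. g2 (Z p \<omega>)) I2"
    and S: "S \<subseteq> cbox a b" and e: "e > 0"
  obtains D where "D tagged_division_of cbox a b" "(\<lambda>p. ball p 1) fine D"
    "expectation (\<lambda>\<omega>. (Riemann_sum S D g1 \<omega> - I1 \<omega>)\<^sup>2) < e" "expectation (\<lambda>\<omega>. (Riemann_sum S D g2 \<omega> - I2 \<omega>)\<^sup>2) < e"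
proof -
  obtain d1 where d1: "d1 > 0" "\<And>D. D tagged_division_of cbox a b \<Longrightarrow> (\<lambda>p. ball p d1) fine D \<Longrightarrow>
      expectation (\<lambda>\<omega>. (Riemann_sum S D g1 \<omega> - I1 \<omega>)\<^sup>2) < e"
    by (rule has_ms_integral_Riemann_sum[OF I1 S e]) blast
  obtain d2 where d2: "d2 > 0" "\<And>D. D tagged_division_of cbox a b \<Longrightarrow> (\<lambda>p. ball p d2) fine D \<Longrightarrow>
      expectation (\<lambda>\<omega>. (Riemann_sum S D g2 \<omega> - I2 \<omega>)\<^sup>2) < e"
    by (rule has_ms_integral_Riemann_sum[OF I2 S e]) blast
  define d where "d = min 1 (min d1 d2)"
  have d: "d > 0" "d \<le> 1" "d \<le> d1" "d \<le> d2" using d1 d2 by (auto simp: d_def)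
  obtain D where D: "D tagged_division_of cbox a b" "(\<lambda>p. ball p d) fine D"
    using fine_division_exists[of "\<lambda>p. ball p d" a b] d(1) by (auto simp: gauge_def)
  have fine: "(\<lambda>p. ball p d') fine D" if "d \<le> d'" for d'
    using D(2) subset_ball[OF that] unfolding fine_def by blast
  show ?thesis
    by (rule that[OF D(1) fine[OF d(2)] d1(2)[OF D(1) fine[OF d(3)]] d2(2)[OF D(1) fine[OF d(4)]]])
qed

lemma ms_integral_sq_integrable:
  assumes "sq_integrable std_normal_distribution g" "compact S" "negligible (frontier S)"
  shows "sq_integrable M (ms_integral M S (\<lambda>p \<omega>. g (Z p \<omega>)))"
  using has_ms_integral_subordinated[OF assms] by (simp add: has_ms_integral_def)

lemma integral_hermite:
  assumes "m \<ge> 1" shows "(LINT x|std_normal_distribution. hermite m x) = 0"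
  using std_normal_expectation_hermite[of m 0] assms by (simp add: hermite_eq_poly)

text \<open>All Riemann sums have mean zero, and the squared difference of means is at most the mean
  squared error, which is arbitrarily small.\<close>

lemma expectation_ms_integral_hermite:
  assumes m: "m \<ge> 1" and S: "compact S" "negligible (frontier S)"
  shows "expectation (ms_integral M S (\<lambda>p \<omega>. hermite m (Z p \<omega>))) = 0"
proof -
  let ?I = "ms_integral M S (\<lambda>p \<omega>. hermite m (Z p \<omega>))"
  note I = has_ms_integral_subordinated[OF sq_integrable_hermite S, of m]
    and sqI = ms_integral_sq_integrable[OF sq_integrable_hermite S, of m]
  obtain a where a: "S \<subseteq> cbox (- a) a"
    by (rule bounded_subset_cbox_symmetric[OF compact_imp_bounded[OF S(1)]])
  have "(expectation ?I)\<^sup>2 \<le> e" if e: "e > 0" for e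
  proof -
    obtain D where D: "expectation (\<lambda>\<omega>. (Riemann_sum S D (hermite m) \<omega> - ?I \<omega>)\<^sup>2) < e"
      by (rule approximating_division[OF I I a e]) blast
    have sq: "sq_integrable M (Riemann_sum S D (hermite m))"
      by (rule sq_integrable_Riemann_sum[OF sq_integrable_hermite])
    have "expectation (\<lambda>\<omega>. Riemann_sum S D (hermite m) \<omega> - ?I \<omega>) = - expectation ?I"
      using sq_integrable_integrable[OF sq] sq_integrable_integrable[OF sqI]
      by (simp add: expectation_Riemann_sum[OF sq_integrable_hermite] integral_hermite[OF m])
    then show ?thesis
      using expectation_square_le[OF sq_integrable_diff[OF sq sqI]] D by simp
  qed
  then have "(expectation ?I)\<^sup>2 \<le> 0 + e" if "e > 0" for e
    using that by simp
  then have "(expectation ?I)\<^sup>2 \<le> 0" by (rule field_le_epsilon)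
  then show ?thesis by simp
qed

text \<open>On one division the Riemann sum of g is exactly that of G, minus the constant W
  \<open>J_0\<close>, minus c times that of \<open>H_m\<close>. The constant disappears with the
  centring of A, so the left side is the second moment of the Riemann sum of g plus errors, and
  these vanish as the approximation is refined. Replacing the Riemann sum of \<open>H_m\<close> by I
  accounts for the factor 2 at \<epsilon>.\<close>

lemma remainder_second_moment_le:
  assumes G: "sq_integrable std_normal_distribution G" and m: "m \<ge> 1"
    and rank: "\<And>k. 1 \<le> k \<Longrightarrow> k < m \<Longrightarrow> hermite_coeff G k = 0"
    and S: "compact S" "negligible (frontier S)" "S \<subseteq> cbox a b"
    and far: "\<And>p q :: 'a \<times> real. norm (fst p - fst q) > R \<or> \<bar>snd p - snd q\<bar> > R \<Longrightarrow> corr p q \<le> \<epsilon>"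
    and R: "R \<ge> 0" and \<epsilon>: "\<epsilon> > 0"
  defines "c \<equiv> hermite_coeff G m / fact m"
  defines "g \<equiv> \<lambda>x. G x - hermite_coeff G 0 - c * hermite m x"
  defines "A \<equiv> ms_integral M S (\<lambda>p \<omega>. G (Z p \<omega>))" and "I \<equiv> ms_integral M S (\<lambda>p \<omega>. hermite m (Z p \<omega>))"
  shows "expectation (\<lambda>\<omega>. (A \<omega> - expectation A - c * I \<omega>)\<^sup>2) \<le>
    2 * (LINT x|std_normal_distribution. (g x)\<^sup>2) *
      (2 * \<epsilon> * expectation (\<lambda>\<omega>. (I \<omega>)\<^sup>2) / fact m + measure lborel (cbox a b) * measure lborel (ball (0 :: 'a \<times> real) (2 * R + 1)))"
proof -
  let ?N = std_normal_distribution
  let ?K = "LINT x|?N. (g x)\<^sup>2" and ?B = "measure lborel (cbox a b) * measure lborel (ball (0 :: 'a \<times> real) (2 * R + 1))"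
  have [measurable]: "G \<in> borel_measurable borel" using G by (simp add: sq_integrable_def)
  have sqg: "sq_integrable ?N g"
    unfolding g_def by (intro std_normal.sq_integrable_diff std_normal.sq_integrable_cmult std_normal.sq_integrable_const G sq_integrable_hermite)
  have [measurable]: "g \<in> borel_measurable borel" using sqg by (simp add: sq_integrable_def)
  \<comment> \<open>Order 0 is removed by the subtracted constant, order m by c because
    \<open>H_m\<close> has squared norm m!, and the orders in between vanish by the rank.\<close>
  have coeff0: "hermite_coeff g k = 0" if "k \<le> m" for k
  proof -
    have "hermite_coeff g k = (LINT x|?N. G x * hermite k x - hermite_coeff G 0 * (hermite 0 x * hermite k x) - c * (hermite m x * hermite k x))"
      by (subst hermite_coeff_std_normal) (simp_all add: g_def algebra_simps hermite_eq_poly[of 0])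
    also have "\<dots> = hermite_coeff G k - hermite_coeff G 0 * (LINT x|?N. hermite 0 x * hermite k x) - c * (LINT x|?N. hermite m x * hermite k x)"
      using std_normal.sq_integrable_mult[OF G sq_integrable_hermite] std_normal_integrable_hermite_mult
      by (simp add: hermite_coeff_inner[OF G])
    also have "\<dots> = 0"
      using rank[of k] that m by (cases "k = 0"; cases "k = m") (simp_all add: std_normal_expectation_hermite c_def)
    finally show ?thesis .
  qed
  have intG: "(LINT x|?N. G x) = hermite_coeff G 0"
    using hermite_coeff_inner[OF G, of 0] by (simp add: hermite_eq_poly)
  note A = has_ms_integral_subordinated[OF G S(1,2), folded A_def]
    and I = has_ms_integral_subordinated[OF sq_integrable_hermite S(1,2), of m, folded I_def]
  have sqA: "sq_integrable M A" unfolding A_def by (rule ms_integral_sq_integrable[OF G S(1,2)])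
  have sqI: "sq_integrable M I" unfolding I_def by (rule ms_integral_sq_integrable[OF sq_integrable_hermite S(1,2)])
  have main: "expectation (\<lambda>\<omega>. (A \<omega> - expectation A - c * I \<omega>)\<^sup>2) \<le>
      2 * ?K * (2 * \<epsilon> * expectation (\<lambda>\<omega>. (I \<omega>)\<^sup>2) / fact m + ?B) + (4 * ?K * \<epsilon> / fact m + 4 * c\<^sup>2 + 4) * e"
    if e: "e > 0" for e
  proof -
    obtain D where D: "D tagged_division_of cbox a b" "(\<lambda>p. ball p 1) fine D"
      and DA: "expectation (\<lambda>\<omega>. (Riemann_sum S D G \<omega> - A \<omega>)\<^sup>2) < e"
      and DI: "expectation (\<lambda>\<omega>. (Riemann_sum S D (hermite m) \<omega> - I \<omega>)\<^sup>2) < e"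
      by (rule approximating_division[OF A I S(3) e]) blast
    define \<Delta>A where "\<Delta>A \<omega> = Riemann_sum S D G \<omega> - A \<omega>" for \<omega>
    define \<Delta>I where "\<Delta>I \<omega> = Riemann_sum S D (hermite m) \<omega> - I \<omega>" for \<omega>
    define W where "W = (\<Sum>x\<in>D. weight S x)"
    note sqSG = sq_integrable_Riemann_sum[OF G, of S D] and sqSH = sq_integrable_Riemann_sum[OF sq_integrable_hermite, of S D m]
      and sqSg = sq_integrable_Riemann_sum[OF sqg, of S D]
    have sq\<Delta>A: "sq_integrable M \<Delta>A" unfolding \<Delta>A_def[abs_def] by (intro sq_integrable_diff sqSG sqA)
    have sq\<Delta>I: "sq_integrable M \<Delta>I" unfolding \<Delta>I_def[abs_def] by (intro sq_integrable_diff sqSH sqI)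
    have EA: "expectation \<Delta>A = W * hermite_coeff G 0 - expectation A"
      using sq_integrable_integrable[OF sqSG] sq_integrable_integrable[OF sqA]
      unfolding \<Delta>A_def[abs_def] by (simp add: expectation_Riemann_sum[OF G] intG W_def)
    have Sg: "Riemann_sum S D g \<omega> = Riemann_sum S D G \<omega> - W * hermite_coeff G 0 - c * Riemann_sum S D (hermite m) \<omega>" for \<omega>
      by (simp add: Riemann_sum_eq g_def W_def sum_subtractf right_diff_distrib sum_distrib_left sum_distrib_right mult_ac)
    have "A \<omega> - expectation A - c * I \<omega> = Riemann_sum S D g \<omega> + (c * \<Delta>I \<omega> - (\<Delta>A \<omega> - expectation \<Delta>A))" for \<omega>
      unfolding Sg EA by (simp add: \<Delta>A_def \<Delta>I_def algebra_simps)
    then have "expectation (\<lambda>\<omega>. (A \<omega> - expectation A - c * I \<omega>)\<^sup>2) =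
      expectation (\<lambda>\<omega>. (Riemann_sum S D g \<omega> + (c * \<Delta>I \<omega> - (\<Delta>A \<omega> - expectation \<Delta>A)))\<^sup>2)" by simp
    also have "\<dots> \<le> 2 * expectation (\<lambda>\<omega>. (Riemann_sum S D g \<omega>)\<^sup>2) + 2 * expectation (\<lambda>\<omega>. (c * \<Delta>I \<omega> - (\<Delta>A \<omega> - expectation \<Delta>A))\<^sup>2)"
      by (intro expectation_square_add_le sq_integrable_diff sq_integrable_cmult sq_integrable_const sqSg sq\<Delta>I sq\<Delta>A)
    also have "expectation (\<lambda>\<omega>. (c * \<Delta>I \<omega> - (\<Delta>A \<omega> - expectation \<Delta>A))\<^sup>2) \<le> 2 * (c\<^sup>2 * e) + 2 * e"
    proof -
      have "expectation (\<lambda>\<omega>. (c * \<Delta>I \<omega> - (\<Delta>A \<omega> - expectation \<Delta>A))\<^sup>2) \<le>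
        2 * expectation (\<lambda>\<omega>. (c * \<Delta>I \<omega>)\<^sup>2) + 2 * expectation (\<lambda>\<omega>. (\<Delta>A \<omega> - expectation \<Delta>A)\<^sup>2)"
        by (intro expectation_square_diff_le sq_integrable_diff sq_integrable_cmult sq_integrable_const sq\<Delta>I sq\<Delta>A)
      moreover have "expectation (\<lambda>\<omega>. (c * \<Delta>I \<omega>)\<^sup>2) = c\<^sup>2 * expectation (\<lambda>\<omega>. (\<Delta>I \<omega>)\<^sup>2)"
        by (simp add: power_mult_distrib)
      moreover have "\<dots> \<le> c\<^sup>2 * e" using DI by (intro mult_left_mono) (simp_all add: \<Delta>I_def)
      moreover have "expectation (\<lambda>\<omega>. (\<Delta>A \<omega> - expectation \<Delta>A)\<^sup>2) = expectation (\<lambda>\<omega>. (\<Delta>A \<omega>)\<^sup>2) - (expectation \<Delta>A)\<^sup>2"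
        by (intro variance_eq sq_integrable_integrable[OF sq\<Delta>A] sq_integrable_power2[OF sq\<Delta>A])
      moreover have "expectation (\<lambda>\<omega>. (\<Delta>A \<omega>)\<^sup>2) \<le> e" using DA by (simp add: \<Delta>A_def)
      moreover have "0 \<le> (expectation \<Delta>A)\<^sup>2" by simp
      ultimately show ?thesis by linarith
    qed
    also have "expectation (\<lambda>\<omega>. (Riemann_sum S D g \<omega>)\<^sup>2) \<le>
      ?K * (\<epsilon> * expectation (\<lambda>\<omega>. (Riemann_sum S D (hermite m) \<omega>)\<^sup>2) / fact m + ?B)"
      by (rule expectation_Riemann_sum_square_le[OF sqg coeff0 D far R \<epsilon>])
    also have "expectation (\<lambda>\<omega>. (Riemann_sum S D (hermite m) \<omega>)\<^sup>2) \<le> 2 * expectation (\<lambda>\<omega>. (I \<omega>)\<^sup>2) + 2 * e"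
    proof -
      have "expectation (\<lambda>\<omega>. (I \<omega> + \<Delta>I \<omega>)\<^sup>2) \<le> 2 * expectation (\<lambda>\<omega>. (I \<omega>)\<^sup>2) + 2 * expectation (\<lambda>\<omega>. (\<Delta>I \<omega>)\<^sup>2)"
        by (intro expectation_square_add_le sqI sq\<Delta>I)
      then show ?thesis using DI by (simp add: \<Delta>I_def)
    qed
    finally have "expectation (\<lambda>\<omega>. (A \<omega> - expectation A - c * I \<omega>)\<^sup>2) \<le>
      2 * (?K * (\<epsilon> * (2 * expectation (\<lambda>\<omega>. (I \<omega>)\<^sup>2) + 2 * e) / fact m + ?B)) + 2 * (2 * (c\<^sup>2 * e) + 2 * e)"
      using \<epsilon> by (simp add: mult_left_mono divide_right_mono)
    also have "\<dots> = 2 * ?K * (2 * \<epsilon> * expectation (\<lambda>\<omega>. (I \<omega>)\<^sup>2) / fact m + ?B) + (4 * ?K * \<epsilon> / fact m + 4 * c\<^sup>2 + 4) * e"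
      by (simp add: algebra_simps add_divide_distrib)
    finally show ?thesis .
  qed
  show ?thesis
  proof (rule field_le_epsilon)
    fix e :: real assume e: "e > 0"
    define L where "L = 4 * ?K * \<epsilon> / fact m + 4 * c\<^sup>2 + 4"
    have L: "L > 0" using \<epsilon> by (simp add: L_def add_nonneg_pos)
    show "expectation (\<lambda>\<omega>. (A \<omega> - expectation A - c * I \<omega>)\<^sup>2) \<le>
      2 * ?K * (2 * \<epsilon> * expectation (\<lambda>\<omega>. (I \<omega>)\<^sup>2) / fact m + ?B) + e"
      using main[of "e / L"] e L unfolding L_def[symmetric] by simp
  qed
qed

end

section \<open>Decay of the covariance, the space-time cylinder, and growth of the variance\<close>

lemma eventually_going_to_max:
  assumes lim: "((\<lambda>(z, \<tau>). C z \<tau>) \<longlongrightarrow> (0::real)) ((\<lambda>(z, \<tau>). max z \<tau>) going_to at_top within {0..} \<times> {0::real..})"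
    and \<epsilon>: "\<epsilon> > 0"
  obtains R where "R \<ge> 0" "\<And>z \<tau>. z \<ge> 0 \<Longrightarrow> \<tau> \<ge> 0 \<Longrightarrow> z > R \<or> \<tau> > R \<Longrightarrow> C z \<tau> \<le> \<epsilon>"
proof -
  have "\<forall>\<^sub>F p in (\<lambda>(z, \<tau>). max z \<tau>) going_to at_top within {0..} \<times> {0::real..}. (case p of (z, \<tau>) \<Rightarrow> C z \<tau>) < \<epsilon>"
    using lim \<epsilon> by (rule order_tendstoD)
  then obtain R where R: "\<And>z \<tau>. z \<ge> 0 \<Longrightarrow> \<tau> \<ge> 0 \<Longrightarrow> max z \<tau> \<ge> R \<Longrightarrow> C z \<tau> < \<epsilon>"
    unfolding going_to_within_def eventually_inf_principal eventually_filtercomap eventually_at_top_linorder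
    by fastforce
  show ?thesis
  proof (rule that[of "max 0 R"])
    fix z \<tau> assume "z \<ge> 0" "\<tau> \<ge> 0" "z > max 0 R \<or> \<tau> > max 0 R"
    moreover from this have "max z \<tau> \<ge> R" by auto
    ultimately show "C z \<tau> \<le> \<epsilon>" using R[of z \<tau>] by simp
  qed simp
qed

text \<open>Convexity of the cylinder makes its frontier negligible. The enclosing box has half side
  r c in space, so its volume has the order r^d T that the growth condition is measured
  against.\<close>

lemma dilated_cylinder:
  fixes K :: "'a::euclidean_space set"
  assumes K: "compact K" "convex K" and c: "c > 0" "\<And>x. x \<in> K \<Longrightarrow> norm x \<le> c" and r: "r > 0" and T: "T > 0"
  defines "S \<equiv> dilate r K \<times> {0..T}"
  shows "compact S" "negligible (frontier S)"
    and "\<exists>a b. S \<subseteq> cbox a b \<and> measure lborel (cbox a b) = (2 * c) ^ DIM('a) * r ^ DIM('a) * T"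
proof -
  have S: "S = (\<lambda>x. r *\<^sub>R x) ` K \<times> {0..T}" by (simp add: S_def dilate_def)
  show "compact S" unfolding S by (intro compact_Times compact_scaling K compact_Icc)
  show "negligible (frontier S)"
    unfolding S by (intro negligible_convex_frontier convex_Times convex_scaling K convex_real_interval)
  let ?a = "(r * c) *\<^sub>R (One :: 'a)"
  have rc: "r * c > 0" using r c by simp
  have "S \<subseteq> cbox (- ?a, 0) (?a, T)"
  proof -
    have "\<bar>(r *\<^sub>R x) \<bullet> i\<bar> \<le> r * c" if "x \<in> K" "i \<in> Basis" for x i :: 'a
    proof -
      have "\<bar>(r *\<^sub>R x) \<bullet> i\<bar> = r * \<bar>x \<bullet> i\<bar>" using r by (simp add: abs_mult)
      also have "\<dots> \<le> r * c"
        using Basis_le_norm[OF that(2), of x] c(2)[OF that(1)] r by (intro mult_left_mono) auto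
      finally show ?thesis .
    qed
    then show ?thesis unfolding S cbox_Pair_eq by (auto simp: cbox_def abs_le_iff) (fastforce simp: abs_le_iff)+
  qed
  moreover have "measure lborel (cbox (- ?a, 0) (?a, T)) = (2 * c) ^ DIM('a) * r ^ DIM('a) * T"
  proof -
    have "measure lborel (cbox (- ?a) ?a) = (\<Prod>i\<in>(Basis :: 'a set). ?a \<bullet> i - (- ?a) \<bullet> i)"
      using rc by (intro content_cbox) simp
    also have "\<dots> = (\<Prod>i\<in>(Basis :: 'a set). 2 * c * r)" by (intro prod.cong) (simp_all add: mult_ac)
    finally have "measure lborel (cbox (- ?a) ?a) = (2 * c) ^ DIM('a) * r ^ DIM('a)" by (simp add: power_mult_distrib mult_ac)
    then show ?thesis using T by (simp add: content_Pair)
  qed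
  ultimately show "\<exists>a b. S \<subseteq> cbox a b \<and> measure lborel (cbox a b) = (2 * c) ^ DIM('a) * r ^ DIM('a) * T"
    by blast
qed

text \<open>For T \<ge> 1 the volume T^b T is at most the normalizer of the growth condition, whose
  exponents are at least as large. Hence the ratio is at most the inverse of a quantity tending to
  infinity. In the application b is \<gamma> d.\<close>

lemma tendsto_volume_ratio:
  fixes s :: "real \<Rightarrow> real"
  assumes s: "filterlim (\<lambda>T. s T / (T powr (1 + \<delta>1) * T powr (b * (1 + \<delta>2)))) at_top at_top"
    and \<delta>: "\<delta>1 > 0" "\<delta>2 > 0" and b: "b \<ge> 0"
  shows "\<forall>\<^sub>F T in at_top. s T > 0" "((\<lambda>T. T powr b * T / s T) \<longlongrightarrow> 0) at_top"
proof -
  let ?Q = "\<lambda>T. s T / (T powr (1 + \<delta>1) * T powr (b * (1 + \<delta>2)))"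
  have Q: "\<forall>\<^sub>F T in at_top. ?Q T > 0 \<and> T \<ge> 1"
    using s eventually_ge_at_top[of "1 :: real"] unfolding filterlim_at_top_dense by (auto intro: eventually_conj)
  then show pos: "\<forall>\<^sub>F T in at_top. s T > 0"
  proof eventually_elim
    case (elim T)
    then have "T powr (1 + \<delta>1) * T powr (b * (1 + \<delta>2)) > 0" by simp
    with elim show ?case by (simp add: zero_less_divide_iff)
  qed
  have "\<forall>\<^sub>F T in at_top. T powr b * T / s T \<ge> 0"
    using pos eventually_ge_at_top[of "0 :: real"] by eventually_elim simp
  moreover have "\<forall>\<^sub>F T in at_top. T powr b * T / s T \<le> inverse (?Q T)"
    using pos eventually_ge_at_top[of "1 :: real"]
  proof eventually_elim
    case (elim T)
    have "T powr b * T powr 1 \<le> T powr (b * (1 + \<delta>2)) * T powr (1 + \<delta>1)"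
    proof (rule mult_mono)
      show "T powr b \<le> T powr (b * (1 + \<delta>2))"
        using elim(2) \<delta> b by (intro powr_mono) (simp_all add: distrib_left)
      show "T powr 1 \<le> T powr (1 + \<delta>1)"
        using elim(2) \<delta> by (intro powr_mono) simp_all
    qed simp_all
    then have "T powr b * T / s T \<le> T powr (b * (1 + \<delta>2)) * T powr (1 + \<delta>1) / s T"
      using elim by (intro divide_right_mono) auto
    then show ?case by (simp add: mult.commute)
  qed
  ultimately show "((\<lambda>T. T powr b * T / s T) \<longlongrightarrow> 0) at_top"
    by (rule real_tendsto_sandwich[OF _ _ tendsto_const tendsto_inverse_0_at_top[OF s]])
qed

theorem theorem1:
  fixes M :: "'w measure"
    and Z :: "(real ^ 'n) \<times> real \<Rightarrow> 'w \<Rightarrow> real"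
    and C :: "real \<Rightarrow> real \<Rightarrow> real"
    and G :: "real \<Rightarrow> real"
    and K :: "(real ^ 'n) set"
    and \<gamma> :: real
    and m :: nat
  assumes "CARD('n) \<ge> 2"
    and "convex_body K" and "0 \<in> K"
    and "\<gamma> \<ge> 0"
    and "prob_space M"
    and "measurable_field M Z" and "ms_continuous M Z" and "gaussian_field M Z"
    and "homogeneous_in_space M Z" and "isotropic_in_space M Z" and "stationary_in_time M Z"
    and "\<And>x t. prob_space.expectation M (Z (x, t)) = 0"
    and "\<And>x t. prob_space.expectation M (\<lambda>\<omega>. (Z (x, t) \<omega>)\<^sup>2) = 1"
    and "\<And>x t y s. prob_space.expectation M (\<lambda>\<omega>. Z (x, t) \<omega> * Z (y, s) \<omega>)
           = C (norm (x - y)) \<bar>t - s\<bar>"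
    and "\<And>x t y s. C (norm (x - y :: real ^ 'n)) \<bar>t - s\<bar> \<ge> 0"
    and "G \<in> borel_measurable borel"
    and "\<And>x t. integrable M (\<lambda>\<omega>. (G (Z (x, t) \<omega>))\<^sup>2)"
    and "hermite_rank G m"
    and "((\<lambda>(z, \<tau>). C z \<tau>) \<longlongrightarrow> 0)
           ((\<lambda>(z, \<tau>). max z \<tau>) going_to at_top within {0..} \<times> {0..})"
    and "\<exists>\<delta>1 \<delta>2. \<delta>1 \<in> {0<..<1} \<and> \<delta>2 \<in> {0<..<1} \<and>
           filterlim (\<lambda>T. sigma2 M Z K \<gamma> m T /
               (T powr (1 + \<delta>1) * T powr (\<gamma> * real CARD('n) * (1 + \<delta>2)))) at_top at_top"
  shows "\<forall>\<mu>. real_distribution \<mu> \<longrightarrow>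
    (conv_in_distr M
       (\<lambda>T \<omega>. (st_functional M Z K \<gamma> G T \<omega> - prob_space.expectation M (st_functional M Z K \<gamma> G T)) /
          (\<bar>hermite_coeff G m\<bar> * sqrt (sigma2 M Z K \<gamma> m T) / fact m)) \<mu> \<longleftrightarrow>
     conv_in_distr M
       (\<lambda>T \<omega>. sgn (hermite_coeff G m) * st_functional M Z K \<gamma> (hermite m) T \<omega> /
          sqrt (sigma2 M Z K \<gamma> m T)) \<mu>)"
proof -
  have \<gamma>: "\<gamma> \<ge> 0" and K: "convex_body K" by fact+
  interpret prob_space M by fact
  interpret F: gaussian_random_field M Z C
    by unfold_locales (use assms in \<open>auto simp: split_paired_all\<close>)
  define J where "J = hermite_coeff G m"
  define c where "c = J / fact m"
  have m: "m \<ge> 1" and J: "J \<noteq> 0" and rank: "\<And>k. 1 \<le> k \<Longrightarrow> k < m \<Longrightarrow> hermite_coeff G k = 0"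
    using \<open>hermite_rank G m\<close> by (auto simp: hermite_rank_def J_def)
  have G_borel [measurable]: "G \<in> borel_measurable borel" by fact
  \<comment> \<open>Integrability along the field is carried over to the standard normal law, the
    law of Z at the origin.\<close>
  have G: "sq_integrable std_normal_distribution G"
  proof -
    have "(\<lambda>x. (G x)\<^sup>2) \<in> borel_measurable borel" by measurable
    from integrable_distr_eq[OF F.Z_section_measurable[of "(0, 0)"] this]
    have "integrable (distr M borel (Z (0, 0))) (\<lambda>x. (G x)\<^sup>2)"
      using assms(17)[of 0 0] by (simp only:)
    then show ?thesis
      using std_gaussian_pair.distr_X[OF F.pair[of "(0, 0)" "(0, 0)"]] by (simp add: sq_integrable_def)
  qed
  define g where "g x = G x - hermite_coeff G 0 - c * hermite m x" for x
  define A where "A = st_functional M Z K \<gamma> G"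
  define I where "I = st_functional M Z K \<gamma> (hermite m)"
  define s where "s = sigma2 M Z K \<gamma> m"
  define S where "S T = dilate (T powr \<gamma>) K \<times> {0..T}" for T
  have A: "A T = ms_integral M (S T) (\<lambda>p \<omega>. G (Z p \<omega>))" and I: "I T = ms_integral M (S T) (\<lambda>p \<omega>. hermite m (Z p \<omega>))" for T
    by (simp_all add: A_def I_def S_def st_functional_def)
  have K': "compact K" "convex K" using K by (auto simp: convex_body_def)
  obtain r where r: "r > 0" "\<And>x. x \<in> K \<Longrightarrow> norm x \<le> r"
    using compact_imp_bounded[OF K'(1)] unfolding bounded_pos by blast
  have S: "compact (S T)" "negligible (frontier (S T))"
      "\<exists>a b. S T \<subseteq> cbox a b \<and> measure lborel (cbox a b) = (2 * r) ^ CARD('n) * (T powr (\<gamma> * CARD('n)) * T)"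
    if T: "T > 0" for T
  proof -
    have p: "T powr \<gamma> > 0" using T by simp
    have "(T powr \<gamma>) ^ CARD('n) = T powr (\<gamma> * CARD('n))"
      using p by (simp add: powr_powr flip: powr_realpow)
    then show "compact (S T)" "negligible (frontier (S T))"
      "\<exists>a b. S T \<subseteq> cbox a b \<and> measure lborel (cbox a b) = (2 * r) ^ CARD('n) * (T powr (\<gamma> * CARD('n)) * T)"
      using dilated_cylinder[OF K' r p T] by (simp_all add: S_def mult.assoc)
  qed
  \<comment> \<open>\<open>sigma2\<close> is a variance, while the remainder estimate produces a
    second moment; they agree because the functional of \<open>H_m\<close> has mean zero.\<close>
  have sqA: "sq_integrable M (A T)" and sqI: "sq_integrable M (I T)" and s_eq: "s T = expectation (\<lambda>\<omega>. (I T \<omega>)\<^sup>2)"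
    if "T > 0" for T
  proof -
    show "sq_integrable M (A T)" unfolding A by (rule F.ms_integral_sq_integrable[OF G S(1,2)[OF that]])
    show "sq_integrable M (I T)" unfolding I by (rule F.ms_integral_sq_integrable[OF sq_integrable_hermite S(1,2)[OF that]])
    have "expectation (I T) = 0" unfolding I by (rule F.expectation_ms_integral_hermite[OF m S(1,2)[OF that]])
    then show "s T = expectation (\<lambda>\<omega>. (I T \<omega>)\<^sup>2)" by (simp add: s_def sigma2_def I_def[symmetric])
  qed
  define b where "b = \<gamma> * CARD('n)"
  have b: "b \<ge> 0" using \<gamma> by (simp add: b_def)
  obtain \<delta>1 \<delta>2 where \<delta>: "\<delta>1 > 0" "\<delta>2 > 0"
      "filterlim (\<lambda>T. s T / (T powr (1 + \<delta>1) * T powr (b * (1 + \<delta>2)))) at_top at_top"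
    using assms(20) unfolding s_def b_def by auto
  note s_pos = tendsto_volume_ratio(1)[OF \<delta>(3,1,2) b] and ratio = tendsto_volume_ratio(2)[OF \<delta>(3,1,2) b]
  define Y where "Y T \<omega> = (A T \<omega> - expectation (A T)) / (\<bar>J\<bar> * sqrt (s T) / fact m)" for T \<omega>
  define Y' where "Y' T \<omega> = sgn J * I T \<omega> / sqrt (s T)" for T \<omega>
  have sqY: "sq_integrable M (Y T)" and sqY': "sq_integrable M (Y' T)" if "T > 0" for T
  proof -
    show "sq_integrable M (Y T)"
      using sq_integrable_cmult[OF sq_integrable_diff[OF sqA[OF that] sq_integrable_const], of "1 / (\<bar>J\<bar> * sqrt (s T) / fact m)"]
      by (simp add: Y_def[abs_def] mult.commute)
    show "sq_integrable M (Y' T)"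
      using sq_integrable_cmult[OF sqI[OF that], of "sgn J / sqrt (s T)"] by (simp add: Y'_def[abs_def])
  qed
  \<comment> \<open>The square of the factor 1/c left when c is taken out of the
    normalization.\<close>
  define \<kappa> where "\<kappa> = (1 / c)\<^sup>2"
  define Q where "Q = (LINT x|std_normal_distribution. (g x)\<^sup>2)"
  have \<kappa>: "\<kappa> > 0" using J by (simp add: \<kappa>_def c_def)
  have Q: "Q \<ge> 0" by (simp add: Q_def)
  have close: "((\<lambda>T. expectation (\<lambda>\<omega>. (Y T \<omega> - Y' T \<omega>)\<^sup>2)) \<longlongrightarrow> 0) at_top"
  proof (rule tendstoI)
    fix e :: real assume e: "e > 0"
    \<comment> \<open>Chosen so that the far part 4 \<kappa> Q \<epsilon> / m! is at most e/2. Q may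
      vanish, namely when the expansion of G stops at order m, hence Q + 1.\<close>
    define \<epsilon> where "\<epsilon> = e * fact m / (8 * \<kappa> * (Q + 1))"
    have \<epsilon>: "\<epsilon> > 0" using e \<kappa> Q by (simp add: \<epsilon>_def)
    obtain R where R: "R \<ge> 0" "\<And>z \<tau>. z \<ge> 0 \<Longrightarrow> \<tau> \<ge> 0 \<Longrightarrow> z > R \<or> \<tau> > R \<Longrightarrow> C z \<tau> \<le> \<epsilon>"
      by (rule eventually_going_to_max[OF assms(19) \<epsilon>]) blast
    \<comment> \<open>The coefficient of the volume ratio in the near part. It depends on R, hence
      on e, but not on T, so the ratio can be sent to zero afterwards.\<close>
    define L where "L = 2 * \<kappa> * Q * (2 * r) ^ CARD('n) * measure lborel (ball (0 :: (real ^ 'n) \<times> real) (2 * R + 1))"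
    have "((\<lambda>T. L * (T powr b * T / s T)) \<longlongrightarrow> L * 0) at_top" by (intro tendsto_mult tendsto_const ratio)
    then have "\<forall>\<^sub>F T in at_top. L * (T powr b * T / s T) < e / 2"
      using e by (intro order_tendstoD(2)) auto
    then show "\<forall>\<^sub>F T in at_top. dist (expectation (\<lambda>\<omega>. (Y T \<omega> - Y' T \<omega>)\<^sup>2)) 0 < e"
      using s_pos eventually_gt_at_top[of "0 :: real"]
    proof eventually_elim
      case (elim T)
      obtain a b' where ab: "S T \<subseteq> cbox a b'" "measure lborel (cbox a b') = (2 * r) ^ CARD('n) * (T powr b * T)"
        using S(3)[OF elim(3)] unfolding b_def by blast
      \<comment> \<open>As |J| / m! = c sgn J, both normalizations are multiples of the same square
        root, and the difference is the centred remainder up to a scalar.\<close>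
      have "Y T \<omega> - Y' T \<omega> = 1 / c / (sgn J * sqrt (s T)) * (A T \<omega> - expectation (A T) - c * I T \<omega>)" for \<omega>
      proof -
        have "\<bar>J\<bar> = J * sgn J" "sgn J * sgn J = 1" using J by (auto simp: sgn_if)
        then show ?thesis using J elim(2) unfolding Y_def Y'_def c_def by (auto simp: field_simps sgn_if)
      qed
      then have "expectation (\<lambda>\<omega>. (Y T \<omega> - Y' T \<omega>)\<^sup>2) =
        \<kappa> / s T * expectation (\<lambda>\<omega>. (A T \<omega> - expectation (A T) - c * I T \<omega>)\<^sup>2)"
        using J elim(2) by (simp add: power_mult_distrib power_divide \<kappa>_def sgn_if)
      also have "\<dots> \<le> \<kappa> / s T * (2 * Q * (2 * \<epsilon> * s T / fact m +
          (2 * r) ^ CARD('n) * (T powr b * T) * measure lborel (ball (0 :: (real ^ 'n) \<times> real) (2 * R + 1))))"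
      proof (rule mult_left_mono)
        have far: "F.corr p q \<le> \<epsilon>" if "R < norm (fst p - fst q) \<or> R < \<bar>snd p - snd q\<bar>" for p q
          unfolding F.corr_def using that by (intro R(2)) auto
        show "expectation (\<lambda>\<omega>. (A T \<omega> - expectation (A T) - c * I T \<omega>)\<^sup>2) \<le> 2 * Q * (2 * \<epsilon> * s T / fact m +
          (2 * r) ^ CARD('n) * (T powr b * T) * measure lborel (ball (0 :: (real ^ 'n) \<times> real) (2 * R + 1)))"
          using F.remainder_second_moment_le[OF G m rank S(1,2)[OF elim(3)] ab(1) far R(1) \<epsilon>]
          unfolding A[symmetric] I[symmetric] s_eq[OF elim(3), symmetric] ab(2) J_def[symmetric] c_def[symmetric] Q_def g_def .
      qed (use elim(2) \<kappa> in simp)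
      also have "\<dots> = 4 * \<kappa> * Q * \<epsilon> / fact m + L * (T powr b * T / s T)"
        using elim(2) by (simp add: L_def field_simps)
      also have "4 * \<kappa> * Q * \<epsilon> / fact m = e / 2 * (Q / (Q + 1))"
      proof -
        have "Q + 1 \<noteq> 0" "8 * Q + 8 \<noteq> 0" "2 * Q + 2 \<noteq> 0" using Q by simp_all
        then show ?thesis using \<kappa> by (simp add: \<epsilon>_def) (simp add: field_simps)
      qed
      also have "\<dots> \<le> e / 2 * 1" using e Q by (intro mult_left_mono) auto
      finally have "expectation (\<lambda>\<omega>. (Y T \<omega> - Y' T \<omega>)\<^sup>2) < e" using elim(1) by linarith
      then show ?case by simp
    qed
  qed
  \<comment> \<open>The geometric facts about the cylinder were obtained for T > 0, so measurability
    and integrability are available eventually.\<close>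
  have T0: "\<forall>\<^sub>F T in at_top. (0::real) < T" by (rule eventually_gt_at_top)
  have mY: "\<forall>\<^sub>F T in at_top. Y T \<in> borel_measurable M" "\<forall>\<^sub>F T in at_top. Y' T \<in> borel_measurable M"
    by (rule eventually_mono[OF T0], use sqY sqY' in \<open>simp add: sq_integrable_def\<close>)+
  have sqd: "\<forall>\<^sub>F T in at_top. sq_integrable M (\<lambda>\<omega>. Y T \<omega> - Y' T \<omega>)" "\<forall>\<^sub>F T in at_top. sq_integrable M (\<lambda>\<omega>. Y' T \<omega> - Y T \<omega>)"
    by (rule eventually_mono[OF T0], intro sq_integrable_diff sqY sqY', assumption+)+
  have close': "((\<lambda>T. expectation (\<lambda>\<omega>. (Y' T \<omega> - Y T \<omega>)\<^sup>2)) \<longlongrightarrow> 0) at_top"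
    using close by (simp add: power2_commute)
  have "conv_in_distr M Y \<mu> \<longleftrightarrow> conv_in_distr M Y' \<mu>" if "real_distribution \<mu>" for \<mu>
    using conv_in_distr_L2_close[OF prob_space_axioms that mY sqd(1) close]
      conv_in_distr_L2_close[OF prob_space_axioms that mY(2,1) sqd(2) close'] by blast
  then show ?thesis
    unfolding Y_def[abs_def] Y'_def[abs_def] A_def I_def J_def s_def by blast
qed

end
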